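(* Let $\eta\in(0,1)$, $\tau\in[0,1]$, $\alpha\in\mathbb C$, $N_B>0$, $N_T=(1-\eta)N_B$, let $m$ be a positive integer, and let the bipartite resource $\rho_{SI}$ be the split coherent state with parameters $\alpha,\tau$. If $N_T>\frac{\eta\tau|\alpha|^2}2-1$, then $$\chi_{m\text{-}\mathrm{PSK}}^{\mathrm{coherent}}\ \ge\ \chi_{\mathrm{ring}}^{\mathrm{coherent}}-\xi(m),$$ where $$\xi(m)=\frac{e^{z}}{N_T+1}\exp\left(-\frac{\eta\tau|\alpha|^2}{N_T}\right)\sum_{\Delta=1}^\infty\frac{\left(\eta\tau|\alpha|^2/N_T^2\right)^{m\Delta}}{(m\Delta)!}\left(m^2\Delta^2K+2\right)\frac{q_\Delta^{m\Delta}}{(1-q_\Delta)^{m\Delta+1}},$$ with $z=\frac{\eta\tau|\alpha|^2}{N_T(N_T+1)}$, $K=\left(\left|\log\frac{N_T}{N_T+1}\right|+\log\left(1+\frac{\eta\tau|\alpha|^2}{N_T(N_T+1)}\right)\right)^2$ and $q_\Delta=\frac{N_T}{N_T+1}\left(1+\frac{\eta\tau|\alpha|^2}{N_T(N_T+1)(m\Delta+1)}\right)$.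
   Context: All logarithms are natural. Lossy thermal bosonic channel: with transmissivity $\eta\in(0,1)$ and noise mean photon number $N_B$, the channel mixes the input mode $\hat a$ with an environment mode $\hat c$ in the thermal state $\rho_{N_B}=\sum_{n\ge0}\frac{N_B^n}{(N_B+1)^{n+1}}|n\rangle\langle n|$ on a beamsplitter; the accessible output mode is $\hat b=\sqrt\eta\,\hat a+\sqrt{1-\eta}\,\hat c$ and the mode $\hat e=-\sqrt{1-\eta}\,\hat a+\sqrt\eta\,\hat c$ is lost (traced out). With $N_T=(1-\eta)N_B$ this is called the $(\eta,N_T)$-bosonic channel. Split coherent state: $\rho_{SI}$ is the two-mode output of a beamsplitter of transmissivity $\tau$ whose inputs are the coherent state $|\alpha\rangle\langle\alpha|$ and the vacuum; that is, $\rho_{SI}$ is the product of the coherent state of amplitude $\sqrt\tau\,\alpha$ in the signal mode $S$ and the coherent state of amplitude $\sqrt{1-\tau}\,\alpha$ in the idler mode $I$. $\rho_{BI}^{\theta}$ is the state obtained from $\rho_{SI}$ by applying the phase shift $\theta$ (unitary $e^{i\theta\hat a^\dagger\hat a}$) to the signal mode $S$ and then sending it through the $(\eta,N_T)$-bosonic channel (output mode $B$), the idler $I$ being left unchanged. Let $\mathbb H(\rho)=-\mathrm{tr}(\rho\log\rho)$ be the von Neumann entropy. The Holevo information of $m$-ary phase-shift keying and of the ring state are $$\chi_{m\text{-}\mathrm{PSK}}^{\mathrm{coherent}}=\mathbb H\Big(\frac1m\sum_{k=0}^{m-1}\rho_{BI}^{\theta=2\pi k/m}\Big)-\frac1m\sum_{k=0}^{m-1}\mathbb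 H\big(\rho_{BI}^{\theta=2\pi k/m}\big),\qquad \chi_{\mathrm{ring}}^{\mathrm{coherent}}=\mathbb H\Big(\frac1{2\pi}\int_0^{2\pi}\rho_{BI}^\theta\,d\theta\Big)-\frac1{2\pi}\int_0^{2\pi}\mathbb H(\rho_{BI}^\theta)\,d\theta .$$ *)

theory Defs
  imports "HOL-Analysis.Analysis"
begin

(* Vectors of the Hilbert space l2(I) and operators on it are given by their coordinates and
   matrix elements A i j = <i|A|j>.  One bosonic mode has I = nat (Fock basis), two modes have
   I = nat * nat. *)

type_synonym 'i ket = "'i \<Rightarrow> complex"
type_synonym 'i opr = "'i \<Rightarrow> 'i \<Rightarrow> complex"

definition op_one :: "'i opr" where
  "op_one i j = (if i = j then 1 else 0)"

definition op_times :: "'i opr \<Rightarrow> 'i opr \<Rightarrow> 'i opr" where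
  "op_times A B i j = (\<Sum>\<^sub>\<infinity>k. A i k * B k j)"

definition dagger :: "'i opr \<Rightarrow> 'i opr" where
  "dagger A i j = cnj (A j i)"

definition unitary_op :: "'i opr \<Rightarrow> bool" where
  "unitary_op U \<longleftrightarrow> op_times U (dagger U) = op_one \<and> op_times (dagger U) U = op_one"

definition conj_by :: "'i opr \<Rightarrow> 'i opr \<Rightarrow> 'i opr" where
  "conj_by U A = op_times (op_times U A) (dagger U)"

definition diag_op :: "('i \<Rightarrow> complex) \<Rightarrow> 'i opr" where
  "diag_op d i j = (if i = j then d i else 0)"

definition proj :: "'i ket \<Rightarrow> 'i opr" where
  "proj \<psi> i j = \<psi> i * cnj (\<psi> j)"

definition tensor_op :: "'i opr \<Rightarrow> 'j opr \<Rightarrow> ('i \<times> 'j) opr" where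
  "tensor_op A B x y = A (fst x) (fst y) * B (snd x) (snd y)"

definition partial_trace_snd :: "('i \<times> 'j) opr \<Rightarrow> 'i opr" where
  "partial_trace_snd A i i' = (\<Sum>\<^sub>\<infinity>j. A (i, j) (i', j))"

(* The extension (N \<otimes> id) of a linear map N on operators of the first subsystem. *)
definition on_fst :: "('i opr \<Rightarrow> 'i opr) \<Rightarrow> ('i \<times> 'j) opr \<Rightarrow> ('i \<times> 'j) opr" where
  "on_fst N A x y = N (\<lambda>i i'. A (i, snd x) (i', snd y)) (fst x) (fst y)"


(* A = V diag(p) V^dagger: the columns of V form an orthonormal eigenbasis of A with real
   eigenvalues p (repeated according to multiplicity).  Boundedness of p makes the
   matrix product absolutely convergent; it holds for every bounded operator A. *)
definition diagonalizes :: "'i opr \<Rightarrow> ('i \<Rightarrow> real) \<Rightarrow> 'i opr \<Rightarrow> bool" where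
  "diagonalizes V p A \<longleftrightarrow>
     unitary_op V \<and> bounded (range p) \<and> A = conj_by V (diag_op (\<lambda>k. complex_of_real (p k)))"

(* For f bounded on bounded sets, f(A) does not depend on the choice of the eigenbasis. *)
definition fun_calc :: "(real \<Rightarrow> real) \<Rightarrow> 'i opr \<Rightarrow> 'i opr" where
  "fun_calc f A =
     (SOME B. \<exists>V p. diagonalizes V p A \<and> B = conj_by V (diag_op (\<lambda>k. complex_of_real (f (p k)))))"

(* - tr (\<rho> log \<rho>), with values in [0,\<infinity>]: for a density operator, - \<rho> log \<rho> is a positive operator,
   so its diagonal entries are nonnegative.  At the eigenvalue 0, x * ln x has the value 0. *)
definition von_neumann_entropy :: "'i opr \<Rightarrow> ennreal" where
  "von_neumann_entropy \<rho> =
     (\<integral>\<^sup>+ i. ennreal (- Re (fun_calc (\<lambda>x. x * ln x) \<rho> i i)) \<partial>count_space UNIV)"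


definition coherent :: "complex \<Rightarrow> nat ket" where
  "coherent \<beta> n = complex_of_real (exp (- (cmod \<beta>)\<^sup>2 / 2)) * \<beta> ^ n / complex_of_real (sqrt (fact n))"

definition thermal :: "real \<Rightarrow> nat opr" where
  "thermal N = diag_op (\<lambda>n. complex_of_real (N ^ n / (N + 1) ^ (n + 1)))"

definition phase_unitary :: "real \<Rightarrow> nat opr" where
  "phase_unitary \<theta> = diag_op (\<lambda>n. cis (\<theta> * real n))"

definition vac2 :: "(nat \<times> nat) ket" where
  "vac2 x = (if x = (0, 0) then 1 else 0)"

(* In the next two definitions the square root vanishes where the predecessor truncates. *)
definition create_fst :: "(nat \<times> nat) ket \<Rightarrow> (nat \<times> nat) ket" where
  "create_fst \<psi> = (\<lambda>(n, k). complex_of_real (sqrt (real n)) * \<psi> (n - 1, k))"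

definition create_snd :: "(nat \<times> nat) ket \<Rightarrow> (nat \<times> nat) ket" where
  "create_snd \<psi> = (\<lambda>(n, k). complex_of_real (sqrt (real k)) * \<psi> (n, k - 1))"

definition annih_fst :: "(nat \<times> nat) ket \<Rightarrow> (nat \<times> nat) ket" where
  "annih_fst \<psi> = (\<lambda>(n, k). complex_of_real (sqrt (real (n + 1))) * \<psi> (n + 1, k))"

definition annih_snd :: "(nat \<times> nat) ket \<Rightarrow> (nat \<times> nat) ket" where
  "annih_snd \<psi> = (\<lambda>(n, k). complex_of_real (sqrt (real (k + 1))) * \<psi> (n, k + 1))"

definition lin_comb :: "real \<Rightarrow> ('i ket \<Rightarrow> 'i ket) \<Rightarrow> real \<Rightarrow> ('i ket \<Rightarrow> 'i ket) \<Rightarrow> 'i ket \<Rightarrow> 'i ket" where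
  "lin_comb r A s B \<psi> = (\<lambda>i. complex_of_real r * A \<psi> i + complex_of_real s * B \<psi> i)"

(* The unitary U with U^dagger a U = sqrt \<eta> a + sqrt (1-\<eta>) c, U^dagger c U = - sqrt (1-\<eta>) a + sqrt \<eta> c
   and U|0,0> = |0,0>, where a and c annihilate in the first and second mode; the outputs b and e
   occupy the first and second mode.  Column (n,k) is
     U |n,k> = (U a^dagger U^dagger)^n (U c^dagger U^dagger)^k |0,0> / sqrt (n! k!),
   with U a^dagger U^dagger = sqrt \<eta> a^dagger - sqrt (1-\<eta>) c^dagger
   and  U c^dagger U^dagger = sqrt (1-\<eta>) a^dagger + sqrt \<eta> c^dagger.
   The Heisenberg relations are proved, column by column, below. *)
definition beamsplitter :: "real \<Rightarrow> (nat \<times> nat) opr" where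
  "beamsplitter \<eta> x y =
     ((lin_comb (sqrt \<eta>) create_fst (- sqrt (1 - \<eta>)) create_snd ^^ fst y)
      ((lin_comb (sqrt (1 - \<eta>)) create_fst (sqrt \<eta>) create_snd ^^ snd y) vac2)) x
     / complex_of_real (sqrt (fact (fst y) * fact (snd y)))"

lemma beamsplitter_vacuum: "beamsplitter \<eta> x (0, 0) = vac2 x"
  by (simp add: beamsplitter_def)

lemma lin_comb_create_linear:
  "lin_comb r create_fst s create_snd (\<lambda>x. f x + c * g x) =
     (\<lambda>x. lin_comb r create_fst s create_snd f x + c * lin_comb r create_fst s create_snd g x)"
  by (auto simp: fun_eq_iff lin_comb_def create_fst_def create_snd_def algebra_simps)

lemma annih_linear:
  "annih_fst (\<lambda>x. f x / c) = (\<lambda>x. annih_fst f x / c)"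
  "annih_snd (\<lambda>x. f x / c) = (\<lambda>x. annih_snd f x / c)"
  by (auto simp: fun_eq_iff annih_fst_def annih_snd_def)

lemma sqrt_nat_mult_self:
  "complex_of_real (sqrt (real k)) * (complex_of_real (sqrt (real k)) * u) = of_nat k * u"
proof -
  have "complex_of_real (sqrt (real k)) * complex_of_real (sqrt (real k)) = of_nat k"
    unfolding of_real_mult[symmetric] by simp
  then show ?thesis by (simp add: mult.assoc[symmetric])
qed

lemma annih_create_comm:
  "annih_fst (lin_comb r create_fst s create_snd \<psi>) =
     (\<lambda>x. lin_comb r create_fst s create_snd (annih_fst \<psi>) x + complex_of_real r * \<psi> x)"
  "annih_snd (lin_comb r create_fst s create_snd \<psi>) =
     (\<lambda>x. lin_comb r create_fst s create_snd (annih_snd \<psi>) x + complex_of_real s * \<psi> x)"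
proof -
  have sq: "complex_of_real (sqrt (1 + real k)) * (complex_of_real (sqrt (1 + real k)) * u)
      = (1 + of_nat k) * u" for k u
    using sqrt_nat_mult_self[of "Suc k" u] by simp
  have sq': "complex_of_real (sqrt (1 + real k)) * (complex_of_real t *
      (complex_of_real (sqrt (1 + real k)) * u)) = complex_of_real t * ((1 + of_nat k) * u)" for k t u
    using sq[of k u] by (simp add: mult.left_commute)
  have "annih_fst (lin_comb r create_fst s create_snd \<psi>) (n, k) =
      lin_comb r create_fst s create_snd (annih_fst \<psi>) (n, k) + complex_of_real r * \<psi> (n, k)" for n k
    by (cases n) (simp_all add: annih_fst_def lin_comb_def create_fst_def create_snd_def
        distrib_left sq sq', simp_all add: algebra_simps)
  moreover have "annih_snd (lin_comb r create_fst s create_snd \<psi>) (n, k) =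
      lin_comb r create_fst s create_snd (annih_snd \<psi>) (n, k) + complex_of_real s * \<psi> (n, k)" for n k
    by (cases k) (simp_all add: annih_snd_def lin_comb_def create_fst_def create_snd_def
        distrib_left sq sq', simp_all add: algebra_simps)
  ultimately show
    "annih_fst (lin_comb r create_fst s create_snd \<psi>) =
       (\<lambda>x. lin_comb r create_fst s create_snd (annih_fst \<psi>) x + complex_of_real r * \<psi> x)"
    "annih_snd (lin_comb r create_fst s create_snd \<psi>) =
       (\<lambda>x. lin_comb r create_fst s create_snd (annih_snd \<psi>) x + complex_of_real s * \<psi> x)"
    by (auto simp: fun_eq_iff)
qed

lemma annih_power_aux:
  fixes L A :: "'i ket \<Rightarrow> 'i ket"
  assumes lin: "\<And>f c g. L (\<lambda>x. f x + c * g x) = (\<lambda>x. L f x + c * L g x)"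
    and comm: "\<And>\<psi>. A (L \<psi>) = (\<lambda>x. L (A \<psi>) x + r * \<psi> x)"
  shows "A ((L ^^ n) \<psi>) = (\<lambda>x. (L ^^ n) (A \<psi>) x + of_nat n * r * (L ^^ (n - 1)) \<psi> x)"
proof (induction n)
  case 0
  then show ?case by simp
next
  case (Suc n)
  have "A ((L ^^ Suc n) \<psi>) = (\<lambda>x. L (A ((L ^^ n) \<psi>)) x + r * (L ^^ n) \<psi> x)"
    by (simp add: comm)
  also have "\<dots> = (\<lambda>x. (L ^^ Suc n) (A \<psi>) x + of_nat n * r * L ((L ^^ (n - 1)) \<psi>) x
                       + r * (L ^^ n) \<psi> x)"
    unfolding Suc.IH lin by simp
  also have "\<dots> = (\<lambda>x. (L ^^ Suc n) (A \<psi>) x + of_nat (Suc n) * r * (L ^^ (Suc n - 1)) \<psi> x)"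
    by (cases n) (auto simp: fun_eq_iff algebra_simps)
  finally show ?case .
qed

lemma funpow_linear:
  fixes L :: "'i ket \<Rightarrow> 'i ket"
  assumes lin: "\<And>f c g. L (\<lambda>x. f x + c * g x) = (\<lambda>x. L f x + c * L g x)"
  shows "(L ^^ n) (\<lambda>x. f x + c * g x) = (\<lambda>x. (L ^^ n) f x + c * (L ^^ n) g x)"
  by (induction n) (simp_all add: lin)

lemma fact_sqrt_step:
  "of_nat n * u / complex_of_real (sqrt (fact n * c)) =
     complex_of_real (sqrt (real n)) * (u / complex_of_real (sqrt (fact (n - 1) * c)))"
proof (cases n)
  case 0
  then show ?thesis by simp
next
  case (Suc k)
  have "complex_of_real (sqrt (real n)) * complex_of_real (sqrt (real n)) = of_nat n"
    using sqrt_nat_mult_self[of n 1] by simp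
  moreover have "sqrt (fact n * c) = sqrt (real n) * sqrt (fact (n - 1) * c)"
    unfolding real_sqrt_mult[symmetric] using Suc by (simp add: mult.assoc)
  moreover have "complex_of_real (sqrt (real n)) \<noteq> 0"
    using Suc by simp
  ultimately show ?thesis
    by (cases "c = 0") (simp_all add: field_simps)
qed

(* a U = U (sqrt \<eta> a + sqrt (1-\<eta>) c) and c U = U (- sqrt (1-\<eta>) a + sqrt \<eta> c), applied to |n,k>. *)
lemma beamsplitter_heisenberg:
  "annih_fst (\<lambda>x. beamsplitter \<eta> x (n, k)) =
     (\<lambda>x. complex_of_real (sqrt \<eta>) * (complex_of_real (sqrt (real n)) * beamsplitter \<eta> x (n - 1, k))
        + complex_of_real (sqrt (1 - \<eta>)) * (complex_of_real (sqrt (real k)) * beamsplitter \<eta> x (n, k - 1)))"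
  "annih_snd (\<lambda>x. beamsplitter \<eta> x (n, k)) =
     (\<lambda>x. - complex_of_real (sqrt (1 - \<eta>)) * (complex_of_real (sqrt (real n)) * beamsplitter \<eta> x (n - 1, k))
        + complex_of_real (sqrt \<eta>) * (complex_of_real (sqrt (real k)) * beamsplitter \<eta> x (n, k - 1)))"
proof -
  let ?P = "lin_comb (sqrt \<eta>) create_fst (- sqrt (1 - \<eta>)) create_snd"
  let ?Q = "lin_comb (sqrt (1 - \<eta>)) create_fst (sqrt \<eta>) create_snd"
  let ?d = "complex_of_real (sqrt (fact n * fact k))"
  have gen: "A (\<lambda>x. beamsplitter \<eta> x (n, k)) =
     (\<lambda>x. r * (complex_of_real (sqrt (real n)) * beamsplitter \<eta> x (n - 1, k))
        + s * (complex_of_real (sqrt (real k)) * beamsplitter \<eta> x (n, k - 1)))"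
    if P: "\<And>\<psi>. A (?P \<psi>) = (\<lambda>x. ?P (A \<psi>) x + r * \<psi> x)"
      and Q: "\<And>\<psi>. A (?Q \<psi>) = (\<lambda>x. ?Q (A \<psi>) x + s * \<psi> x)"
      and v: "A vac2 = (\<lambda>x. 0)" and d: "\<And>f c. A (\<lambda>x. f x / c) = (\<lambda>x. A f x / c)"
    for A r s
  proof
    fix x
    have zero: "(?Q ^^ k) (\<lambda>x. 0) = (\<lambda>x. 0)"
      by (induction k) (auto simp: lin_comb_def create_fst_def create_snd_def fun_eq_iff)
    have Qk: "A ((?Q ^^ k) vac2) = (\<lambda>x. 0 + of_nat k * s * (?Q ^^ (k - 1)) vac2 x)"
      using annih_power_aux[of ?Q A s k vac2, OF lin_comb_create_linear Q]
      by (simp add: v zero)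
    have zero': "(?P ^^ n) (\<lambda>x. 0) = (\<lambda>x. 0)"
      by (induction n) (auto simp: lin_comb_def create_fst_def create_snd_def fun_eq_iff)
    have PQ: "A ((?P ^^ n) ((?Q ^^ k) vac2)) x =
        of_nat k * s * (?P ^^ n) ((?Q ^^ (k - 1)) vac2) x
        + of_nat n * r * (?P ^^ (n - 1)) ((?Q ^^ k) vac2) x"
      unfolding annih_power_aux[of ?P A r n, OF lin_comb_create_linear P] Qk
        funpow_linear[of ?P, OF lin_comb_create_linear] by (simp add: zero')
    have "A (\<lambda>x. beamsplitter \<eta> x (n, k)) x = A ((?P ^^ n) ((?Q ^^ k) vac2)) x / ?d"
      unfolding beamsplitter_def by (simp add: d)
    also have "\<dots> = r * (of_nat n * (?P ^^ (n - 1)) ((?Q ^^ k) vac2) x / ?d)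
        + s * (of_nat k * (?P ^^ n) ((?Q ^^ (k - 1)) vac2) x
            / complex_of_real (sqrt (fact k * fact n)))"
      unfolding PQ by (simp add: add_divide_distrib algebra_simps)
    also have "\<dots> = r * (complex_of_real (sqrt (real n)) * beamsplitter \<eta> x (n - 1, k))
        + s * (complex_of_real (sqrt (real k)) * beamsplitter \<eta> x (n, k - 1))"
      unfolding fact_sqrt_step beamsplitter_def by (simp add: mult.commute)
    finally show "A (\<lambda>x. beamsplitter \<eta> x (n, k)) x =
        r * (complex_of_real (sqrt (real n)) * beamsplitter \<eta> x (n - 1, k))
        + s * (complex_of_real (sqrt (real k)) * beamsplitter \<eta> x (n, k - 1))" .
  qed
  have v: "annih_fst vac2 = (\<lambda>x. 0)" "annih_snd vac2 = (\<lambda>x. 0)"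
    by (auto simp: annih_fst_def annih_snd_def vac2_def)
  show "annih_fst (\<lambda>x. beamsplitter \<eta> x (n, k)) =
     (\<lambda>x. complex_of_real (sqrt \<eta>) * (complex_of_real (sqrt (real n)) * beamsplitter \<eta> x (n - 1, k))
        + complex_of_real (sqrt (1 - \<eta>)) * (complex_of_real (sqrt (real k)) * beamsplitter \<eta> x (n, k - 1)))"
    by (rule gen) (simp_all add: annih_create_comm v annih_linear)
  show "annih_snd (\<lambda>x. beamsplitter \<eta> x (n, k)) =
     (\<lambda>x. - complex_of_real (sqrt (1 - \<eta>)) * (complex_of_real (sqrt (real n)) * beamsplitter \<eta> x (n - 1, k))
        + complex_of_real (sqrt \<eta>) * (complex_of_real (sqrt (real k)) * beamsplitter \<eta> x (n, k - 1)))"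
    by (rule gen) (simp_all add: annih_create_comm v annih_linear)
qed

(* The (\<eta>, N_T)-bosonic channel with N_T = (1-\<eta>) N_B; the second output mode is lost. *)
definition bosonic_channel :: "real \<Rightarrow> real \<Rightarrow> nat opr \<Rightarrow> nat opr" where
  "bosonic_channel \<eta> N_B \<rho> =
     partial_trace_snd (conj_by (beamsplitter \<eta>) (tensor_op \<rho> (thermal N_B)))"

definition rho_SI :: "real \<Rightarrow> complex \<Rightarrow> (nat \<times> nat) opr" where
  "rho_SI \<tau> \<alpha> =
     tensor_op (proj (coherent (complex_of_real (sqrt \<tau>) * \<alpha>)))
               (proj (coherent (complex_of_real (sqrt (1 - \<tau>)) * \<alpha>)))"

definition rho_BI :: "real \<Rightarrow> real \<Rightarrow> real \<Rightarrow> complex \<Rightarrow> real \<Rightarrow> (nat \<times> nat) opr" where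
  "rho_BI \<eta> N_B \<tau> \<alpha> \<theta> =
     on_fst (bosonic_channel \<eta> N_B) (on_fst (conj_by (phase_unitary \<theta>)) (rho_SI \<tau> \<alpha>))"


definition psk_holevo :: "nat \<Rightarrow> (real \<Rightarrow> 'i opr) \<Rightarrow> ereal" where
  "psk_holevo m \<rho> =
     enn2ereal (von_neumann_entropy (\<lambda>i j. (\<Sum>k<m. \<rho> (2 * pi * real k / real m) i j) / of_nat m))
     - enn2ereal ((\<Sum>k<m. von_neumann_entropy (\<rho> (2 * pi * real k / real m))) / of_nat m)"

(* The operator-valued integral is taken entrywise (in the weak sense). *)
definition ring_holevo :: "(real \<Rightarrow> 'i opr) \<Rightarrow> ereal" where
  "ring_holevo \<rho> =
     enn2ereal (von_neumann_entropy
       (\<lambda>i j. integral {0..2 * pi} (\<lambda>\<theta>. \<rho> \<theta> i j) / complex_of_real (2 * pi)))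
     - enn2ereal ((\<integral>\<^sup>+ \<theta>\<in>{0..2 * pi}. von_neumann_entropy (\<rho> \<theta>) \<partial>lborel) / ennreal (2 * pi))"

definition chi_PSK_coherent :: "nat \<Rightarrow> real \<Rightarrow> real \<Rightarrow> real \<Rightarrow> complex \<Rightarrow> ereal" where
  "chi_PSK_coherent m \<eta> N_B \<tau> \<alpha> = psk_holevo m (rho_BI \<eta> N_B \<tau> \<alpha>)"

definition chi_ring_coherent :: "real \<Rightarrow> real \<Rightarrow> real \<Rightarrow> complex \<Rightarrow> ereal" where
  "chi_ring_coherent \<eta> N_B \<tau> \<alpha> = ring_holevo (rho_BI \<eta> N_B \<tau> \<alpha>)"

(* The summation index \<Delta> = 1, 2, ... is written Suc D with D = 0, 1, ... *)
definition xi :: "real \<Rightarrow> real \<Rightarrow> complex \<Rightarrow> real \<Rightarrow> nat \<Rightarrow> real" where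
  "xi \<eta> \<tau> \<alpha> N_T m =
     (let s = \<eta> * \<tau> * (cmod \<alpha>)\<^sup>2;
          z = s / (N_T * (N_T + 1));
          K = (\<bar>ln (N_T / (N_T + 1))\<bar> + ln (1 + s / (N_T * (N_T + 1))))\<^sup>2;
          q = (\<lambda>\<Delta>::nat. N_T / (N_T + 1) * (1 + s / (N_T * (N_T + 1) * (real m * real \<Delta> + 1))));
          t = (\<lambda>\<Delta>::nat. (s / N_T\<^sup>2) ^ (m * \<Delta>) / fact (m * \<Delta>)
                 * ((real m)\<^sup>2 * (real \<Delta>)\<^sup>2 * K + 2)
                 * (q \<Delta> ^ (m * \<Delta>) / (1 - q \<Delta>) ^ (m * \<Delta> + 1)))
      in exp z / (N_T + 1) * exp (- (s / N_T)) * (\<Sum>D. t (Suc D)))"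

end

theory Submission
  imports Defs
begin

text \<open>
  Number conservation of the beamsplitter makes the channel covariant under phase rotations, so all
  states of the family have the same entropy h (possibly infinite; no finiteness is needed), the ring
  average is the diagonal part of one displaced thermal state sigma in the Fock basis, and the m-ary
  average keeps exactly the entries with i congruent to j modulo m. The idler is a fixed pure factor and
  does not change entropies. Hence the claim compares the entropy of the pinched matrix A with the
  entropy of its diagonal p. In an eigenbasis of A the inequality ln x \<le> x - 1 gives, for every i,
  - p i ln (p i) \<le> (- A ln A) i i + (sum over j \<noteq> i of (A i j)^2 / p i).
  The Heisenberg relations yield a recursion that determines sigma, whose entries are Laguerre
  polynomials; elementary bounds on these estimate the sum of the excess terms by xi(m). Half of the
  constant 2 in xi(m) pays for the entries above the diagonal and half for those below it.

  An eigenbasis exists since A is, up to phases, a positive real Hilbert-Schmidt matrix: by weak compactness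
  the quadratic form attains its maximum on the unit ball of the orthogonal complement of any system of
  eigenvectors, so a maximal orthonormal system of eigenvectors is total.
\<close>

section \<open>Operators on square-summable sequences\<close>

text \<open>\<open>fun_calc\<close> takes its value from a \<open>SOME\<close>, so an entropy can be
  evaluated only once an eigenbasis is exhibited and independence of the choice is proved. All
  phases in the problem are diagonal unitaries, and stripping them leaves real matrices.

  The comparison is made row by row with values in [0,\<infinity>], so infinite entropies meet no
  subtraction before the end. Let s = \<eta>\<tau>|\<alpha>|^2, N = N_T, y = s/(N(N+1)), d =
  m\<Delta>. The entries at (n+d,n) and (n,n+d) together cost, up to a common prefactor, at most 2
  y^d/d! times binomial(n+d,d) q_\<Delta>^n; the sum over n is a negative binomial series with value
  1/(1-q_\<Delta>)^(d+1), the denominator in xi. It converges for q_\<Delta> < 1, and N_T > s/2 - 1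
  says exactly that the formula for q_\<Delta> with 1 in place of m\<Delta> gives less than 1. Since
  y = (s/N^2) N/(N+1) and N/(N+1) <= q_\<Delta>, the power y^d accounts for both (s/N^2)^d and
  q_\<Delta>^d.\<close>

lemma abs_mult_le_sum_squares: "\<bar>a * b\<bar> \<le> a\<^sup>2 + b\<^sup>2" for a b :: real
proof -
  have "2 * (\<bar>a\<bar> * \<bar>b\<bar>) \<le> a\<^sup>2 + b\<^sup>2"
    using sum_squares_bound[of "\<bar>a\<bar>" "\<bar>b\<bar>"] by (simp add: mult.assoc)
  moreover have "0 \<le> \<bar>a\<bar> * \<bar>b\<bar>" by simp
  ultimately show ?thesis unfolding abs_mult by linarith
qed

lemma mult_cnj_weighted: "z * complex_of_real d * cnj z = complex_of_real ((cmod z)\<^sup>2 * d)"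
  by (simp only: of_real_mult complex_norm_square) (simp add: mult_ac)

lemma has_sum_finite_sum:
  fixes f :: "'a \<Rightarrow> 'b \<Rightarrow> 'c::topological_comm_monoid_add"
  assumes "finite I" "\<And>i. i \<in> I \<Longrightarrow> (f i has_sum s i) A"
  shows "((\<lambda>x. \<Sum>i\<in>I. f i x) has_sum (\<Sum>i\<in>I. s i)) A"
  using assms by (induction I rule: finite_induct) (auto intro!: has_sum_add)

lemma has_sum_single:
  fixes f :: "'a \<Rightarrow> 'b::{topological_comm_monoid_add, t2_space}"
  assumes "\<And>x. x \<noteq> a \<Longrightarrow> f x = 0"
  shows "(f has_sum f a) UNIV"
  by (rule has_sum_finite_neutralI[of "{a}"]) (use assms in auto)

text \<open>A family that is not summable has \<open>infsum\<close> 0 in both types, so the identity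
  is unconditional.\<close>

lemma infsum_complex_of_real:
  "(\<Sum>\<^sub>\<infinity>x\<in>A. complex_of_real (f x)) = complex_of_real (\<Sum>\<^sub>\<infinity>x\<in>A. f x)"
proof (cases "f summable_on A")
  case True
  then show ?thesis by (intro infsumI has_sum_of_real has_sum_infsum)
next
  case False
  then have "\<not> (\<lambda>x. complex_of_real (f x)) summable_on A"
    using summable_on_Re by fastforce
  then show ?thesis using False by (simp add: infsum_not_exists)
qed

text \<open>Over the complex numbers unconditional summability is absolute, so the product family is
  summable on the product set and the iterated sum identifies its value.\<close>

lemma has_sum_complex_mult_Times:
  fixes f :: "'a \<Rightarrow> complex" and g :: "'b \<Rightarrow> complex"
  assumes f: "(f has_sum a) UNIV" and g: "(g has_sum b) UNIV"
  shows "((\<lambda>(x, y). f x * g y) has_sum a * b) UNIV"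
proof -
  have "(\<lambda>x. cmod (f x)) summable_on UNIV" "(\<lambda>x. cmod (g x)) summable_on UNIV"
    using f g by (simp_all only: summable_on_iff_abs_summable_on_complex[symmetric] has_sum_imp_summable)
  then have "(\<lambda>p. cmod (f (fst p) * g (snd p))) summable_on (SIGMA x:UNIV. UNIV)"
    unfolding Infinite_Sum.abs_summable_on_Sigma_iff
    by (simp add: norm_mult abs_mult summable_on_cmult_right infsum_cmult_right' summable_on_cmult_left)
  then have sm: "(\<lambda>p. f (fst p) * g (snd p)) summable_on (SIGMA x:UNIV. UNIV)"
    by (rule abs_summable_summable)
  have "((\<lambda>p. f (fst p) * g (snd p)) has_sum a * b) (SIGMA x:UNIV. UNIV)"
    by (rule has_sum_SigmaI[OF _ _ sm, where g = "\<lambda>x. f x * b"])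
      (auto intro!: has_sum_cmult_right has_sum_cmult_left f g)
  then show ?thesis by (simp add: case_prod_unfold)
qed

section \<open>Square-summable coordinate vectors\<close>

definition sq_summable :: "'i ket \<Rightarrow> bool" where
  "sq_summable x \<longleftrightarrow> (\<lambda>i. (cmod (x i))\<^sup>2) summable_on UNIV"

text \<open>The default 0 of a divergent sum makes a bound on \<open>norm_sq x\<close> meaningful
  only next to \<open>sq_summable x\<close>.\<close>

definition norm_sq :: "'i ket \<Rightarrow> real" where
  "norm_sq x = (\<Sum>\<^sub>\<infinity>i. (cmod (x i))\<^sup>2)"

lemma norm_sq_nonneg: "0 \<le> norm_sq x"
  unfolding norm_sq_def by (rule infsum_nonneg) simp

lemma sum_le_norm_sq:
  assumes "sq_summable x" "finite F"
  shows "(\<Sum>i\<in>F. (cmod (x i))\<^sup>2) \<le> norm_sq x"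
  using assms unfolding norm_sq_def sq_summable_def by (intro finite_sum_le_infsum) auto

lemma sq_summableI:
  assumes "\<And>F. finite F \<Longrightarrow> (\<Sum>i\<in>F. (cmod (x i))\<^sup>2) \<le> C"
  shows "sq_summable x" "norm_sq x \<le> C"
proof -
  show *: "sq_summable x"
    unfolding sq_summable_def
    by (rule nonneg_bdd_above_summable_on) (use assms in \<open>auto simp: bdd_above_def\<close>)
  show "norm_sq x \<le> C"
    unfolding norm_sq_def
    by (rule infsum_le_finite_sums) (use * assms in \<open>auto simp: sq_summable_def\<close>)
qed

lemma sq_summable_mult:
  assumes "sq_summable x" "sq_summable y"
  shows "(\<lambda>i. x i * y i) summable_on UNIV"
proof -
  have "(\<lambda>i. cmod (x i * x i)) summable_on UNIV" "(\<lambda>i. cmod (y i * y i)) summable_on UNIV"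
    using assms by (auto simp: sq_summable_def norm_mult power2_eq_square)
  from abs_summable_product[OF this] show ?thesis by (rule abs_summable_summable)
qed

lemma sq_summable_bounded_mult:
  assumes "sq_summable x" "\<And>i. cmod (d i) \<le> C"
  shows "sq_summable (\<lambda>i. d i * x i)"
  unfolding sq_summable_def
proof (rule summable_on_comparison_test)
  show "(\<lambda>i. C\<^sup>2 * (cmod (x i))\<^sup>2) summable_on UNIV"
    using assms(1) unfolding sq_summable_def by (rule summable_on_cmult_right)
  show "(cmod (d i * x i))\<^sup>2 \<le> C\<^sup>2 * (cmod (x i))\<^sup>2" for i
    using assms(2)[of i] by (simp add: norm_mult power_mult_distrib mult_right_mono power_mono)
qed simp

lemma sq_summable_cnj: "sq_summable x \<Longrightarrow> sq_summable (\<lambda>i. cnj (x i))"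
  by (simp add: sq_summable_def)

text \<open>The squared norm of the tail outside \<open>F\<close> tends to 0 along finite sets; this
  is the error term in the interchange of sums below.\<close>

lemma norm_sq_split:
  assumes "sq_summable x" "finite F"
  shows "sq_summable (\<lambda>i. if i \<in> F then 0 else x i)"
    "norm_sq (\<lambda>i. if i \<in> F then 0 else x i) = norm_sq x - (\<Sum>i\<in>F. (cmod (x i))\<^sup>2)"
proof -
  have "((\<lambda>i. (cmod (x i))\<^sup>2) has_sum norm_sq x) UNIV"
    using assms(1) by (simp add: sq_summable_def norm_sq_def)
  from has_sum_Diff[OF this has_sum_finite[OF assms(2)]]
  have "((\<lambda>i. (cmod (x i))\<^sup>2) has_sum norm_sq x - (\<Sum>i\<in>F. (cmod (x i))\<^sup>2)) (UNIV - F)" by simp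
  then have "((\<lambda>i. (cmod (if i \<in> F then 0 else x i))\<^sup>2) has_sum norm_sq x - (\<Sum>i\<in>F. (cmod (x i))\<^sup>2)) UNIV"
    by (rule has_sum_cong_neutral[THEN iffD1, rotated 3]) auto
  then show "sq_summable (\<lambda>i. if i \<in> F then 0 else x i)"
    "norm_sq (\<lambda>i. if i \<in> F then 0 else x i) = norm_sq x - (\<Sum>i\<in>F. (cmod (x i))\<^sup>2)"
    by (auto simp: sq_summable_def norm_sq_def has_sum_imp_summable infsumI)
qed

lemma Cauchy_Schwarz_infsum:
  assumes "sq_summable x" "sq_summable y"
  shows "cmod (\<Sum>\<^sub>\<infinity>i. x i * y i) \<le> sqrt (norm_sq x) * sqrt (norm_sq y)"
proof (rule tendsto_upperbound)
  show "((\<lambda>F. cmod (\<Sum>i\<in>F. x i * y i)) \<longlongrightarrow> cmod (\<Sum>\<^sub>\<infinity>i. x i * y i)) (finite_subsets_at_top UNIV)"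
    by (intro tendsto_norm infsum_tendsto sq_summable_mult assms)
  have "cmod (\<Sum>i\<in>F. x i * y i) \<le> sqrt (norm_sq x) * sqrt (norm_sq y)" if "finite F" for F
  proof -
    have "cmod (\<Sum>i\<in>F. x i * y i) \<le> (\<Sum>i\<in>F. \<bar>cmod (x i)\<bar> * \<bar>cmod (y i)\<bar>)"
      by (rule order_trans[OF norm_sum]) (simp add: norm_mult)
    also have "\<dots> \<le> L2_set (\<lambda>i. cmod (x i)) F * L2_set (\<lambda>i. cmod (y i)) F"
      by (rule L2_set_mult_ineq)
    also have "\<dots> \<le> sqrt (norm_sq x) * sqrt (norm_sq y)"
      unfolding L2_set_def
      by (intro mult_mono real_sqrt_le_mono sum_le_norm_sq assms that)
        (auto simp: norm_sq_nonneg intro!: sum_nonneg)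
    finally show ?thesis .
  qed
  then show "\<forall>\<^sub>F F in finite_subsets_at_top UNIV. cmod (\<Sum>i\<in>F. x i * y i) \<le> sqrt (norm_sq x) * sqrt (norm_sq y)"
    by (intro eventually_finite_subsets_at_top_weakI) auto
qed simp

section \<open>Unitary matrices acting on square-summable vectors\<close>

definition apply_op :: "'i opr \<Rightarrow> 'i ket \<Rightarrow> 'i ket" where
  "apply_op A x i = (\<Sum>\<^sub>\<infinity>k. A i k * x k)"

lemma unitary_op_dagger: "unitary_op U \<Longrightarrow> unitary_op (dagger U)"
  by (simp add: unitary_op_def dagger_def[abs_def])

text \<open>\<open>unitary_op\<close> only equates \<open>infsum\<close> values, but a divergent sum
  would be 0, so the diagonal value 1 already forces the columns to be square summable. The
  off-diagonal series then converge as products of square-summable vectors.\<close>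

lemma unitary_op_col:
  assumes "unitary_op U"
  shows "((\<lambda>k. cnj (U k i) * U k j) has_sum (if i = j then 1 else 0)) UNIV"
    and "sq_summable (\<lambda>k. U k i)"
proof -
  have val: "(\<Sum>\<^sub>\<infinity>k. cnj (U k i) * U k j) = (if i = j then 1 else 0)" for i j
    using assms unfolding unitary_op_def
    by (auto simp: fun_eq_iff op_times_def dagger_def op_one_def)
  have sq: "sq_summable (\<lambda>k. U k i)" for i
  proof -
    have "(\<lambda>k. cnj (U k i) * U k i) summable_on UNIV"
      using val[of i i] infsum_not_exists by fastforce
    then have "(\<lambda>k. cmod (cnj (U k i) * U k i)) summable_on UNIV"
      by (simp only: summable_on_iff_abs_summable_on_complex[symmetric])
    then show ?thesis by (simp add: sq_summable_def norm_mult power2_eq_square)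
  qed
  then show "sq_summable (\<lambda>k. U k i)" .
  show "((\<lambda>k. cnj (U k i) * U k j) has_sum (if i = j then 1 else 0)) UNIV"
    using has_sum_infsum[OF sq_summable_mult[OF sq_summable_cnj[OF sq[of i]] sq[of j]]]
    unfolding val .
qed

lemma unitary_op_row:
  assumes "unitary_op U"
  shows "((\<lambda>k. U i k * cnj (U j k)) has_sum (if i = j then 1 else 0)) UNIV"
    and "sq_summable (\<lambda>k. U i k)"
  using unitary_op_col(1)[OF unitary_op_dagger[OF assms], of i j]
    sq_summable_cnj[OF unitary_op_col(2)[OF unitary_op_dagger[OF assms], of i]]
  by (simp_all add: dagger_def)

lemma unitary_opI:
  assumes "\<And>i j. ((\<lambda>k. U i k * cnj (U j k)) has_sum (if i = j then 1 else 0)) UNIV"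
    and "\<And>i j. ((\<lambda>k. cnj (U k i) * U k j) has_sum (if i = j then 1 else 0)) UNIV"
  shows "unitary_op U"
  using assms[THEN infsumI]
  by (simp add: unitary_op_def fun_eq_iff op_times_def dagger_def op_one_def)

lemma unitary_op_transpose:
  assumes "unitary_op U"
  shows "unitary_op (\<lambda>i j. U j i)"
proof (rule unitary_opI)
  fix i j
  show "((\<lambda>k. U k i * cnj (U k j)) has_sum (if i = j then 1 else 0)) UNIV"
    using unitary_op_col(1)[OF assms, of j i] by (cases "i = j") (simp_all add: mult.commute)
  show "((\<lambda>k. cnj (U i k) * U j k) has_sum (if i = j then 1 else 0)) UNIV"
    using unitary_op_row(1)[OF assms, of j i] by (cases "i = j") (simp_all add: mult.commute)
qed

text \<open>On finitely supported vectors column orthonormality gives equality of norms; the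
  inequality is what passes to the limit directly. Together with the same bound for
  \<open>dagger U\<close> it amounts to isometry.\<close>

lemma unitary_op_contraction:
  assumes U: "unitary_op U" and c: "sq_summable c"
  shows "sq_summable (apply_op U c)" "norm_sq (apply_op U c) \<le> norm_sq c"
proof -
  have fin: "(\<Sum>k\<in>F. (cmod (\<Sum>l\<in>G. U k l * c l))\<^sup>2) \<le> norm_sq c" if F: "finite F" and G: "finite G" for F G
  proof -
    let ?f = "\<lambda>k. \<Sum>l\<in>G. U k l * c l"
    have "((\<lambda>k. \<Sum>l\<in>G. \<Sum>l'\<in>G. cnj (U k l) * U k l' * (cnj (c l) * c l'))
        has_sum (\<Sum>l\<in>G. \<Sum>l'\<in>G. (if l = l' then 1 else 0) * (cnj (c l) * c l'))) UNIV"
      by (intro has_sum_finite_sum[OF G] has_sum_cmult_left unitary_op_col(1)[OF U])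
    moreover have "(\<Sum>l\<in>G. \<Sum>l'\<in>G. cnj (U k l) * U k l' * (cnj (c l) * c l')) = of_real ((cmod (?f k))\<^sup>2)" for k
      unfolding complex_norm_square cnj_sum sum_product complex_cnj_mult
      by (subst sum.swap) (simp add: mult_ac)
    moreover have "(\<Sum>l\<in>G. \<Sum>l'\<in>G. (if l = l' then 1 else 0) * (cnj (c l) * c l')) = of_real (\<Sum>l\<in>G. (cmod (c l))\<^sup>2)"
      using G by (simp add: if_distrib[of "\<lambda>x. x * _"] complex_norm_square[symmetric] mult.commute[of "cnj _"]
          cong: if_cong del: of_real_power)
    ultimately have "((\<lambda>k. complex_of_real ((cmod (?f k))\<^sup>2)) has_sum of_real (\<Sum>l\<in>G. (cmod (c l))\<^sup>2)) UNIV"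
      by simp
    then have "((\<lambda>k. (cmod (?f k))\<^sup>2) has_sum (\<Sum>l\<in>G. (cmod (c l))\<^sup>2)) UNIV"
      by (simp only: has_sum_of_real_iff)
    then have "(\<Sum>k\<in>F. (cmod (?f k))\<^sup>2) \<le> (\<Sum>l\<in>G. (cmod (c l))\<^sup>2)"
      by (rule finite_sum_le_has_sum) (use F in auto)
    also have "\<dots> \<le> norm_sq c" by (rule sum_le_norm_sq[OF c G])
    finally show ?thesis .
  qed
  have "(\<Sum>k\<in>F. (cmod (apply_op U c k))\<^sup>2) \<le> norm_sq c" if F: "finite F" for F
  proof (rule tendsto_upperbound)
    show "((\<lambda>G. \<Sum>k\<in>F. (cmod (\<Sum>l\<in>G. U k l * c l))\<^sup>2) \<longlongrightarrow> (\<Sum>k\<in>F. (cmod (apply_op U c k))\<^sup>2))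
        (finite_subsets_at_top UNIV)"
      unfolding apply_op_def
      by (intro tendsto_intros infsum_tendsto sq_summable_mult unitary_op_row(2)[OF U] c)
    show "\<forall>\<^sub>F G in finite_subsets_at_top UNIV. (\<Sum>k\<in>F. (cmod (\<Sum>l\<in>G. U k l * c l))\<^sup>2) \<le> norm_sq c"
      using fin F by (intro eventually_finite_subsets_at_top_weakI) auto
  qed simp
  from sq_summableI[OF this] show "sq_summable (apply_op U c)" "norm_sq (apply_op U c) \<le> norm_sq c"
    by auto
qed

text \<open>The interchange is not an instance of Fubini: the double series need not converge absolutely.\<close>
lemma unitary_op_swap:
  assumes U: "unitary_op U" and a: "sq_summable a" and c: "sq_summable c"
  shows "(\<Sum>\<^sub>\<infinity>k. a k * (\<Sum>\<^sub>\<infinity>l. U k l * c l)) = (\<Sum>\<^sub>\<infinity>l. (\<Sum>\<^sub>\<infinity>k. a k * U k l) * c l)"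
proof -
  let ?U = "\<lambda>i j. U j i" and ?F = "finite_subsets_at_top (UNIV :: 'a set)"
  let ?R = "\<Sum>\<^sub>\<infinity>l. apply_op ?U a l * c l"
  let ?B = "\<lambda>F. sqrt (norm_sq a - (\<Sum>i\<in>F. (cmod (a i))\<^sup>2)) * sqrt (norm_sq c)"
  have eq: "apply_op ?U x l = (\<Sum>\<^sub>\<infinity>k. x k * U k l)" for x l
    unfolding apply_op_def by (simp add: mult.commute)
  have sqU: "sq_summable (apply_op ?U x)" if "sq_summable x" for x
    using unitary_op_contraction(1)[OF unitary_op_transpose[OF U] that] .
  let ?s = "\<lambda>F. \<Sum>k\<in>F. a k * apply_op U c k"
  have lim1: "(?s \<longlongrightarrow> (\<Sum>\<^sub>\<infinity>k. a k * apply_op U c k)) ?F"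
    by (intro infsum_tendsto sq_summable_mult a unitary_op_contraction(1)[OF U c])
  \<comment> \<open>For finite \<open>F\<close> the sums may be exchanged, so the discrepancy is the
    same expression with \<open>a\<close> replaced by its tail outside \<open>F\<close>. The
    transpose of \<open>U\<close> being a contraction, Cauchy-Schwarz bounds it by the norm of that
    tail.\<close>
  have bound: "cmod (?s F - ?R)
      \<le> ?B F" if F: "finite F" for F
  proof -
    let ?a = "\<lambda>i. if i \<in> F then 0 else a i"
    have "((\<lambda>l. \<Sum>k\<in>F. a k * (U k l * c l)) has_sum ?s F) UNIV"
      unfolding apply_op_def
      by (intro has_sum_finite_sum[OF F] has_sum_cmult_right has_sum_infsum sq_summable_mult
          unitary_op_row(2)[OF U] c)
    moreover have "((\<lambda>l. apply_op ?U a l * c l) has_sum ?R) UNIV"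
      by (intro has_sum_infsum sq_summable_mult sqU a c)
    ultimately have "((\<lambda>l. apply_op ?U a l * c l + - (\<Sum>k\<in>F. a k * (U k l * c l)))
        has_sum ?R + - ?s F) UNIV"
      by (intro has_sum_add has_sum_uminusI)
    moreover have "apply_op ?U a l * c l + - (\<Sum>k\<in>F. a k * (U k l * c l)) = apply_op ?U ?a l * c l" for l
    proof -
      have "((\<lambda>k. a k * U k l) has_sum apply_op ?U a l) UNIV"
        unfolding eq by (intro has_sum_infsum sq_summable_mult a unitary_op_col(2)[OF U])
      from has_sum_Diff[OF this has_sum_finite[OF F]]
      have "((\<lambda>k. a k * U k l) has_sum apply_op ?U a l - (\<Sum>k\<in>F. a k * U k l)) (UNIV - F)" by simp
      then have "((\<lambda>k. ?a k * U k l) has_sum apply_op ?U a l - (\<Sum>k\<in>F. a k * U k l)) UNIV"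
        by (rule has_sum_cong_neutral[THEN iffD1, rotated 3]) auto
      then have "apply_op ?U ?a l = apply_op ?U a l - (\<Sum>k\<in>F. a k * U k l)"
        unfolding eq by (rule infsumI)
      then show ?thesis by (simp add: left_diff_distrib sum_distrib_right mult.assoc)
    qed
    ultimately have "(\<Sum>\<^sub>\<infinity>l. apply_op ?U ?a l * c l) = ?R - ?s F"
      by (simp add: infsumI)
    then have "cmod (?s F - ?R) = cmod (\<Sum>\<^sub>\<infinity>l. apply_op ?U ?a l * c l)"
      by (simp add: norm_minus_commute)
    also have "\<dots> \<le> sqrt (norm_sq (apply_op ?U ?a)) * sqrt (norm_sq c)"
      by (intro Cauchy_Schwarz_infsum sqU norm_sq_split a c F)
    also have "\<dots> \<le> sqrt (norm_sq ?a) * sqrt (norm_sq c)"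
      by (rule mult_right_mono[OF real_sqrt_le_mono])
        (rule unitary_op_contraction(2)[OF unitary_op_transpose[OF U] norm_sq_split(1)[OF a F]],
          simp add: norm_sq_nonneg)
    finally show ?thesis by (simp only: norm_sq_split(2)[OF a F])
  qed
  have "((\<lambda>F. ?s F - ?R) \<longlongrightarrow> 0) ?F"
  proof (rule Lim_null_comparison)
    show "\<forall>\<^sub>F F in ?F. norm (?s F - ?R)
        \<le> ?B F"
      using bound by (intro eventually_finite_subsets_at_top_weakI) auto
    have "((\<lambda>F. ?B F)
        \<longlongrightarrow> sqrt (norm_sq a - norm_sq a) * sqrt (norm_sq c)) ?F"
      unfolding norm_sq_def using a
      by (intro tendsto_intros infsum_tendsto) (simp add: sq_summable_def)
    then show "((\<lambda>F. ?B F) \<longlongrightarrow> 0) ?F"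
      by simp
  qed
  then have lim2: "(?s \<longlongrightarrow> ?R) ?F"
    by (simp add: LIM_zero_iff)
  have "(\<Sum>\<^sub>\<infinity>k. a k * apply_op U c k) = ?R"
    by (rule tendsto_unique[OF _ lim1 lim2]) simp
  then show ?thesis unfolding eq by (simp add: apply_op_def)
qed

lemma apply_op_inverse:
  assumes U: "unitary_op U" and x: "sq_summable x"
  shows "apply_op (dagger U) (apply_op U x) = x"
proof
  fix i
  have "apply_op (dagger U) (apply_op U x) i = (\<Sum>\<^sub>\<infinity>k. cnj (U k i) * (\<Sum>\<^sub>\<infinity>l. U k l * x l))"
    by (simp add: apply_op_def dagger_def)
  also have "\<dots> = (\<Sum>\<^sub>\<infinity>l. (\<Sum>\<^sub>\<infinity>k. cnj (U k i) * U k l) * x l)"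
    by (rule unitary_op_swap[OF U sq_summable_cnj[OF unitary_op_col(2)[OF U]] x])
  also have "\<dots> = (\<Sum>\<^sub>\<infinity>l. (if i = l then 1 else 0) * x l)"
    by (simp only: infsumI[OF unitary_op_col(1)[OF U]])
  also have "\<dots> = x i"
    using infsumI[OF has_sum_single[of i "\<lambda>l. (if i = l then 1 else 0) * x l"]] by simp
  finally show "apply_op (dagger U) (apply_op U x) i = x i" .
qed

lemma dagger_dagger [simp]: "dagger (dagger A) = A"
  by (simp add: dagger_def fun_eq_iff)

lemma apply_op_inverse':
  assumes "unitary_op U" "sq_summable x"
  shows "apply_op U (apply_op (dagger U) x) = x"
  using apply_op_inverse[OF unitary_op_dagger[OF assms(1)] assms(2)] by simp

section \<open>Diagonalized matrices and the functional calculus\<close>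

abbreviation real_diag :: "('i \<Rightarrow> real) \<Rightarrow> 'i opr" where
  "real_diag p \<equiv> diag_op (\<lambda>k. complex_of_real (p k))"

lemma conj_by_diag: "conj_by V (diag_op d) i j = (\<Sum>\<^sub>\<infinity>k. V i k * d k * cnj (V j k))"
proof -
  have "op_times V (diag_op d) i k = V i k * d k" for k
    unfolding op_times_def diag_op_def
    using infsumI[OF has_sum_single[of k "\<lambda>l. V i l * (if l = k then d l else 0)"]] by simp
  then show ?thesis by (simp add: conj_by_def op_times_def[of "op_times _ _"] dagger_def)
qed

text \<open>Row i of V diag(d) V^dagger is the image of the vector d_k V_ik, a bounded multiple of a
  row of \<open>V\<close>, under the unitary with conjugated entries; hence it is square
  summable.\<close>

lemma conj_by_diag_row:
  assumes V: "unitary_op V" and d: "\<And>k. cmod (d k) \<le> C"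
  shows "conj_by V (diag_op d) i = apply_op (\<lambda>j k. cnj (V j k)) (\<lambda>k. d k * V i k)"
    and "sq_summable (conj_by V (diag_op d) i)"
proof -
  show *: "conj_by V (diag_op d) i = apply_op (\<lambda>j k. cnj (V j k)) (\<lambda>k. d k * V i k)"
    by (rule ext) (simp add: conj_by_diag apply_op_def mult_ac)
  have "unitary_op (\<lambda>j k. cnj (V j k))"
    using unitary_op_transpose[OF unitary_op_dagger[OF V]] by (simp add: dagger_def)
  then show "sq_summable (conj_by V (diag_op d) i)"
    unfolding * by (rule unitary_op_contraction) (rule sq_summable_bounded_mult[OF unitary_op_row(2)[OF V] d])
qed

lemma apply_conj_by_diag:
  assumes V: "unitary_op V" and d: "\<And>k. cmod (d k) \<le> C" and x: "sq_summable x"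
  shows "apply_op (conj_by V (diag_op d)) x = apply_op V (\<lambda>k. d k * apply_op (dagger V) x k)"
proof
  fix i
  have "apply_op (conj_by V (diag_op d)) x i = (\<Sum>\<^sub>\<infinity>l. (\<Sum>\<^sub>\<infinity>k. d k * V i k * dagger V k l) * x l)"
    by (simp add: apply_op_def conj_by_diag dagger_def mult_ac)
  also have "\<dots> = (\<Sum>\<^sub>\<infinity>k. d k * V i k * (\<Sum>\<^sub>\<infinity>l. dagger V k l * x l))"
    by (rule unitary_op_swap[symmetric, OF unitary_op_dagger[OF V]
        sq_summable_bounded_mult[OF unitary_op_row(2)[OF V] d] x])
  finally show "apply_op (conj_by V (diag_op d)) x i = apply_op V (\<lambda>k. d k * apply_op (dagger V) x k) i"
    by (simp add: apply_op_def mult_ac)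
qed

lemma apply_op_delta: "apply_op A (\<lambda>k. if k = j then c else 0) i = A i j * c"
  unfolding apply_op_def
  using infsumI[OF has_sum_single[of j "\<lambda>k. A i k * (if k = j then c else 0)"]] by simp

lemma apply_op_scale: "apply_op A (\<lambda>k. c * x k) = (\<lambda>i. c * apply_op A x i)"
  by (rule ext) (simp add: apply_op_def infsum_cmult_right'[symmetric] mult_ac)

lemma apply_dagger_col:
  assumes "unitary_op V"
  shows "apply_op (dagger V) (\<lambda>i. V i j) = (\<lambda>k. if k = j then 1 else 0)"
  using infsumI[OF unitary_op_col(1)[OF assms]] by (simp add: fun_eq_iff apply_op_def dagger_def)

lemma apply_conj_by_diag_col:
  assumes V: "unitary_op V" and d: "\<And>k. cmod (d k) \<le> C"
  shows "apply_op (conj_by V (diag_op d)) (\<lambda>i. V i j) = (\<lambda>i. d j * V i j)"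
proof -
  have "(\<lambda>k. d k * apply_op (dagger V) (\<lambda>i. V i j) k) = (\<lambda>k. if k = j then d j else 0)"
    by (auto simp: apply_dagger_col[OF V])
  then show ?thesis
    using apply_conj_by_diag[OF V d unitary_op_col(2)[OF V]] by (simp add: fun_eq_iff apply_op_delta mult.commute)
qed

text \<open>Completeness of the columns of \<open>V\<close> expands each unit vector in them;
  \<open>unitary_op_swap\<close> then recovers every entry of a matrix with square-summable rows
  from its action on these columns.\<close>

lemma op_eqI_on_basis:
  assumes V: "unitary_op V" and A: "\<And>i. sq_summable (A i)" and B: "\<And>i. sq_summable (B i)"
    and eq: "\<And>j. apply_op A (\<lambda>i. V i j) = apply_op B (\<lambda>i. V i j)"
  shows "A = B"
proof -
  have expand: "C i l = (\<Sum>\<^sub>\<infinity>j. apply_op C (\<lambda>k. V k j) i * cnj (V l j))" if "\<And>i. sq_summable (C i)" for C i l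
  proof -
    have "C i l = (\<Sum>\<^sub>\<infinity>k. C i k * (if k = l then 1 else 0))"
      using infsumI[OF has_sum_single[of l "\<lambda>k. C i k * (if k = l then 1 else 0)"]] by simp
    also have "\<dots> = (\<Sum>\<^sub>\<infinity>k. C i k * (\<Sum>\<^sub>\<infinity>j. V k j * cnj (V l j)))"
      by (simp only: infsumI[OF unitary_op_row(1)[OF V]])
    also have "\<dots> = (\<Sum>\<^sub>\<infinity>j. (\<Sum>\<^sub>\<infinity>k. C i k * V k j) * cnj (V l j))"
      by (rule unitary_op_swap[OF V that sq_summable_cnj[OF unitary_op_row(2)[OF V]]])
    finally show ?thesis by (simp add: apply_op_def)
  qed
  show ?thesis
  proof (intro ext)
    show "A i l = B i l" for i l
      using expand[of A i l] expand[of B i l] A B by (simp add: eq)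
  qed
qed

lemma diagonalizes_bound:
  assumes "diagonalizes V p A" and f: "\<And>S. bounded S \<Longrightarrow> bounded (f ` S)"
  obtains C where "\<And>k. cmod (complex_of_real (f (p k))) \<le> C"
proof -
  have "bounded (f ` range p)" using assms by (auto simp: diagonalizes_def)
  then obtain C where "\<forall>x\<in>f ` range p. norm x \<le> C" by (auto simp: bounded_iff)
  then show thesis by (intro that[of C]) auto
qed

text \<open>A column of \<open>V\<close> with eigenvalue p_j has coordinates w_k in the basis
  \<open>W\<close> that vanish wherever q_k differs from p_j. Hence f(q_k) w_k = f(p_j) w_k, and
  both candidates for f(A) act alike on every column of \<open>V\<close>.\<close>

lemma fun_calc_unique:
  assumes V: "diagonalizes V p A" and W: "diagonalizes W q A"
    and f: "\<And>S. bounded S \<Longrightarrow> bounded (f ` S)"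
  shows "conj_by V (real_diag (\<lambda>k. f (p k))) = conj_by W (real_diag (\<lambda>k. f (q k)))"
proof -
  let ?d = "\<lambda>f p k. complex_of_real (f (p k))"
  have uV: "unitary_op V" and uW: "unitary_op W"
    and AV: "A = conj_by V (diag_op (?d id p))" and AW: "A = conj_by W (diag_op (?d id q))"
    using V W by (auto simp: diagonalizes_def)
  obtain Cp where Cp: "\<And>k. cmod (?d id p k) \<le> Cp" by (rule diagonalizes_bound[OF V, of id]) (auto intro: that)
  obtain Cq where Cq: "\<And>k. cmod (?d id q k) \<le> Cq" by (rule diagonalizes_bound[OF W, of id]) (auto intro: that)
  obtain Dp where Dp: "\<And>k. cmod (?d f p k) \<le> Dp" by (rule diagonalizes_bound[OF V, of f]) (auto intro: that f)
  obtain Dq where Dq: "\<And>k. cmod (?d f q k) \<le> Dq" by (rule diagonalizes_bound[OF W, of f]) (auto intro: that f)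
  show ?thesis
  proof (rule op_eqI_on_basis[OF uV conj_by_diag_row(2)[OF uV Dp] conj_by_diag_row(2)[OF uW Dq]])
    fix j
    let ?v = "\<lambda>i. V i j"
    have v: "sq_summable ?v" by (rule unitary_op_col(2)[OF uV])
    define w where "w = apply_op (dagger W) ?v"
    have w: "sq_summable w"
      unfolding w_def by (rule unitary_op_contraction(1)[OF unitary_op_dagger[OF uW] v])
    have "apply_op W (\<lambda>k. ?d id q k * w k) = (\<lambda>i. ?d id p j * ?v i)"
      unfolding w_def apply_conj_by_diag[OF uW Cq v, symmetric] AW[symmetric]
      by (subst AV) (rule apply_conj_by_diag_col[OF uV Cp])
    then have "apply_op (dagger W) (apply_op W (\<lambda>k. ?d id q k * w k)) = apply_op (dagger W) (\<lambda>i. ?d id p j * ?v i)"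
      by simp
    then have "(\<lambda>k. ?d id q k * w k) = (\<lambda>k. ?d id p j * w k)"
      by (simp only: apply_op_inverse[OF uW sq_summable_bounded_mult[OF w Cq]] apply_op_scale w_def[symmetric])
    then have "q k = p j" if "w k \<noteq> 0" for k
      using that by (auto simp: fun_eq_iff)
    then have fw: "(\<lambda>k. ?d f q k * w k) = (\<lambda>k. ?d f p j * w k)" by fastforce
    have "apply_op (conj_by W (diag_op (?d f q))) ?v = apply_op W (\<lambda>k. ?d f q k * w k)"
      unfolding w_def by (rule apply_conj_by_diag[OF uW Dq v])
    also have "\<dots> = (\<lambda>i. ?d f p j * ?v i)"
      unfolding fw apply_op_scale by (simp add: w_def apply_op_inverse'[OF uW v])
    also have "\<dots> = apply_op (conj_by V (diag_op (?d f p))) ?v"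
      by (rule apply_conj_by_diag_col[OF uV Dp, symmetric])
    finally show "apply_op (conj_by V (diag_op (?d f p))) ?v = apply_op (conj_by W (diag_op (?d f q))) ?v" ..
  qed
qed

lemma fun_calc_eq:
  assumes "diagonalizes V p A" and "\<And>S. bounded S \<Longrightarrow> bounded (f ` S)"
  shows "fun_calc f A = conj_by V (real_diag (\<lambda>k. f (p k)))"
  unfolding fun_calc_def
proof (rule some_equality)
  show "\<exists>V' p'. diagonalizes V' p' A \<and> conj_by V (real_diag (\<lambda>k. f (p k))) =
      conj_by V' (real_diag (\<lambda>k. f (p' k)))"
    using assms(1) by blast
qed (use fun_calc_unique[OF _ assms] in blast)

text \<open>ln x <= x - 1 bounds x ln x from above, and the same inequality at 1/x bounds it from
  below. \<open>diagonalizes\<close> allows eigenvalues of either sign; a negative argument is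
  reduced to a positive one by \<open>ln_minus\<close>.\<close>

lemma bounded_image_x_ln_x:
  assumes "bounded S"
  shows "bounded ((\<lambda>x::real. x * ln x) ` S)"
proof -
  obtain C where C: "\<And>x. x \<in> S \<Longrightarrow> \<bar>x\<bar> \<le> C" using assms by (auto simp: bounded_iff)
  have "\<bar>x * ln x\<bar> \<le> 1 + C\<^sup>2" if "x \<in> S" for x
  proof -
    have pos: "\<bar>x * ln x\<bar> \<le> 1 + x\<^sup>2" if "x > 0" for x :: real
    proof -
      have "x * ln x \<le> x * (x - 1)" using that by (intro mult_left_mono ln_le_minus_one) auto
      then have "x * ln x \<le> x\<^sup>2 - x" by (simp add: power2_eq_square algebra_simps)
      moreover have "x * (- ln x) \<le> x * (1 / x - 1)"
        using that ln_le_minus_one[of "1 / x"] by (intro mult_left_mono) (auto simp: ln_div)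
      then have "- (x * ln x) \<le> 1 - x" using that by (simp add: algebra_simps)
      ultimately show ?thesis using that zero_le_power2[of x] unfolding abs_le_iff by linarith
    qed
    have "\<bar>x * ln x\<bar> \<le> 1 + x\<^sup>2"
      using pos[of x] pos[of "-x"] by (cases "x > 0"; cases "x = 0") (auto simp: ln_minus)
    also have "\<dots> \<le> 1 + C\<^sup>2" using C[OF that] power_mono[of "\<bar>x\<bar>" C 2] by simp
    finally show ?thesis .
  qed
  then show ?thesis by (auto simp: bounded_iff)
qed

lemma von_neumann_entropy_eq:
  assumes "diagonalizes V p A"
  shows "von_neumann_entropy A =
    (\<integral>\<^sup>+ i. ennreal (- (\<Sum>\<^sub>\<infinity>k. (cmod (V i k))\<^sup>2 * (p k * ln (p k)))) \<partial>count_space UNIV)"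
proof -
  let ?f = "\<lambda>x::real. x * ln x"
  have fc: "fun_calc ?f A = conj_by V (real_diag (\<lambda>k. ?f (p k)))"
    by (rule fun_calc_eq[OF assms]) (rule bounded_image_x_ln_x)
  have "fun_calc ?f A i i = complex_of_real (\<Sum>\<^sub>\<infinity>k. (cmod (V i k))\<^sup>2 * ?f (p k))" for i
  proof -
    show ?thesis unfolding fc conj_by_diag mult_cnj_weighted by (rule infsum_complex_of_real)
  qed
  then show ?thesis unfolding von_neumann_entropy_def by simp
qed

section \<open>Entropy under diagonal phases and under tensoring with a pure state\<close>

definition phase_conj :: "('i \<Rightarrow> complex) \<Rightarrow> 'i opr \<Rightarrow> 'i opr" where
  "phase_conj u A i j = u i * A i j * cnj (u j)"

lemma phase_mult_cnj: "cmod z = 1 \<Longrightarrow> z * cnj z = 1"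
  by (simp add: complex_norm_square[symmetric])

lemma conj_by_phase_left:
  "conj_by (\<lambda>i k. u i * V i k) (diag_op d) = phase_conj u (conj_by V (diag_op d))"
proof (intro ext)
  fix i j
  have "(\<Sum>\<^sub>\<infinity>k. u i * V i k * d k * cnj (u j * V j k)) = (\<Sum>\<^sub>\<infinity>k. u i * (V i k * d k * cnj (V j k)) * cnj (u j))"
    by (simp add: mult_ac)
  then show "conj_by (\<lambda>i k. u i * V i k) (diag_op d) i j = phase_conj u (conj_by V (diag_op d)) i j"
    by (simp only: conj_by_diag phase_conj_def infsum_cmult_left' infsum_cmult_right')
qed

lemma diagonalizes_phase_conj:
  assumes V: "diagonalizes V p A" and u: "\<And>i. cmod (u i) = 1"
  shows "diagonalizes (\<lambda>i k. u i * V i k) p (phase_conj u A)"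
proof -
  have uV: "unitary_op V" using V by (simp add: diagonalizes_def)
  have "unitary_op (\<lambda>i k. u i * V i k)"
  proof (rule unitary_opI)
    fix i j
    have "((\<lambda>k. u i * cnj (u j) * (V i k * cnj (V j k))) has_sum u i * cnj (u j) * (if i = j then 1 else 0)) UNIV"
      by (rule has_sum_cmult_right[OF unitary_op_row(1)[OF uV]])
    moreover have "u i * cnj (u j) * (if i = j then 1 else 0) = (if i = j then 1 else 0)"
      by (simp add: phase_mult_cnj[OF u])
    ultimately show "((\<lambda>k. u i * V i k * cnj (u j * V j k)) has_sum (if i = j then 1 else 0)) UNIV"
      by (simp only: complex_cnj_mult mult_ac)
    have "cnj (u k * V k i) * (u k * V k j) = u k * cnj (u k) * (cnj (V k i) * V k j)" for k
      by (simp only: complex_cnj_mult mult_ac)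
    then have "cnj (u k * V k i) * (u k * V k j) = cnj (V k i) * V k j" for k
      by (simp only: phase_mult_cnj[OF u] mult_1)
    then show "((\<lambda>k. cnj (u k * V k i) * (u k * V k j)) has_sum (if i = j then 1 else 0)) UNIV"
      using unitary_op_col(1)[OF uV, of i j] by (simp only:)
  qed
  then show ?thesis
    using V by (simp add: diagonalizes_def conj_by_phase_left)
qed

lemma phase_conj_cancel:
  assumes "\<And>i. cmod (u i) = 1"
  shows "phase_conj (\<lambda>i. cnj (u i)) (phase_conj u A) = A"
proof (intro ext)
  fix i j
  have "phase_conj (\<lambda>i. cnj (u i)) (phase_conj u A) i j = u i * cnj (u i) * A i j * (u j * cnj (u j))"
    by (simp only: phase_conj_def complex_cnj_cnj mult_ac)
  then show "phase_conj (\<lambda>i. cnj (u i)) (phase_conj u A) i j = A i j"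
    by (simp only: phase_mult_cnj[OF assms] mult_1 mult_1_right)
qed

text \<open>If \<open>A\<close> has no eigenbasis, neither has its conjugate; both
  \<open>SOME\<close> choices are then made from the same empty predicate and coincide.\<close>

lemma von_neumann_entropy_phase_conj:
  assumes u: "\<And>i. cmod (u i) = 1"
  shows "von_neumann_entropy (phase_conj u A) = von_neumann_entropy A"
proof (cases "\<exists>V p. diagonalizes V p A")
  case True
  then obtain V p where V: "diagonalizes V p A" by blast
  show ?thesis
    unfolding von_neumann_entropy_eq[OF V] von_neumann_entropy_eq[OF diagonalizes_phase_conj[OF V u]]
    by (simp add: norm_mult u)
next
  case False
  have "\<not> diagonalizes V p (phase_conj u A)" for V p
  proof
    assume "diagonalizes V p (phase_conj u A)"
    then have "diagonalizes (\<lambda>i k. cnj (u i) * V i k) p (phase_conj (\<lambda>i. cnj (u i)) (phase_conj u A))"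
      by (rule diagonalizes_phase_conj) (simp add: u)
    then show False using False by (auto simp: phase_conj_cancel[OF u])
  qed
  then show ?thesis
    using False by (simp add: von_neumann_entropy_def fun_calc_def)
qed

lemma unitary_op_tensor:
  assumes V: "unitary_op V" and W: "unitary_op W"
  shows "unitary_op (tensor_op V W)"
proof (rule unitary_opI)
  fix x y :: "'a \<times> 'b"
  show "((\<lambda>k. tensor_op V W x k * cnj (tensor_op V W y k)) has_sum (if x = y then 1 else 0)) UNIV"
    using has_sum_complex_mult_Times[OF unitary_op_row(1)[OF V, of "fst x" "fst y"]
        unitary_op_row(1)[OF W, of "snd x" "snd y"]]
    by (auto simp: tensor_op_def case_prod_unfold mult_ac prod_eq_iff cong: if_cong split: if_splits)
  show "((\<lambda>k. cnj (tensor_op V W k x) * tensor_op V W k y) has_sum (if x = y then 1 else 0)) UNIV"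
    using has_sum_complex_mult_Times[OF unitary_op_col(1)[OF V, of "fst x" "fst y"]
        unitary_op_col(1)[OF W, of "snd x" "snd y"]]
    by (auto simp: tensor_op_def case_prod_unfold mult_ac prod_eq_iff cong: if_cong split: if_splits)
qed

lemma conj_by_diag_has_sum:
  assumes V: "unitary_op V" and d: "\<And>k. cmod (d k) \<le> C"
  shows "((\<lambda>k. V i k * d k * cnj (V j k)) has_sum conj_by V (diag_op d) i j) UNIV"
  unfolding conj_by_diag
  using sq_summable_mult[OF sq_summable_bounded_mult[where d = d, OF unitary_op_row(2)[OF V, of i] d]
      sq_summable_cnj[OF unitary_op_row(2)[OF V, of j]]]
  by (intro has_sum_infsum) (simp add: mult_ac)

lemma diagonalizes_tensor:
  assumes V: "diagonalizes V p A" and W: "diagonalizes W q B"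
  shows "diagonalizes (tensor_op V W) (\<lambda>k. p (fst k) * q (snd k)) (tensor_op A B)"
proof -
  obtain P where P: "\<And>k. cmod (complex_of_real (p k)) \<le> P"
    by (rule diagonalizes_bound[OF V, of id]) (auto intro: that)
  obtain Q where Q: "\<And>k. cmod (complex_of_real (q k)) \<le> Q"
    by (rule diagonalizes_bound[OF W, of id]) (auto intro: that)
  have uV: "unitary_op V" and uW: "unitary_op W"
    and AV: "A = conj_by V (real_diag p)"
    and BW: "B = conj_by W (real_diag q)"
    using V W by (auto simp: diagonalizes_def)
  have "norm (p (fst k) * q (snd k)) \<le> P * Q" for k
    using mult_mono[OF P[of "fst k"] Q[of "snd k"]] order_trans[OF norm_ge_zero P[of "fst k"]]
    by (simp add: abs_mult)
  then have "bounded (range (\<lambda>k. p (fst k) * q (snd k)))"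
    unfolding bounded_iff by blast
  moreover have "tensor_op A B = conj_by (tensor_op V W) (real_diag (\<lambda>k. p (fst k) * q (snd k)))"
  proof (intro ext)
    fix x y :: "'a \<times> 'b"
    have "((\<lambda>(k, l). (V (fst x) k * complex_of_real (p k) * cnj (V (fst y) k))
          * (W (snd x) l * complex_of_real (q l) * cnj (W (snd y) l))) has_sum
        A (fst x) (fst y) * B (snd x) (snd y)) UNIV"
      unfolding AV BW
      by (intro has_sum_complex_mult_Times conj_by_diag_has_sum[OF uV P] conj_by_diag_has_sum[OF uW Q])
    from infsumI[OF this] show "tensor_op A B x y = conj_by (tensor_op V W) (real_diag (\<lambda>k. p (fst k) * q (snd k))) x y"
      unfolding conj_by_diag by (simp add: tensor_op_def case_prod_unfold mult_ac)
  qed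
  ultimately show ?thesis
    using unitary_op_tensor[OF uV uW] by (simp add: diagonalizes_def)
qed

text \<open>The projector onto a unit vector is idempotent, so q^2 w = q w for an eigenvector w with
  eigenvalue q, and a column of a unitary matrix is not zero.\<close>

lemma proj_eigenvalues:
  assumes W: "diagonalizes W q (proj \<gamma>)" and \<gamma>: "((\<lambda>i. (cmod (\<gamma> i))\<^sup>2) has_sum 1) UNIV"
  shows "q k = 0 \<or> q k = 1"
proof -
  have uW: "unitary_op W" and A: "proj \<gamma> = conj_by W (real_diag q)"
    using W by (auto simp: diagonalizes_def)
  obtain Q where Q: "\<And>k. cmod (complex_of_real (q k)) \<le> Q"
    by (rule diagonalizes_bound[OF W, of id]) (auto intro: that)
  let ?w = "\<lambda>i. W i k"
  have ev: "apply_op (proj \<gamma>) ?w = (\<lambda>i. complex_of_real (q k) * ?w i)"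
    unfolding A by (rule apply_conj_by_diag_col[OF uW Q])
  have proj_apply: "apply_op (proj \<gamma>) x = (\<lambda>i. (\<Sum>\<^sub>\<infinity>j. cnj (\<gamma> j) * x j) * \<gamma> i)" for x
    by (rule ext) (simp add: apply_op_def proj_def mult_ac infsum_cmult_right')
  have "((\<lambda>i. complex_of_real ((cmod (\<gamma> i))\<^sup>2)) has_sum complex_of_real 1) UNIV"
    using \<gamma> by (simp only: has_sum_of_real_iff)
  then have one: "(\<Sum>\<^sub>\<infinity>j. cnj (\<gamma> j) * \<gamma> j) = 1"
    unfolding complex_norm_square by (intro infsumI) (simp add: mult.commute)
  have "apply_op (proj \<gamma>) (apply_op (proj \<gamma>) ?w) = apply_op (proj \<gamma>) ?w"
    unfolding proj_apply[of "apply_op (proj \<gamma>) ?w"] unfolding proj_apply[of ?w]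
    by (simp add: mult.left_commute[of "cnj _"] infsum_cmult_right' one)
  then have "(\<lambda>i. complex_of_real (q k) * (complex_of_real (q k) * ?w i)) = (\<lambda>i. complex_of_real (q k) * ?w i)"
    by (simp add: ev apply_op_scale)
  then have eq: "complex_of_real (q k) * (complex_of_real (q k) * ?w i) = complex_of_real (q k) * ?w i" for i
    by (rule fun_cong)
  obtain i where "?w i \<noteq> 0"
  proof (rule ccontr)
    assume "\<not> thesis"
    then have "?w i = 0" for i using that by blast
    then have "((\<lambda>i. cnj (W i k) * W i k) has_sum 0) UNIV" by simp
    with unitary_op_col(1)[OF uW, of k k] show False using has_sum_unique by fastforce
  qed
  then show ?thesis using eq[of i] by (simp add: mult.assoc[symmetric])
qed

text \<open>The idler eigenvalues q are 0 or 1, so p q ln(p q) = q (p ln p) in both cases. The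
  diagonal entries therefore factor as e_i |\<gamma>_j|^2, and the sum over j is 1.\<close>

lemma von_neumann_entropy_tensor_proj:
  assumes V: "diagonalizes V p A" and W: "diagonalizes W q (proj \<gamma>)"
    and \<gamma>: "((\<lambda>i. (cmod (\<gamma> i))\<^sup>2) has_sum 1) UNIV"
  shows "von_neumann_entropy (tensor_op A (proj (\<gamma> :: nat ket))) = von_neumann_entropy A"
proof -
  have uV: "unitary_op V" and uW: "unitary_op W"
    and B: "proj \<gamma> = conj_by W (real_diag q)"
    using V W by (auto simp: diagonalizes_def)
  obtain F where F: "\<And>k. cmod (complex_of_real (p k * ln (p k))) \<le> F"
    by (rule diagonalizes_bound[OF V, of "\<lambda>x. x * ln x"]) (auto intro: that bounded_image_x_ln_x)
  obtain Q where Q: "\<And>k. cmod (complex_of_real (q k)) \<le> Q"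
    by (rule diagonalizes_bound[OF W, of id]) (auto intro: that)
  let ?e = "\<lambda>i. \<Sum>\<^sub>\<infinity>k. (cmod (V i k))\<^sup>2 * (p k * ln (p k))"
  have entry: "(\<Sum>\<^sub>\<infinity>k. (cmod (tensor_op V W x k))\<^sup>2 * (p (fst k) * q (snd k) * ln (p (fst k) * q (snd k))))
      = ?e (fst x) * (cmod (\<gamma> (snd x)))\<^sup>2" for x
  proof -
    let ?i = "fst x" and ?j = "snd x"
    have "((\<lambda>(k, l). (V ?i k * complex_of_real (p k * ln (p k)) * cnj (V ?i k))
          * (W ?j l * complex_of_real (q l) * cnj (W ?j l))) has_sum
        conj_by V (real_diag (\<lambda>k. p k * ln (p k))) ?i ?i * proj \<gamma> ?j ?j) UNIV"
      unfolding B
      by (intro has_sum_complex_mult_Times conj_by_diag_has_sum[OF uV F] conj_by_diag_has_sum[OF uW Q])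
    moreover have "conj_by V (real_diag (\<lambda>k. p k * ln (p k))) ?i ?i = complex_of_real (?e ?i)"
      unfolding conj_by_diag mult_cnj_weighted by (rule infsum_complex_of_real)
    moreover have "proj \<gamma> ?j ?j = complex_of_real ((cmod (\<gamma> ?j))\<^sup>2)"
      unfolding proj_def by (rule complex_norm_square[symmetric])
    ultimately have *: "((\<lambda>k. (cmod (V ?i (fst k)))\<^sup>2 * (p (fst k) * ln (p (fst k))) * ((cmod (W ?j (snd k)))\<^sup>2 * q (snd k)))
        has_sum ?e ?i * (cmod (\<gamma> ?j))\<^sup>2) UNIV"
      by (simp only: mult_cnj_weighted of_real_mult[symmetric] has_sum_of_real_iff case_prod_unfold)
    have "(cmod (tensor_op V W x k))\<^sup>2 * (p (fst k) * q (snd k) * ln (p (fst k) * q (snd k)))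
        = (cmod (V ?i (fst k)))\<^sup>2 * (p (fst k) * ln (p (fst k))) * ((cmod (W ?j (snd k)))\<^sup>2 * q (snd k))" for k
      using proj_eigenvalues[OF W \<gamma>, of "snd k"]
      by (auto simp: tensor_op_def norm_mult power_mult_distrib)
    then show ?thesis using infsumI[OF *] by (simp only:)
  qed
  have one: "(\<integral>\<^sup>+ j. ennreal ((cmod (\<gamma> j))\<^sup>2) \<partial>count_space UNIV) = 1"
    unfolding nn_integral_count_space_nat ennreal_1[symmetric]
    by (rule suminf_ennreal_eq[OF zero_le_power2 has_sum_imp_sums[OF \<gamma>]])
  have split: "ennreal (- (?e i * (cmod (\<gamma> j))\<^sup>2)) = ennreal (- ?e i) * ennreal ((cmod (\<gamma> j))\<^sup>2)" for i j
    using ennreal_mult''[of "(cmod (\<gamma> j))\<^sup>2" "- ?e i"] by simp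
  have "von_neumann_entropy (tensor_op A (proj \<gamma>)) =
      (\<integral>\<^sup>+ x. ennreal (- (?e (fst x) * (cmod (\<gamma> (snd x)))\<^sup>2)) \<partial>count_space UNIV)"
    unfolding von_neumann_entropy_eq[OF diagonalizes_tensor[OF V W]] entry ..
  also have "\<dots> = (\<integral>\<^sup>+ i. \<integral>\<^sup>+ j. ennreal (- (?e i * (cmod (\<gamma> j))\<^sup>2)) \<partial>count_space UNIV \<partial>count_space UNIV)"
    by (subst nn_integral_fst_count_space[symmetric]) simp
  also have "\<dots> = (\<integral>\<^sup>+ i. ennreal (- ?e i) \<partial>count_space UNIV)"
    unfolding split by (simp add: nn_integral_cmult one)
  also have "\<dots> = von_neumann_entropy A"
    by (rule von_neumann_entropy_eq[OF V, symmetric])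
  finally show ?thesis .
qed

text \<open>By ln x \<le> x - 1 in the eigenbasis; summing over i bounds the relative entropy of A with respect
  to its diagonal part D by the chi-squared divergence tr (A^2 D^-1) - 1.\<close>
lemma entropy_entry_bound:
  assumes V: "diagonalizes V p A" and p: "\<And>k. 0 \<le> p k"
    and a: "A i i = complex_of_real a" "0 < a"
    and b: "((\<lambda>j. (cmod (A i j))\<^sup>2) has_sum b) UNIV"
  shows "- (a * ln a) \<le> - (\<Sum>\<^sub>\<infinity>k. (cmod (V i k))\<^sup>2 * (p k * ln (p k))) + (b / a - a)"
proof -
  have uV: "unitary_op V" and A: "A = conj_by V (real_diag p)"
    using V by (auto simp: diagonalizes_def)
  obtain P where P: "\<And>k. cmod (complex_of_real (p k)) \<le> P"
    by (rule diagonalizes_bound[OF V, of id]) (auto intro: that)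
  obtain F where F: "\<And>k. cmod (complex_of_real (p k * ln (p k))) \<le> F"
    by (rule diagonalizes_bound[OF V, of "\<lambda>x. x * ln x"]) (auto intro: that bounded_image_x_ln_x)
  let ?w = "\<lambda>k. (cmod (V i k))\<^sup>2"
  have weighted: "((\<lambda>k. ?w k * d k) has_sum Re (conj_by V (real_diag d) i i)) UNIV"
    if "\<And>k. cmod (complex_of_real (d k)) \<le> C" for d C
    using has_sum_Re[OF conj_by_diag_has_sum[where d = "\<lambda>k. complex_of_real (d k)" and i = i and j = i, OF uV that]]
    by (simp only: mult_cnj_weighted Re_complex_of_real)
  have mean: "((\<lambda>k. ?w k * p k) has_sum a) UNIV"
    using weighted[where d = p, OF P] a(1) unfolding A[symmetric] by simp
  have ent: "((\<lambda>k. ?w k * (p k * ln (p k))) has_sum (\<Sum>\<^sub>\<infinity>k. ?w k * (p k * ln (p k)))) UNIV"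
    by (rule has_sum_infsum[OF has_sum_imp_summable[OF weighted[where d = "\<lambda>k. p k * ln (p k)", OF F]]])
  let ?x = "\<lambda>k. complex_of_real (p k) * V i k" and ?U = "\<lambda>j k. cnj (V j k)"
  have uU: "unitary_op ?U"
    using unitary_op_transpose[OF unitary_op_dagger[OF uV]] by (simp add: dagger_def)
  have row: "A i = apply_op ?U ?x"
    unfolding A by (rule conj_by_diag_row(1)[OF uV P])
  have sqx: "sq_summable ?x" by (rule sq_summable_bounded_mult[OF unitary_op_row(2)[OF uV] P])
  have sqA: "sq_summable (A i)" unfolding row by (rule unitary_op_contraction(1)[OF uU sqx])
  \<comment> \<open>The second moment of p under the weights |V_ik|^2 is at most the squared norm of
    row i of \<open>A\<close>, because the inverse of the unitary that produces the row is a
    contraction too.\<close>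
  have "norm_sq ?x \<le> norm_sq (A i)"
    using unitary_op_contraction(2)[OF unitary_op_dagger[OF uU] sqA] apply_op_inverse[OF uU sqx] by (simp add: row)
  moreover have "norm_sq (A i) = b" unfolding norm_sq_def by (rule infsumI[OF b])
  moreover have second: "((\<lambda>k. ?w k * (p k)\<^sup>2) has_sum norm_sq ?x) UNIV"
    using sqx unfolding norm_sq_def sq_summable_def
    by (simp add: norm_mult power_mult_distrib mult.commute has_sum_infsum)
  ultimately have xb: "norm_sq ?x \<le> b" by simp
  have "(\<Sum>\<^sub>\<infinity>k. ?w k * (p k * ln (p k))) \<le> a * (ln a - 1) + norm_sq ?x * (1 / a)"
  proof (rule has_sum_mono[OF ent])
    show "((\<lambda>k. ?w k * p k * (ln a - 1) + ?w k * (p k)\<^sup>2 * (1 / a)) has_sum a * (ln a - 1) + norm_sq ?x * (1 / a)) UNIV"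
      by (intro has_sum_add has_sum_cmult_left mean second)
    \<comment> \<open>This is ln x <= x - 1 at x = p_k / a, multiplied by |V_ik|^2 p_k. The
      reference point a is the mean of p under the weights |V_ik|^2.\<close>
    show "?w k * (p k * ln (p k)) \<le> ?w k * p k * (ln a - 1) + ?w k * (p k)\<^sup>2 * (1 / a)" for k
    proof (cases "p k = 0")
      case False
      then have pk: "0 < p k" using p[of k] by simp
      have "ln (p k) - ln a \<le> p k / a - 1"
        using ln_le_minus_one[of "p k / a"] pk a(2) by (simp add: ln_div)
      then have "?w k * p k * (ln (p k) - ln a) \<le> ?w k * p k * (p k / a - 1)"
        using pk by (intro mult_left_mono) auto
      then show ?thesis by (simp add: algebra_simps power2_eq_square)
    qed simp
  qed
  also have "\<dots> \<le> a * (ln a - 1) + b * (1 / a)"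
    using xb a(2) by (simp add: divide_right_mono)
  finally show ?thesis by (simp add: algebra_simps)
qed

section \<open>The spectral theorem for positive Hilbert-Schmidt matrices\<close>

text \<open>A type, so that norm, orthogonality and Cauchy-Schwarz of the class
  \<open>real_inner\<close> are available. Real scalars suffice because the matrices to which the
  spectral theorem is applied are real up to diagonal phases.\<close>

typedef ell2 = "{f :: nat \<Rightarrow> real. summable (\<lambda>n. (f n)\<^sup>2)}"
  morphisms coord Abs_ell2
  by (rule exI[of _ "\<lambda>_. 0"]) simp

setup_lifting type_definition_ell2

lemma summable_mult_of_squares:
  fixes f g :: "nat \<Rightarrow> real"
  assumes "summable (\<lambda>n. (f n)\<^sup>2)" "summable (\<lambda>n. (g n)\<^sup>2)"
  shows "summable (\<lambda>n. \<bar>f n * g n\<bar>)" "summable (\<lambda>n. f n * g n)"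
proof -
  show "summable (\<lambda>n. \<bar>f n * g n\<bar>)"
    by (rule summable_comparison_test'[OF summable_add[OF assms], of 0]) (use abs_mult_le_sum_squares in auto)
  then show "summable (\<lambda>n. f n * g n)"
    by (rule summable_rabs_cancel)
qed

instantiation ell2 :: real_inner
begin

lift_definition zero_ell2 :: ell2 is "\<lambda>_. 0" by simp
lift_definition plus_ell2 :: "ell2 \<Rightarrow> ell2 \<Rightarrow> ell2" is "\<lambda>f g n. f n + g n"
proof -
  fix f g :: "nat \<Rightarrow> real"
  assume *: "summable (\<lambda>n. (f n)\<^sup>2)" "summable (\<lambda>n. (g n)\<^sup>2)"
  have "summable (\<lambda>n. (f n)\<^sup>2 + (g n)\<^sup>2 + 2 * (f n * g n))"
    by (intro summable_add summable_mult summable_mult_of_squares * )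
  then show "summable (\<lambda>n. (f n + g n)\<^sup>2)"
    by (simp add: power2_sum mult.assoc)
qed
lift_definition scaleR_ell2 :: "real \<Rightarrow> ell2 \<Rightarrow> ell2" is "\<lambda>r f n. r * f n"
  by (simp add: power_mult_distrib summable_mult)
definition uminus_ell2 :: "ell2 \<Rightarrow> ell2" where "uminus_ell2 x = (-1) *\<^sub>R x"
definition minus_ell2 :: "ell2 \<Rightarrow> ell2 \<Rightarrow> ell2" where "minus_ell2 x y = x + (- y)"
lift_definition inner_ell2 :: "ell2 \<Rightarrow> ell2 \<Rightarrow> real" is "\<lambda>f g. \<Sum>n. f n * g n" .
definition norm_ell2 :: "ell2 \<Rightarrow> real" where "norm_ell2 x = sqrt (inner x x)"
definition sgn_ell2 :: "ell2 \<Rightarrow> ell2" where "sgn_ell2 x = inverse (norm x) *\<^sub>R x"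
definition dist_ell2 :: "ell2 \<Rightarrow> ell2 \<Rightarrow> real" where "dist_ell2 x y = norm (x - y)"
definition uniformity_ell2 :: "(ell2 \<times> ell2) filter" where
  "uniformity_ell2 = (INF e\<in>{0 <..}. principal {(x, y). dist x y < e})"
definition open_ell2 :: "ell2 set \<Rightarrow> bool" where
  "open_ell2 S = (\<forall>x\<in>S. \<forall>\<^sub>F (x', y) in uniformity. x' = x \<longrightarrow> y \<in> S)"

instance
proof
  fix x y z :: ell2 and a b r :: real and U :: "ell2 set"
  show "x + y + z = x + (y + z)" "x + y = y + x" "0 + x = x"
    "a *\<^sub>R (x + y) = a *\<^sub>R x + a *\<^sub>R y" "(a + b) *\<^sub>R x = a *\<^sub>R x + b *\<^sub>R x"
    "a *\<^sub>R b *\<^sub>R x = (a * b) *\<^sub>R x" "1 *\<^sub>R x = x"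
    by (transfer; simp add: fun_eq_iff algebra_simps)+
  show "- x + x = 0"
    unfolding uminus_ell2_def by transfer simp
  show "x - y = x + - y" by (fact minus_ell2_def)
  show "sgn x = inverse (norm x) *\<^sub>R x" by (fact sgn_ell2_def)
  show "dist x y = norm (x - y)" by (fact dist_ell2_def)
  show "uniformity = (INF e\<in>{0 <..}. principal {(x::ell2, y). dist x y < e})"
    by (fact uniformity_ell2_def)
  show "open U = (\<forall>x\<in>U. \<forall>\<^sub>F (x', y) in uniformity. x' = x \<longrightarrow> y \<in> U)"
    by (fact open_ell2_def)
  show "norm x = sqrt (inner x x)" by (fact norm_ell2_def)
  show "inner x y = inner y x" by transfer (simp add: mult.commute)
  show "inner (x + y) z = inner x z + inner y z"
    by transfer (simp add: distrib_right suminf_add summable_mult_of_squares)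
  show "inner (r *\<^sub>R x) y = r * inner x y"
    by transfer (simp add: mult.assoc suminf_mult summable_mult_of_squares)
  show "0 \<le> inner x x"
    by transfer (auto intro!: suminf_nonneg simp: power2_eq_square)
  show "inner x x = 0 \<longleftrightarrow> x = 0"
    by transfer (auto simp: power2_eq_square suminf_eq_zero_iff fun_eq_iff)
qed

end

lemma coord_simps [simp]:
  "coord 0 i = 0" "coord (x + y) i = coord x i + coord y i"
  "coord (r *\<^sub>R x) i = r * coord x i" "coord (- x) i = - coord x i"
  "coord (x - y) i = coord x i - coord y i"
  unfolding minus_ell2_def uminus_ell2_def by (transfer, simp)+

lemma coord_sum: "coord (\<Sum>a\<in>F. f a) i = (\<Sum>a\<in>F. coord (f a) i)"
  by (induction F rule: infinite_finite_induct) auto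

lemma summable_coord: "summable (\<lambda>i. (coord x i)\<^sup>2)"
  using coord[of x] by simp

lemma ell2_eqI: "(\<And>i. coord x i = coord y i) \<Longrightarrow> x = y"
  by (simp add: coord_inject[symmetric] fun_eq_iff)

lemma inner_sums: "(\<lambda>i. coord x i * coord y i) sums (x \<bullet> y)"
proof -
  have "x \<bullet> y = (\<Sum>i. coord x i * coord y i)" by transfer simp
  then show ?thesis
    using summable_mult_of_squares[OF summable_coord summable_coord] by (simp add: summable_sums)
qed

lemma norm_sums: "(\<lambda>i. (coord x i)\<^sup>2) sums (norm x)\<^sup>2"
  using inner_sums[of x x] by (simp only: power2_norm_eq_inner) (simp add: power2_eq_square)

lift_definition unit_ell2 :: "nat \<Rightarrow> ell2" is "\<lambda>i j. if j = i then 1 else 0"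
  by (rule summable_finite[of "{i}" for i]) auto

lemma coord_unit [simp]: "coord (unit_ell2 i) j = (if j = i then 1 else 0)"
  by transfer simp

lemma inner_unit: "x \<bullet> unit_ell2 i = coord x i"
proof -
  have "(\<lambda>j. coord x j * coord (unit_ell2 i) j) sums (\<Sum>j\<in>{i}. coord x j * coord (unit_ell2 i) j)"
    by (rule sums_finite) auto
  then show ?thesis using inner_sums[of x "unit_ell2 i"] sums_unique2 by fastforce
qed

lemma unit_inner: "unit_ell2 i \<bullet> x = coord x i"
  by (simp add: inner_commute inner_unit)

lemma norm_unit [simp]: "norm (unit_ell2 i) = 1"
  by (simp add: norm_eq_sqrt_inner inner_unit)

lemma sum_coord_square_le: "(\<Sum>i<n. (coord x i)\<^sup>2) \<le> (norm x)\<^sup>2"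
  using sum_le_suminf[OF summable_coord[of x], of "{..<n}"] norm_sums[of x] by (simp add: sums_iff)

lemma abs_coord_le: "\<bar>coord x i\<bar> \<le> norm x"
  using Cauchy_Schwarz_ineq2[of x "unit_ell2 i"] by (simp add: inner_unit)

section \<open>Weak sequential compactness of balls\<close>

lemma weak_limit_ell2:
  assumes "\<And>n. norm (x n) \<le> C" "\<And>i. (\<lambda>n. coord (x n) i) \<longlonglongrightarrow> g i"
  obtains l where "coord l = g" "norm l \<le> C"
proof -
  have C0: "0 \<le> C" using assms(1)[of 0] norm_ge_zero order_trans by blast
  have part: "(\<Sum>i<N. (g i)\<^sup>2) \<le> C\<^sup>2" for N
  proof (rule tendsto_upperbound)
    show "(\<lambda>n. \<Sum>i<N. (coord (x n) i)\<^sup>2) \<longlonglongrightarrow> (\<Sum>i<N. (g i)\<^sup>2)"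
      by (intro tendsto_intros assms(2))
    have "(\<Sum>i<N. (coord (x n) i)\<^sup>2) \<le> C\<^sup>2" for n
    proof -
      have "(\<Sum>i<N. (coord (x n) i)\<^sup>2) \<le> (norm (x n))\<^sup>2" by (rule sum_coord_square_le)
      also have "\<dots> \<le> C\<^sup>2" using assms(1) by (simp add: power_mono)
      finally show ?thesis .
    qed
    then show "\<forall>\<^sub>F n in sequentially. (\<Sum>i<N. (coord (x n) i)\<^sup>2) \<le> C\<^sup>2" by simp
  qed simp
  have sm: "summable (\<lambda>i. (g i)\<^sup>2)"
    by (rule summableI_nonneg_bounded[of _ "C\<^sup>2"]) (use part in auto)
  let ?l = "Abs_ell2 g"
  have cl: "coord ?l = g" using sm by (simp add: Abs_ell2_inverse)
  have "(norm ?l)\<^sup>2 \<le> C\<^sup>2"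
    using norm_sums[of ?l] suminf_le_const[OF sm part] by (simp add: cl sums_iff)
  then have "norm ?l \<le> C" using C0 by (rule power2_le_imp_le)
  with cl show thesis by (rule that)
qed

text \<open>The coordinates of a bounded sequence lie in a product of countably many intervals
  [-C,C], which is compact by Tychonoff and metrizable, hence sequentially compact. The pointwise
  limit stays in the ball by the bound on partial sums.\<close>

lemma weak_compact_ell2:
  assumes "\<And>n. norm (x n) \<le> C"
  obtains l and r :: "nat \<Rightarrow> nat" where
    "strict_mono r" "norm l \<le> C" "\<And>i. (\<lambda>n. coord (x (r n)) i) \<longlonglongrightarrow> coord l i"
proof -
  let ?K = "PiE UNIV (\<lambda>_. {-C..C}) :: (nat \<Rightarrow> real) set"
  have "compactin (product_topology (\<lambda>i::nat. euclidean::real topology) UNIV) ?K"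
    by (subst compactin_PiE) auto
  then have "compact ?K" by (simp add: euclidean_product_topology)
  then have "seq_compact ?K" by (simp add: compact_eq_seq_compact_metric)
  moreover have "coord (x n) i \<in> {-C..C}" for n i
    using abs_coord_le[of "x n" i] assms[of n] by auto
  then have "\<forall>n. coord (x n) \<in> ?K" by auto
  ultimately obtain g and r :: "nat \<Rightarrow> nat" where
    r: "strict_mono r" and g: "((\<lambda>n. coord (x n)) \<circ> r) \<longlonglongrightarrow> g"
    by (rule seq_compactE)
  have c: "(\<lambda>n. coord (x (r n)) i) \<longlonglongrightarrow> g i" for i
  proof -
    have "isCont (\<lambda>f :: nat \<Rightarrow> real. f i) g"
      by (metis continuous_on_product_coordinates continuous_on_eq_continuous_at open_UNIV UNIV_I)
    from isCont_tendsto_compose[OF this g] show ?thesis by (simp add: o_def)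
  qed
  obtain l where l: "coord l = g" "norm l \<le> C"
    using weak_limit_ell2[of "\<lambda>n. x (r n)" C g] assms c by blast
  with r c show thesis by (intro that[of r l]) auto
qed

lemma weak_limit_dist_le:
  assumes "\<And>n. norm (x n) \<le> C" "\<And>i. (\<lambda>n. coord (x n) i) \<longlonglongrightarrow> coord l i"
  shows "norm (x n - l) \<le> 2 * C"
proof -
  have "norm l \<le> C"
    using weak_limit_ell2[OF assms] by (metis coord_inject)
  then show ?thesis using norm_triangle_ineq4[of "x n" l] assms(1)[of n] by linarith
qed

text \<open>For bounded sequences coordinatewise convergence is weak convergence: \<open>y\<close>
  is cut at N, its head leaves a finite sum, and its tail is small uniformly in n.\<close>

lemma inner_weak_tendsto:
  assumes "\<And>n. norm (x n) \<le> C" "\<And>i. (\<lambda>n. coord (x n) i) \<longlonglongrightarrow> coord l i"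
  shows "(\<lambda>n. x n \<bullet> y) \<longlonglongrightarrow> l \<bullet> y"
proof -
  note d = weak_limit_dist_le[OF assms]
  define T where "T N = (\<Sum>i. (coord y (i + N))\<^sup>2)" for N
  have T: "T \<longlonglongrightarrow> 0"
    unfolding T_def by (rule suminf_exist_split2[OF summable_coord])
  have split: "\<bar>(x n - l) \<bullet> y\<bar> \<le> (\<Sum>i<N. \<bar>coord (x n) i - coord l i\<bar> * \<bar>coord y i\<bar>) + 2 * C * sqrt (T N)"
    for n N
  proof -
    let ?y = "\<Sum>i<N. coord y i *\<^sub>R unit_ell2 i"
    have cy: "coord (y - ?y) i = (if i < N then 0 else coord y i)" for i
      by (simp add: coord_sum if_distrib[of "(*) _"] cong: if_cong)
    have "(norm (y - ?y))\<^sup>2 = (\<Sum>i. (coord (y - ?y) i)\<^sup>2)"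
      using norm_sums[of "y - ?y"] by (simp add: sums_iff)
    also have "\<dots> = T N"
      unfolding T_def using suminf_split_initial_segment[OF summable_coord[of "y - ?y"], of N]
      by (simp add: cy del: coord_simps)
    finally have n: "norm (y - ?y) = sqrt (T N)" by (metis norm_ge_zero real_sqrt_unique)
    have "(x n - l) \<bullet> y = (x n - l) \<bullet> ?y + (x n - l) \<bullet> (y - ?y)"
      by (simp add: inner_add_right[symmetric])
    moreover have "\<bar>(x n - l) \<bullet> ?y\<bar> \<le> (\<Sum>i<N. \<bar>coord (x n) i - coord l i\<bar> * \<bar>coord y i\<bar>)"
      unfolding inner_sum_right by (rule order_trans[OF sum_abs])
        (simp add: inner_unit abs_mult mult.commute)
    moreover have "\<bar>(x n - l) \<bullet> (y - ?y)\<bar> \<le> 2 * C * sqrt (T N)"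
      using order_trans[OF Cauchy_Schwarz_ineq2 mult_right_mono[OF d norm_ge_zero]] n by metis
    ultimately show ?thesis by linarith
  qed
  have "(\<lambda>n. (x n - l) \<bullet> y) \<longlonglongrightarrow> 0"
  proof (rule LIMSEQ_I)
    fix e :: real assume e: "e > 0"
    have "(\<lambda>N. 2 * C * sqrt (T N)) \<longlonglongrightarrow> 2 * C * sqrt 0"
      by (intro tendsto_intros T)
    then have "\<forall>\<^sub>F N in sequentially. 2 * C * sqrt (T N) < e / 2"
      using e by (intro order_tendstoD(2)) auto
    then obtain N where N: "2 * C * sqrt (T N) < e / 2"
      using eventually_happens by fastforce
    have "(\<lambda>n. \<Sum>i<N. \<bar>coord (x n) i - coord l i\<bar> * \<bar>coord y i\<bar>) \<longlonglongrightarrow>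
        (\<Sum>i<N. \<bar>coord l i - coord l i\<bar> * \<bar>coord y i\<bar>)"
      by (intro tendsto_intros assms(2))
    then have "\<forall>\<^sub>F n in sequentially. (\<Sum>i<N. \<bar>coord (x n) i - coord l i\<bar> * \<bar>coord y i\<bar>) < e / 2"
      using e by (intro order_tendstoD(2)) auto
    then have "\<forall>\<^sub>F n in sequentially. norm ((x n - l) \<bullet> y - 0) < e"
    proof eventually_elim
      case (elim n)
      then show ?case using split[of n N] N by simp
    qed
    then show "\<exists>no. \<forall>n\<ge>no. norm ((x n - l) \<bullet> y - 0) < e"
      by (simp add: eventually_sequentially)
  qed
  then show ?thesis
    by (simp add: inner_diff_left LIM_zero_iff)
qed

text \<open>Positivity is asked of finite sections, since that is what a Gram representation
  delivers; it reaches all of \<open>ell2\<close> through truncation.\<close>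

locale hilbert_schmidt =
  fixes A :: "nat \<Rightarrow> nat \<Rightarrow> real"
  assumes sym: "A i j = A j i"
    and hs: "(\<lambda>(i, j). (A i j)\<^sup>2) summable_on UNIV"
    and psd: "finite F \<Longrightarrow> 0 \<le> (\<Sum>i\<in>F. \<Sum>j\<in>F. u i * A i j * u j)"
begin

lemma row_summable: "summable (\<lambda>j. (A i j)\<^sup>2)"
proof -
  have "(\<lambda>(i, j). (A i j)\<^sup>2) summable_on (SIGMA i:UNIV. UNIV)"
    using hs by simp
  from summable_on_SigmaD1[OF this] show ?thesis
    by (intro summable_on_imp_summable) auto
qed

definition row :: "nat \<Rightarrow> ell2" where "row i = Abs_ell2 (A i)"

lemma coord_row [simp]: "coord (row i) j = A i j"
  unfolding row_def using row_summable by (simp add: Abs_ell2_inverse)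

lemma summable_row_norm: "summable (\<lambda>i. (norm (row i))\<^sup>2)"
proof -
  have "(\<lambda>(i, j). (A i j)\<^sup>2) summable_on (SIGMA i:UNIV. UNIV)"
    using hs by simp
  then have "(\<lambda>i. \<Sum>\<^sub>\<infinity>j. (A i j)\<^sup>2) summable_on UNIV"
    by (rule summable_on_Sigma_banach)
  moreover have "(\<Sum>\<^sub>\<infinity>j. (A i j)\<^sup>2) = (norm (row i))\<^sup>2" for i
    using sums_nonneg_imp_has_sum[OF norm_sums[of "row i"]] by (intro infsumI) simp
  ultimately show ?thesis by (simp add: summable_on_imp_summable)
qed

lemma row_inner_square_le: "(row i \<bullet> x)\<^sup>2 \<le> (norm (row i))\<^sup>2 * (norm x)\<^sup>2"
  using Cauchy_Schwarz_ineq[of "row i" x] by (simp add: power2_norm_eq_inner)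

definition app :: "ell2 \<Rightarrow> ell2" where "app x = Abs_ell2 (\<lambda>i. row i \<bullet> x)"

lemma coord_app [simp]: "coord (app x) i = row i \<bullet> x"
proof -
  have "summable (\<lambda>i. (row i \<bullet> x)\<^sup>2)"
    by (rule summable_comparison_test'[OF summable_mult2[OF summable_row_norm]])
      (use row_inner_square_le in auto)
  then show ?thesis unfolding app_def by (simp add: Abs_ell2_inverse)
qed

lemma app_add: "app (x + y) = app x + app y"
  and app_scaleR: "app (r *\<^sub>R x) = r *\<^sub>R app x"
  and app_diff: "app (x - y) = app x - app y"
  by (auto intro!: ell2_eqI simp: inner_add_right inner_diff_right)

definition hs_norm :: real where "hs_norm = sqrt (\<Sum>i. (norm (row i))\<^sup>2)"

lemma norm_app_le: "norm (app x) \<le> hs_norm * norm x"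
proof -
  have "(norm (app x))\<^sup>2 = (\<Sum>i. (row i \<bullet> x)\<^sup>2)"
    using norm_sums[of "app x"] by (simp add: sums_iff)
  also have "\<dots> \<le> (\<Sum>i. (norm (row i))\<^sup>2 * (norm x)\<^sup>2)"
    using summable_coord[of "app x"]
    by (intro suminf_le summable_mult2 summable_row_norm row_inner_square_le) simp
  also have "\<dots> = (hs_norm * norm x)\<^sup>2"
    using summable_row_norm
    by (simp add: hs_norm_def power_mult_distrib suminf_mult2 suminf_nonneg)
  finally show ?thesis
    by (rule power2_le_imp_le) (simp add: hs_norm_def suminf_nonneg summable_row_norm)
qed

text \<open>This is compactness of a Hilbert-Schmidt operator: each row functional converges, and
  the squared row norms are a summable majorant, so Tannery's theorem turns weak convergence into
  norm convergence.\<close>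

lemma app_weak_tendsto:
  assumes "\<And>n. norm (x n) \<le> C" "\<And>i. (\<lambda>n. coord (x n) i) \<longlonglongrightarrow> coord l i"
  shows "(\<lambda>n. norm (app (x n) - app l)) \<longlonglongrightarrow> 0"
proof -
  note d = weak_limit_dist_le[OF assms]
  have "((\<lambda>n. \<Sum>i. (row i \<bullet> (x n - l))\<^sup>2) \<longlongrightarrow> (\<Sum>i. 0)) sequentially"
  proof (rule tannerys_theorem[THEN conjunct2, THEN conjunct2])
    fix i
    have "(\<lambda>n. (x n \<bullet> row i - l \<bullet> row i)\<^sup>2) \<longlonglongrightarrow> (l \<bullet> row i - l \<bullet> row i)\<^sup>2"
      by (intro tendsto_intros inner_weak_tendsto[OF assms])
    then show "(\<lambda>n. (row i \<bullet> (x n - l))\<^sup>2) \<longlonglongrightarrow> 0"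
      by (simp add: inner_diff_right inner_commute)
  next
    have "norm ((row i \<bullet> (x n - l))\<^sup>2) \<le> (norm (row i))\<^sup>2 * (2 * C)\<^sup>2" for i n
      using order_trans[OF row_inner_square_le mult_left_mono[OF power_mono[OF d]]] by simp
    then show "\<forall>\<^sub>F (i, n) in sequentially \<times>\<^sub>F sequentially.
        norm ((row i \<bullet> (x n - l))\<^sup>2) \<le> (norm (row i))\<^sup>2 * (2 * C)\<^sup>2"
      by (intro always_eventually) auto
  qed (auto intro!: summable_mult2 summable_row_norm)
  moreover have "(\<Sum>i. (row i \<bullet> (x n - l))\<^sup>2) = (norm (app (x n) - app l))\<^sup>2" for n
    using norm_sums[of "app (x n - l)"] by (simp add: sums_iff app_diff[symmetric])
  ultimately have "(\<lambda>n. (norm (app (x n) - app l))\<^sup>2) \<longlonglongrightarrow> 0" by simp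
  then show ?thesis by (simp add: power_tendsto_0_iff)
qed

text \<open>The form is split into the pairing of x_n with A x_n - A l, where a bounded factor meets
  a norm-null one, and the weakly convergent pairing of x_n with A l.\<close>

lemma form_weak_tendsto:
  assumes "\<And>n. norm (x n) \<le> C" "\<And>i. (\<lambda>n. coord (x n) i) \<longlonglongrightarrow> coord l i"
  shows "(\<lambda>n. x n \<bullet> app (x n)) \<longlonglongrightarrow> l \<bullet> app l"
proof -
  have "(\<lambda>n. x n \<bullet> (app (x n) - app l)) \<longlonglongrightarrow> 0"
  proof (rule Lim_null_comparison)
    have "norm (x n \<bullet> (app (x n) - app l)) \<le> C * norm (app (x n) - app l)" for n
      using order_trans[OF Cauchy_Schwarz_ineq2 mult_right_mono[OF assms(1) norm_ge_zero]] by simp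
    then show "\<forall>\<^sub>F n in sequentially.
        norm (x n \<bullet> (app (x n) - app l)) \<le> C * norm (app (x n) - app l)" by simp
    show "(\<lambda>n. C * norm (app (x n) - app l)) \<longlonglongrightarrow> 0"
      by (rule tendsto_mult_right_zero[OF app_weak_tendsto[OF assms]])
  qed
  from tendsto_add[OF this inner_weak_tendsto[OF assms, of "app l"]]
  show ?thesis by (simp add: inner_diff_right)
qed

definition trunc :: "nat \<Rightarrow> ell2 \<Rightarrow> ell2" where
  "trunc n x = (\<Sum>i<n. coord x i *\<^sub>R unit_ell2 i)"

lemma coord_trunc: "coord (trunc n x) i = (if i < n then coord x i else 0)"
  by (simp add: trunc_def coord_sum if_distrib[of "(*) _"] cong: if_cong)

lemma norm_trunc_le: "norm (trunc n x) \<le> norm x"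
proof -
  have "(norm (trunc n x))\<^sup>2 \<le> (norm x)\<^sup>2"
    by (rule sums_le[OF _ norm_sums norm_sums]) (simp add: coord_trunc)
  then show ?thesis by (rule power2_le_imp_le) simp
qed

lemma coord_trunc_tendsto: "(\<lambda>n. coord (trunc n x) i) \<longlonglongrightarrow> coord x i"
  by (rule tendsto_eventually)
    (auto simp: eventually_sequentially coord_trunc intro!: exI[of _ "Suc i"])

lemma app_trunc_form: "trunc n x \<bullet> app (trunc n y) = (\<Sum>i<n. \<Sum>j<n. coord x i * A i j * coord y j)"
  by (simp add: trunc_def inner_sum_left inner_sum_right unit_inner inner_unit
      sum_distrib_left mult_ac)

lemma form_nonneg: "0 \<le> x \<bullet> app x"
proof (rule tendsto_lowerbound)
  show "(\<lambda>n. trunc n x \<bullet> app (trunc n x)) \<longlonglongrightarrow> x \<bullet> app x"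
    by (rule form_weak_tendsto[OF norm_trunc_le coord_trunc_tendsto])
  show "\<forall>\<^sub>F n in sequentially. 0 \<le> trunc n x \<bullet> app (trunc n x)"
    by (simp add: app_trunc_form psd)
qed simp

lemma app_self_adjoint: "x \<bullet> app y = app x \<bullet> y"
proof -
  have lim: "(\<lambda>n. trunc n x \<bullet> app (trunc n y)) \<longlonglongrightarrow> x \<bullet> app y" for x y
  proof -
    have "(\<lambda>n. trunc n x \<bullet> (app (trunc n y) - app y)) \<longlonglongrightarrow> 0"
    proof (rule Lim_null_comparison)
      have "norm (trunc n x \<bullet> (app (trunc n y) - app y)) \<le> norm x * norm (app (trunc n y) - app y)" for n
        using order_trans[OF Cauchy_Schwarz_ineq2 mult_right_mono[OF norm_trunc_le norm_ge_zero]]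
        by simp
      then show "\<forall>\<^sub>F n in sequentially.
          norm (trunc n x \<bullet> (app (trunc n y) - app y)) \<le> norm x * norm (app (trunc n y) - app y)"
        by simp
      show "(\<lambda>n. norm x * norm (app (trunc n y) - app y)) \<longlonglongrightarrow> 0"
        by (rule tendsto_mult_right_zero[OF app_weak_tendsto[OF norm_trunc_le coord_trunc_tendsto]])
    qed
    from tendsto_add[OF this inner_weak_tendsto[OF norm_trunc_le coord_trunc_tendsto, of x "app y"]]
    show ?thesis by (simp add: inner_diff_right)
  qed
  have "trunc n x \<bullet> app (trunc n y) = trunc n y \<bullet> app (trunc n x)" for n
    unfolding app_trunc_form by (subst sum.swap) (simp add: sym mult_ac)
  with lim[of x y] lim[of y x] have "x \<bullet> app y = y \<bullet> app x"
    by (simp add: LIMSEQ_unique)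
  then show ?thesis by (simp add: inner_commute)
qed

text \<open>By self-adjointness the orthogonal complement \<open>M\<close> of \<open>E\<close> is
  invariant under \<open>app\<close>, so the maximization can be run inside \<open>M\<close>. The
  residual \<open>u\<close> of the eigenvalue equation then lies in \<open>M\<close> too and is an
  admissible direction of variation.\<close>

lemma eigenvector_in_complement:
  assumes E: "\<And>e. e \<in> E \<Longrightarrow> \<exists>c. app e = c *\<^sub>R e"
    and x0: "x0 \<noteq> 0" "\<And>e. e \<in> E \<Longrightarrow> e \<bullet> x0 = 0"
  obtains v \<mu> where "norm v = 1" "app v = \<mu> *\<^sub>R v" "\<And>e. e \<in> E \<Longrightarrow> e \<bullet> v = 0"
proof -
  define M where "M = {x. \<forall>e\<in>E. e \<bullet> x = 0}"
  have M_add: "x + y \<in> M" if "x \<in> M" "y \<in> M" for x y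
    using that by (simp add: M_def inner_add_right)
  have M_scale: "r *\<^sub>R x \<in> M" if "x \<in> M" for r x
    using that by (simp add: M_def)
  have M_app: "app x \<in> M" if "x \<in> M" for x
    using that E by (fastforce simp: M_def app_self_adjoint)
  define Q where "Q = (\<lambda>x. x \<bullet> app x) ` {x \<in> M. norm x \<le> 1}"
  have Q_le: "q \<le> hs_norm" if "q \<in> Q" for q
  proof -
    obtain x where x: "norm x \<le> 1" "q = x \<bullet> app x" using \<open>q \<in> Q\<close> by (auto simp: Q_def)
    have "q \<le> norm x * norm (app x)" unfolding x by (rule norm_cauchy_schwarz)
    also have "\<dots> \<le> 1 * (hs_norm * 1)"
      using x norm_app_le[of x] by (intro mult_mono order_trans[OF norm_app_le] mult_left_mono)
        (auto simp: hs_norm_def suminf_nonneg summable_row_norm)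
    finally show ?thesis by simp
  qed
  have bdd: "bdd_above Q" using Q_le by (auto simp: bdd_above_def)
  have "0 \<in> Q" unfolding Q_def by (rule image_eqI[of _ _ 0]) (auto simp: M_def)
  define \<mu> where "\<mu> = Sup Q"
  have \<mu>0: "0 \<le> \<mu>" unfolding \<mu>_def using \<open>0 \<in> Q\<close> bdd by (rule cSup_upper)
  have ex: "\<exists>x. x \<in> M \<and> norm x \<le> 1 \<and> \<mu> - inverse (real (Suc n)) < x \<bullet> app x" for n
  proof -
    have "\<mu> - inverse (real (Suc n)) < Sup Q" by (simp add: \<mu>_def)
    then obtain q where "q \<in> Q" "\<mu> - inverse (real (Suc n)) < q"
      using less_cSupD[of Q] \<open>0 \<in> Q\<close> by blast
    then show ?thesis by (auto simp: Q_def)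
  qed
  have "\<exists>x. \<forall>n. x n \<in> M \<and> norm (x n) \<le> 1 \<and> \<mu> - inverse (real (Suc n)) < x n \<bullet> app (x n)"
    by (intro choice allI ex)
  then obtain x where x: "\<And>n. x n \<in> M" "\<And>n. norm (x n) \<le> 1"
    "\<And>n. \<mu> - inverse (real (Suc n)) < x n \<bullet> app (x n)" by blast
  obtain l and r :: "nat \<Rightarrow> nat" where r: "strict_mono r" and l: "norm l \<le> 1"
    and lim: "\<And>i. (\<lambda>n. coord (x (r n)) i) \<longlonglongrightarrow> coord l i"
    by (rule weak_compact_ell2[OF x(2)]) (rule that)
  have "l \<in> M"
    unfolding M_def
  proof safe
    fix e assume "e \<in> E"
    have "(\<lambda>n. x (r n) \<bullet> e) \<longlonglongrightarrow> l \<bullet> e"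
      by (rule inner_weak_tendsto[OF x(2) lim])
    moreover have "x (r n) \<bullet> e = 0" for n
      using x(1)[of "r n"] \<open>e \<in> E\<close> by (simp add: M_def inner_commute)
    ultimately show "e \<bullet> l = 0" by (simp add: inner_commute LIMSEQ_const_iff)
  qed
  have "\<mu> \<le> l \<bullet> app l"
  proof (rule LIMSEQ_le)
    have "(\<lambda>n. \<mu> - inverse (real (Suc n))) \<longlonglongrightarrow> \<mu> - 0"
      by (intro tendsto_intros LIMSEQ_inverse_real_of_nat)
    then show "(\<lambda>n. \<mu> - inverse (real (Suc (r n)))) \<longlonglongrightarrow> \<mu>"
      using LIMSEQ_subseq_LIMSEQ[OF _ r] by (fastforce simp: o_def)
    show "(\<lambda>n. x (r n) \<bullet> app (x (r n))) \<longlonglongrightarrow> l \<bullet> app l"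
      by (rule form_weak_tendsto[OF x(2) lim])
    show "\<exists>N. \<forall>n\<ge>N. \<mu> - inverse (real (Suc (r n))) \<le> x (r n) \<bullet> app (x (r n))"
      using x(3) less_imp_le by blast
  qed
  have upper: "y \<bullet> app y \<le> \<mu> * (norm y)\<^sup>2" if "y \<in> M" for y
  proof (cases "y = 0")
    case False
    let ?y = "(1 / norm y) *\<^sub>R y"
    have "?y \<bullet> app ?y \<in> Q"
      unfolding Q_def using M_scale[OF that] False by (intro imageI) simp
    then have "?y \<bullet> app ?y \<le> \<mu>" unfolding \<mu>_def using bdd by (rule cSup_upper)
    then show ?thesis using False by (simp add: app_scaleR field_simps power2_eq_square)
  qed simp
  obtain v where v: "v \<in> M" "norm v = 1" "v \<bullet> app v = \<mu>"
  \<comment> \<open>If the supremum is 0, the weak limit may be the zero vector. The form then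
    vanishes on \<open>M\<close>, and the normalized \<open>x0\<close> is a maximizer.\<close>
  proof (cases "\<mu> = 0")
    case True
    let ?v = "(1 / norm x0) *\<^sub>R x0"
    have "?v \<in> M" using x0 by (intro M_scale) (simp add: M_def)
    moreover have "norm ?v = 1" using x0 by simp
    moreover have "?v \<bullet> app ?v = \<mu>"
      using upper[OF \<open>?v \<in> M\<close>] form_nonneg[of ?v] True by (simp del: inner_scaleR_left)
    ultimately show thesis by (rule that)
  next
    case False
    have "l \<noteq> 0" using False \<mu>0 \<open>\<mu> \<le> l \<bullet> app l\<close> by auto
    let ?v = "(1 / norm l) *\<^sub>R l"
    have vM: "?v \<in> M" using \<open>l \<in> M\<close> by (rule M_scale)
    have nv: "norm ?v = 1" using \<open>l \<noteq> 0\<close> by simp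
    \<comment> \<open>Weak limits can lose norm, so \<open>l\<close> may lie inside the ball; as
      \<mu> >= 0, normalizing it can only raise the form.\<close>
    have "\<mu> \<le> (l \<bullet> app l) / (norm l)\<^sup>2"
    proof -
      have "\<mu> * (norm l)\<^sup>2 \<le> \<mu> * 1"
        using \<mu>0 l by (intro mult_left_mono) (auto simp: power_le_one)
      also have "\<dots> \<le> l \<bullet> app l" using \<open>\<mu> \<le> l \<bullet> app l\<close> by simp
      finally show ?thesis using \<open>l \<noteq> 0\<close> by (simp add: field_simps)
    qed
    also have "\<dots> = ?v \<bullet> app ?v"
      using \<open>l \<noteq> 0\<close> by (simp add: app_scaleR power2_eq_square field_simps)
    finally have "?v \<bullet> app ?v = \<mu>" using upper[OF vM] nv by simp
    with vM nv show thesis by (rule that)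
  qed
  define u where "u = app v - \<mu> *\<^sub>R v"
  have "u \<in> M" unfolding u_def using M_add[OF M_app[OF v(1)] M_scale[OF v(1), of "-\<mu>"]] by simp
  \<comment> \<open>Variation of \<open>v\<close> in direction \<open>u\<close>: in the inequality
    form <= \<mu> norm^2, valid on all of \<open>M\<close>, the terms of order 0 cancel and those of
    order 1 leave 2t |u|^2.\<close>
  have quad: "2 * t * (u \<bullet> u) \<le> t\<^sup>2 * (\<mu> * (norm u)\<^sup>2)" for t
  proof -
    have "(v + t *\<^sub>R u) \<bullet> app (v + t *\<^sub>R u) = \<mu> + 2 * t * (u \<bullet> app v) + t\<^sup>2 * (u \<bullet> app u)"
      using v(3) app_self_adjoint[of v u]
      by (simp add: app_add app_scaleR inner_add_left inner_add_right inner_commute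
          power2_eq_square algebra_simps)
    moreover have "(norm (v + t *\<^sub>R u))\<^sup>2 = 1 + 2 * t * (u \<bullet> v) + t\<^sup>2 * (norm u)\<^sup>2"
      unfolding power2_norm_eq_inner using v(2)
      by (simp add: inner_add_left inner_add_right inner_commute power2_eq_square algebra_simps norm_eq_1)
    moreover have "(v + t *\<^sub>R u) \<bullet> app (v + t *\<^sub>R u) \<le> \<mu> * (norm (v + t *\<^sub>R u))\<^sup>2"
      by (intro upper M_add M_scale v \<open>u \<in> M\<close>)
    moreover have "u \<bullet> app v = u \<bullet> u + \<mu> * (u \<bullet> v)"
      by (simp add: u_def inner_diff_right inner_diff_left algebra_simps)
    moreover have "0 \<le> t\<^sup>2 * (u \<bullet> app u)" using form_nonneg by simp
    ultimately show ?thesis by (simp add: algebra_simps)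
  qed
  have "u \<bullet> u \<le> 0"
  proof (rule ccontr)
    assume "\<not> u \<bullet> u \<le> 0"
    then have pos: "0 < u \<bullet> u" by linarith
    \<comment> \<open>Any positive step with a \<mu> <= 1 keeps the quadratic term below the linear
      one; the summand 1 covers \<mu> = 0.\<close>
    define a where "a = 1 / (\<mu> + 1)"
    have a: "0 < a" "a * \<mu> \<le> 1" using \<mu>0 by (auto simp: a_def field_simps)
    have "2 * a * (u \<bullet> u) \<le> a\<^sup>2 * (\<mu> * (u \<bullet> u))"
      using quad[of a] by (simp add: power2_norm_eq_inner)
    also have "\<dots> = a * (u \<bullet> u) * (a * \<mu>)" by (simp add: power2_eq_square)
    also have "\<dots> \<le> a * (u \<bullet> u) * 1" using a pos by (intro mult_left_mono) auto
    finally show False using mult_pos_pos[OF a(1) pos] by simp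
  qed
  then have "u = 0" by (metis inner_ge_zero inner_eq_zero_iff order_antisym)
  then have "app v = \<mu> *\<^sub>R v" by (simp add: u_def)
  with v show thesis by (intro that[of v \<mu>]) (auto simp: M_def)
qed

lemma maximal_orthonormal_eigensystem:
  obtains E where "\<And>e. e \<in> E \<Longrightarrow> norm e = 1" "\<And>e. e \<in> E \<Longrightarrow> \<exists>c. app e = c *\<^sub>R e"
    "pairwise orthogonal E" "\<forall>x. (\<forall>e\<in>E. e \<bullet> x = 0) \<longrightarrow> x = 0"
proof -
  define \<A> where "\<A> = {E. (\<forall>e\<in>E. norm e = 1 \<and> (\<exists>c. app e = c *\<^sub>R e)) \<and> pairwise orthogonal E}"
  have "\<exists>M\<in>\<A>. \<forall>X\<in>\<A>. M \<subseteq> X \<longrightarrow> X = M"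
  proof (rule subset_Zorn')
    fix C assume C: "subset.chain \<A> C"
    have "pairwise orthogonal (\<Union>C)"
    proof (rule pairwiseI)
      fix x y assume "x \<in> \<Union>C" "y \<in> \<Union>C" "x \<noteq> y"
      then obtain X Y where XY: "X \<in> C" "x \<in> X" "Y \<in> C" "y \<in> Y" by blast
      then have "X \<subseteq> Y \<or> Y \<subseteq> X" using C by (auto simp: subset.chain_def)
      then obtain Z where "Z \<in> C" "x \<in> Z" "y \<in> Z" using XY by blast
      then show "orthogonal x y"
        using C \<open>x \<noteq> y\<close> by (auto simp: subset.chain_def \<A>_def pairwise_def)
    qed
    then show "\<Union>C \<in> \<A>" using C by (auto simp: subset.chain_def \<A>_def)
  qed
  then obtain E where E: "E \<in> \<A>" and max: "\<And>X. X \<in> \<A> \<Longrightarrow> E \<subseteq> X \<Longrightarrow> X = E" by blast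
  have total: "x = 0" if x: "\<And>e. e \<in> E \<Longrightarrow> e \<bullet> x = 0" for x
  proof (rule ccontr)
    assume "x \<noteq> 0"
    obtain v \<mu> where v: "norm v = 1" "app v = \<mu> *\<^sub>R v" "\<And>e. e \<in> E \<Longrightarrow> e \<bullet> v = 0"
      by (rule eigenvector_in_complement[of E x])
        (use E \<open>x \<noteq> 0\<close> x in \<open>auto simp: \<A>_def\<close>)
    have "insert v E \<in> \<A>"
      using E v by (auto simp: \<A>_def pairwise_insert orthogonal_def inner_commute)
    then have "v \<in> E" using max[of "insert v E"] by blast
    then show False using v(1) v(3)[of v] by (simp add: norm_eq_1)
  qed
  from E total show thesis by (intro that[of E]) (auto simp: \<A>_def)
qed

end

section \<open>Orthonormal systems, their expansions and their enumeration\<close>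

lemma bessel_finite:
  fixes e :: "'k \<Rightarrow> 'a :: real_inner"
  assumes "finite F" "\<And>k l. k \<in> F \<Longrightarrow> l \<in> F \<Longrightarrow> e k \<bullet> e l = (if k = l then 1 else 0)"
  shows "(norm (x - (\<Sum>k\<in>F. (x \<bullet> e k) *\<^sub>R e k)))\<^sup>2 = (norm x)\<^sup>2 - (\<Sum>k\<in>F. (x \<bullet> e k)\<^sup>2)"
proof -
  let ?s = "\<Sum>k\<in>F. (x \<bullet> e k) *\<^sub>R e k"
  have xs: "x \<bullet> ?s = (\<Sum>k\<in>F. (x \<bullet> e k)\<^sup>2)"
    by (simp add: inner_sum_right power2_eq_square)
  have "e k \<bullet> ?s = x \<bullet> e k" if "k \<in> F" for k
  proof -
    have "e k \<bullet> ?s = (\<Sum>l\<in>F. if k = l then x \<bullet> e l else 0)"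
      unfolding inner_sum_right by (rule sum.cong) (use assms that in auto)
    then show ?thesis using assms(1) that by simp
  qed
  then have ss: "?s \<bullet> ?s = (\<Sum>k\<in>F. (x \<bullet> e k)\<^sup>2)"
    by (subst inner_sum_left) (simp add: power2_eq_square)
  show ?thesis
    unfolding power2_norm_eq_inner by (simp add: inner_diff_left inner_diff_right inner_commute xs ss)
qed

lemma bessel_inequality:
  fixes e :: "'k \<Rightarrow> 'a :: real_inner"
  assumes "finite F" "\<And>k l. k \<in> F \<Longrightarrow> l \<in> F \<Longrightarrow> e k \<bullet> e l = (if k = l then 1 else 0)"
  shows "(\<Sum>k\<in>F. (x \<bullet> e k)\<^sup>2) \<le> (norm x)\<^sup>2"
  using bessel_finite[of F e x, OF assms] zero_le_power2[of "norm (x - (\<Sum>k\<in>F. (x \<bullet> e k) *\<^sub>R e k))"]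
  by linarith

text \<open>Convergence is wanted only coordinatewise. The remainders are bounded, and their
  coordinates converge because Bessel's inequality, for x and for a unit vector, makes the
  coefficient series absolutely convergent. The weak limit is orthogonal to the whole system and
  therefore 0.\<close>

lemma orthonormal_expansion:
  fixes e :: "nat \<Rightarrow> ell2"
  assumes on: "\<And>k l. e k \<bullet> e l = (if k = l then 1 else 0)"
    and total: "\<And>x. (\<And>k. e k \<bullet> x = 0) \<Longrightarrow> x = 0"
  shows "((\<lambda>k. (x \<bullet> e k) * coord (e k) j) has_sum coord x j) UNIV"
proof -
  have bess: "(\<Sum>k\<in>F. (y \<bullet> e k)\<^sup>2) \<le> (norm y)\<^sup>2" if "finite F" for F and y
    using that on by (intro bessel_inequality) auto
  have sm: "summable (\<lambda>k. (y \<bullet> e k)\<^sup>2)" for y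
    by (rule summableI_nonneg_bounded[of _ "(norm y)\<^sup>2"]) (use bess in auto)
  have sm2: "summable (\<lambda>k. \<bar>(x \<bullet> e k) * coord (e k) j\<bar>)"
    using summable_mult_of_squares(1)[OF sm[of x] sm[of "unit_ell2 j"]]
    by (simp add: unit_inner)
  define r where "r K = x - (\<Sum>k<K. (x \<bullet> e k) *\<^sub>R e k)" for K
  have rC: "norm (r K) \<le> norm x" for K
  proof -
    have "(norm (r K))\<^sup>2 \<le> (norm x)\<^sup>2"
      unfolding r_def using on by (subst bessel_finite) (auto intro: sum_nonneg)
    then show ?thesis by (rule power2_le_imp_le) simp
  qed
  have rg: "(\<lambda>K. coord (r K) i) \<longlonglongrightarrow> coord x i - (\<Sum>k. (x \<bullet> e k) * coord (e k) i)" for i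
  proof -
    have "summable (\<lambda>k. (x \<bullet> e k) * coord (e k) i)"
      using summable_mult_of_squares(2)[OF sm[of x] sm[of "unit_ell2 i"]]
      by (simp add: unit_inner)
    then have "(\<lambda>K. \<Sum>k<K. (x \<bullet> e k) * coord (e k) i) \<longlonglongrightarrow> (\<Sum>k. (x \<bullet> e k) * coord (e k) i)"
      by (rule summable_LIMSEQ)
    then show ?thesis
      unfolding r_def by (simp add: coord_sum) (intro tendsto_intros)
  qed
  obtain l where l: "coord l = (\<lambda>i. coord x i - (\<Sum>k. (x \<bullet> e k) * coord (e k) i))"
    using weak_limit_ell2[OF rC rg] by blast
  have "l = 0"
  proof (rule total)
    fix k
    have "(\<lambda>K. r K \<bullet> e k) \<longlonglongrightarrow> l \<bullet> e k"
      by (rule inner_weak_tendsto[OF rC]) (use rg l in simp)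
    moreover have "\<forall>\<^sub>F K in sequentially. r K \<bullet> e k = 0"
      using eventually_gt_at_top[of k]
    proof eventually_elim
      case (elim K)
      have "(\<Sum>l<K. (x \<bullet> e l) *\<^sub>R e l) \<bullet> e k = (\<Sum>l<K. if l = k then x \<bullet> e l else 0)"
        unfolding inner_sum_left by (rule sum.cong) (auto simp: on)
      then show ?case using elim by (simp add: r_def inner_diff_left)
    qed
    ultimately have "l \<bullet> e k = 0"
      using tendsto_eventually LIMSEQ_unique by metis
    then show "e k \<bullet> l = 0" by (simp add: inner_commute)
  qed
  then have "coord x j = (\<Sum>k. (x \<bullet> e k) * coord (e k) j)"
    using fun_cong[OF l, of j] by simp
  then show ?thesis
    using sm2 by (intro norm_summable_imp_has_sum) (auto simp: summable_sums summable_rabs_cancel)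
qed

text \<open>\<open>diagonalizes\<close> indexes eigenvectors by the same set as the coordinates, so
  the system must be countably infinite. Each member has a nonzero coordinate, and Bessel's
  inequality for the n-th unit vector allows only countably many with a nonzero n-th one.\<close>

lemma enumerate_total_orthonormal:
  assumes norm1: "\<And>e. e \<in> E \<Longrightarrow> norm e = 1" and orth: "pairwise orthogonal E"
    and total: "\<And>x. (\<And>e. e \<in> E \<Longrightarrow> e \<bullet> x = 0) \<Longrightarrow> x = 0"
  obtains e :: "nat \<Rightarrow> ell2" where "range e = E" "\<And>k l. e k \<bullet> e l = (if k = l then 1 else 0)"
proof -
  have on: "a \<bullet> b = (if a = b then 1 else 0)" if "a \<in> E" "b \<in> E" for a b
    using that norm1 orth by (auto simp: pairwise_def orthogonal_def norm_eq_1)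
  have bess: "(\<Sum>e\<in>F. (coord e n)\<^sup>2) \<le> 1" if "finite F" "F \<subseteq> E" for F n
  proof -
    have "(\<Sum>e\<in>F. (unit_ell2 n \<bullet> e)\<^sup>2) \<le> (norm (unit_ell2 n))\<^sup>2"
      using that on by (intro bessel_inequality[where e = "\<lambda>x. x"]) (auto simp: subset_iff)
    then show ?thesis by (simp add: unit_inner)
  qed
  have "countable {e \<in> E. coord e n \<noteq> 0}" for n
  proof -
    have "(\<lambda>e. (coord e n)\<^sup>2) summable_on E"
      by (rule nonneg_bdd_above_summable_on) (auto simp: bdd_above_def intro!: exI[of _ 1] bess)
    then show ?thesis using summable_countable_real by fastforce
  qed
  then have "countable (\<Union>n. {e \<in> E. coord e n \<noteq> 0})" by simp
  moreover have "E \<subseteq> (\<Union>n. {e \<in> E. coord e n \<noteq> 0})"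
  proof
    fix e assume "e \<in> E"
    then have "e \<noteq> 0" using norm1 by force
    then obtain n where "coord e n \<noteq> 0" using ell2_eqI[of e 0] by auto
    then show "e \<in> (\<Union>n. {e \<in> E. coord e n \<noteq> 0})" using \<open>e \<in> E\<close> by blast
  qed
  ultimately have "countable E" by (rule countable_subset[rotated])
  moreover have "infinite E"
  proof
    assume fin: "finite E"
    \<comment> \<open>A finite total system would satisfy Parseval's identity for every unit vector;
      summing the squared coordinates in both orders then bounds every N by
      \<open>card E\<close>.\<close>
    have one: "(\<Sum>e\<in>E. (coord e n)\<^sup>2) = 1" for n
    proof -
      let ?x = "unit_ell2 n - (\<Sum>e\<in>E. (unit_ell2 n \<bullet> e) *\<^sub>R e)"
      have "?x = 0"
      proof (rule total)
        fix b assume "b \<in> E"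
        have "b \<bullet> (\<Sum>e\<in>E. (unit_ell2 n \<bullet> e) *\<^sub>R e) = (\<Sum>e\<in>E. if e = b then unit_ell2 n \<bullet> e else 0)"
          unfolding inner_sum_right by (rule sum.cong) (use on \<open>b \<in> E\<close> in auto)
        then show "b \<bullet> ?x = 0"
          using fin \<open>b \<in> E\<close> by (simp add: inner_diff_right inner_commute)
      qed
      then have "(norm ?x)\<^sup>2 = 0" by (simp only: norm_zero power_zero_numeral)
      moreover have "(norm ?x)\<^sup>2 = (norm (unit_ell2 n))\<^sup>2 - (\<Sum>e\<in>E. (unit_ell2 n \<bullet> e)\<^sup>2)"
        by (rule bessel_finite[where e = "\<lambda>x. x"]) (use fin on in auto)
      ultimately have "(\<Sum>e\<in>E. (unit_ell2 n \<bullet> e)\<^sup>2) = (norm (unit_ell2 n))\<^sup>2" by linarith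
      then show ?thesis
        by (simp add: unit_inner)
    qed
    have "(\<Sum>e\<in>E. \<Sum>n<N. (coord e n)\<^sup>2) \<le> (\<Sum>e\<in>E. 1)" for N
    proof (rule sum_mono)
      show "(\<Sum>n<N. (coord e n)\<^sup>2) \<le> 1" if "e \<in> E" for e
        using sum_coord_square_le[of e N] norm1[OF that] by simp
    qed
    moreover have "(\<Sum>e\<in>E. \<Sum>n<N. (coord e n)\<^sup>2) = real N" for N
      by (subst sum.swap) (simp add: one)
    ultimately have "real N \<le> real (card E)" for N by simp
    from this[of "Suc (card E)"] show False by simp
  qed
  ultimately have bij: "bij_betw (from_nat_into E) UNIV E" by (rule bij_betw_from_nat_into)
  show thesis
  proof (rule that[of "from_nat_into E"])
    show "range (from_nat_into E) = E" using bij by (simp add: bij_betw_def)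
    fix k l
    have "from_nat_into E k \<in> E" "from_nat_into E l \<in> E" using bij by (auto simp: bij_betw_def)
    moreover have "from_nat_into E k = from_nat_into E l \<longleftrightarrow> k = l"
      using bij by (auto simp: bij_betw_def inj_on_def)
    ultimately show "from_nat_into E k \<bullet> from_nat_into E l = (if k = l then 1 else 0)"
      using on by simp
  qed
qed

theorem (in hilbert_schmidt) spectral_decomposition:
  obtains V :: "nat \<Rightarrow> nat \<Rightarrow> real" and p :: "nat \<Rightarrow> real" where
    "\<And>k l. ((\<lambda>i. V i k * V i l) has_sum (if k = l then 1 else 0)) UNIV"
    "\<And>i j. ((\<lambda>k. V i k * V j k) has_sum (if i = j then 1 else 0)) UNIV"
    "\<And>i j. ((\<lambda>k. V i k * p k * V j k) has_sum A i j) UNIV"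
    "\<And>k. 0 \<le> p k" "bounded (range p)"
proof -
  obtain E where norm1: "\<And>e. e \<in> E \<Longrightarrow> norm e = 1" and ev: "\<And>e. e \<in> E \<Longrightarrow> \<exists>c. app e = c *\<^sub>R e"
    and orth: "pairwise orthogonal E" and total0: "\<forall>x. (\<forall>e\<in>E. e \<bullet> x = 0) \<longrightarrow> x = 0"
    by (rule maximal_orthonormal_eigensystem) (rule that)
  have total: "x = 0" if "\<And>e. e \<in> E \<Longrightarrow> e \<bullet> x = 0" for x
    using total0 that by blast
  obtain e :: "nat \<Rightarrow> ell2" where e: "range e = E" and on: "\<And>k l. e k \<bullet> e l = (if k = l then 1 else 0)"
    using enumerate_total_orthonormal[OF norm1 orth total] by metis
  have total': "x = 0" if "\<And>k. e k \<bullet> x = 0" for x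
    using total[of x] that e by blast
  note expand = orthonormal_expansion[of e, OF on total']
  define p where "p k = e k \<bullet> app (e k)" for k
  have app_e: "app (e k) = p k *\<^sub>R e k" for k
  proof -
    obtain c where "app (e k) = c *\<^sub>R e k" using ev[of "e k"] e by blast
    then show ?thesis by (simp add: p_def on)
  qed
  show thesis
  proof (rule that[of "\<lambda>i k. coord (e k) i" p])
    fix k l i j
    have "((\<lambda>i. coord (e k) i * coord (e l) i) has_sum (e k \<bullet> e l)) UNIV"
      using summable_mult_of_squares(1)[OF summable_coord[of "e k"] summable_coord[of "e l"]]
      by (intro norm_summable_imp_has_sum inner_sums) simp
    then show "((\<lambda>i. coord (e k) i * coord (e l) i) has_sum (if k = l then 1 else 0)) UNIV"
      by (simp add: on)
    show "((\<lambda>k. coord (e k) i * coord (e k) j) has_sum (if i = j then 1 else 0)) UNIV"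
      using expand[of "unit_ell2 i" j] 
      by (cases "i = j") (simp_all add: unit_inner)
    have "row i \<bullet> e k = coord (e k) i * p k" for k
      using arg_cong[OF app_e[of k], of "\<lambda>x. coord x i"] by (simp add: mult.commute)
    then show "((\<lambda>k. coord (e k) i * p k * coord (e k) j) has_sum A i j) UNIV"
      using expand[of "row i" j] by simp
    show "0 \<le> p k" unfolding p_def by (rule form_nonneg)
    have "norm (p k) \<le> hs_norm" for k
      using norm_app_le[of "e k"] norm1[of "e k"] e by (auto simp: app_e)
    then show "bounded (range p)" by (auto simp: bounded_iff)
  qed
qed

section \<open>The bosonic channel on coherent states\<close>

lemma negative_binomial_series:
  fixes w :: real
  assumes "0 \<le> w" "w < 1"
  shows "((\<lambda>k. real ((k + j) choose j) * w ^ k) has_sum 1 / (1 - w) ^ (j + 1)) UNIV"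
proof (rule sums_nonneg_imp_has_sum)
  have "(\<lambda>k. ((- real (j + 1)) gchoose k) * (- w) ^ k) sums (1 + (- w)) powr (- real (j + 1))"
    by (rule gen_binomial_real) (use assms in auto)
  moreover have "((- real (j + 1)) gchoose k) * (- w) ^ k = real ((k + j) choose j) * w ^ k" for k
  proof -
    have "((- real (j + 1)) gchoose k) = (- 1) ^ k * ((real (j + 1) + real k - 1) gchoose k)"
      by (rule gbinomial_minus)
    also have "(real (j + 1) + real k - 1) = real (k + j)" by simp
    also have "(real (k + j) gchoose k) = real ((k + j) choose k)"
      by (rule binomial_gbinomial[symmetric])
    also have "((k + j) choose k) = ((k + j) choose j)"
      using binomial_symmetric[of k "k + j"] by simp
    finally show ?thesis
      by (simp add: power_mult_distrib[symmetric] mult_ac flip: power_mult_distrib)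
  qed
  moreover have "(1 + (- w)) powr (- real (j + 1)) = 1 / (1 - w) ^ (j + 1)"
    unfolding powr_minus_divide using assms by (subst powr_realpow) auto
  ultimately show "(\<lambda>k. real ((k + j) choose j) * w ^ k) sums (1 / (1 - w) ^ (j + 1))"
    by simp
qed (use assms in auto)

lemma exp_has_sum: "((\<lambda>j. x ^ j / fact j) has_sum exp x) UNIV" for x :: real
proof (rule norm_summable_imp_has_sum)
  show "summable (\<lambda>n. norm (x ^ n / fact n))"
    using summable_norm_exp[of x] by (simp add: divide_inverse mult.commute)
  show "(\<lambda>j. x ^ j / fact j) sums exp x"
    using exp_converges[of x] by (simp add: divide_inverse mult.commute)
qed

text \<open>The sum over k gives 1/(1 - w)^(j+1), and the powers of 1/(1 - w) go into the argument
  of the exponential series over j. It serves twice: for the vacuum entry of the channel output and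
  for the summability of its diagonal.\<close>

lemma exp_negative_binomial_series:
  fixes v w :: real
  assumes "0 \<le> w" "w < 1" "0 \<le> v"
  shows "((\<lambda>(j, k). real ((k + j) choose j) * w ^ k * (v ^ j / fact j)) has_sum exp (v / (1 - w)) / (1 - w)) UNIV"
proof -
  let ?f = "\<lambda>p. real ((snd p + fst p) choose fst p) * w ^ snd p * (v ^ fst p / fact (fst p))"
  have inner: "((\<lambda>k. ?f (j, k)) has_sum ((v / (1 - w)) ^ j / fact j) * (1 / (1 - w))) UNIV" for j
    using has_sum_cmult_left[OF negative_binomial_series[OF assms(1,2), of j], of "v ^ j / fact j"]
    by (simp add: power_divide mult_ac)
  have outer: "((\<lambda>j. ((v / (1 - w)) ^ j / fact j) * (1 / (1 - w))) has_sum exp (v / (1 - w)) * (1 / (1 - w))) UNIV"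
    by (intro has_sum_cmult_left exp_has_sum)
  have "?f summable_on (SIGMA j:UNIV. UNIV)"
    by (rule summable_on_SigmaI[OF inner has_sum_imp_summable[OF outer]]) (use assms in auto)
  from has_sum_SigmaI[OF inner outer this] show ?thesis
    by (simp add: case_prod_unfold)
qed

lemma has_sum_inj_reindex:
  assumes "inj h" "\<And>x. x \<notin> range h \<Longrightarrow> F x = 0"
  shows "(F has_sum S) UNIV \<longleftrightarrow> ((\<lambda>x. F (h x)) has_sum S) UNIV"
proof -
  have "(F has_sum S) UNIV \<longleftrightarrow> (F has_sum S) (range h)"
    by (rule has_sum_cong_neutral) (use assms(2) in auto)
  then show ?thesis using has_sum_reindex[OF assms(1), of F S] by (simp add: o_def)
qed

lemma has_sum_shift_fst:
  fixes F :: "nat \<times> nat \<Rightarrow> real"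
  assumes "\<And>e. F (0, e) = 0"
  shows "(F has_sum S) UNIV \<longleftrightarrow> ((\<lambda>(k, e). F (Suc k, e)) has_sum S) UNIV"
proof -
  have "F x = 0" if "x \<notin> range (\<lambda>(k, e). (Suc k, e))" for x
    using that assms by (cases x; cases "fst x") (auto simp: image_iff)
  then show ?thesis
    by (subst has_sum_inj_reindex[of "\<lambda>(k, e). (Suc k, e)" F S])
      (auto simp: inj_def case_prod_unfold)
qed

lemma has_sum_shift_snd:
  fixes F :: "nat \<times> nat \<Rightarrow> real"
  assumes "\<And>k. F (k, 0) = 0"
  shows "(F has_sum S) UNIV \<longleftrightarrow> ((\<lambda>(k, e). F (k, Suc e)) has_sum S) UNIV"
proof -
  have "F x = 0" if "x \<notin> range (\<lambda>(k, e). (k, Suc e))" for x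
    using that assms by (cases x; cases "snd x") (auto simp: image_iff)
  then show ?thesis
    by (subst has_sum_inj_reindex[of "\<lambda>(k, e). (k, Suc e)" F S])
      (auto simp: inj_def case_prod_unfold)
qed

section \<open>Matrix elements of the beamsplitter\<close>

lemma lin_comb_create_apply:
  "lin_comb r create_fst s create_snd \<psi> (b, e) =
     complex_of_real (r * sqrt (real b)) * \<psi> (b - 1, e) + complex_of_real (s * sqrt (real e)) * \<psi> (b, e - 1)"
  by (simp add: lin_comb_def create_fst_def create_snd_def mult_ac)

lemma lin_comb_create_commute:
  "lin_comb r create_fst s create_snd (lin_comb r' create_fst s' create_snd \<psi>) =
   lin_comb r' create_fst s' create_snd (lin_comb r create_fst s create_snd \<psi>)"
proof (rule ext, clarify)
  fix b e
  show "lin_comb r create_fst s create_snd (lin_comb r' create_fst s' create_snd \<psi>) (b, e) =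
   lin_comb r' create_fst s' create_snd (lin_comb r create_fst s create_snd \<psi>) (b, e)"
    unfolding lin_comb_create_apply by (simp add: algebra_simps)
qed

lemma lin_comb_create_real:
  assumes "\<And>x. Im (\<psi> x) = 0"
  shows "Im (lin_comb r create_fst s create_snd \<psi> x) = 0"
  using assms by (cases x) (simp add: lin_comb_create_apply)

lemma lin_comb_create_homogeneous:
  assumes "\<And>x. \<psi> x \<noteq> 0 \<Longrightarrow> fst x + snd x = n"
  shows "lin_comb r create_fst s create_snd \<psi> x \<noteq> 0 \<Longrightarrow> fst x + snd x = Suc n"
proof -
  assume nz: "lin_comb r create_fst s create_snd \<psi> x \<noteq> 0"
  obtain b e where x: "x = (b, e)" by (cases x)
  have "(b \<noteq> 0 \<and> \<psi> (b - 1, e) \<noteq> 0) \<or> (e \<noteq> 0 \<and> \<psi> (b, e - 1) \<noteq> 0)"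
    using nz unfolding x lin_comb_create_apply by (auto intro: ccontr)
  then show ?thesis using assms[of "(b - 1, e)"] assms[of "(b, e - 1)"] x by auto
qed

definition bs_re :: "real \<Rightarrow> nat \<times> nat \<Rightarrow> nat \<times> nat \<Rightarrow> real" where
  "bs_re \<eta> x y = Re (beamsplitter \<eta> x y)"

lemma beamsplitter_real: "beamsplitter \<eta> x y = complex_of_real (bs_re \<eta> x y)"
proof -
  have step: "(\<And>x. Im (\<psi> x) = 0) \<Longrightarrow> Im ((lin_comb r create_fst s create_snd ^^ n) \<psi> x) = 0" for \<psi> r s n x
    by (induction n arbitrary: x) (auto intro: lin_comb_create_real)
  have "Im (beamsplitter \<eta> x y) = 0"
    unfolding beamsplitter_def by (simp add: step vac2_def)
  then show ?thesis by (simp add: bs_re_def complex_eq_iff)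
qed

lemma beamsplitter_number:
  assumes "beamsplitter \<eta> x y \<noteq> 0"
  shows "fst x + snd x = fst y + snd y"
proof -
  have step: "(\<And>x. \<psi> x \<noteq> 0 \<Longrightarrow> fst x + snd x = m) \<Longrightarrow>
      (lin_comb r create_fst s create_snd ^^ n) \<psi> x \<noteq> 0 \<Longrightarrow> fst x + snd x = n + m" for \<psi> r s n x m
  proof (induction n arbitrary: x)
    case (Suc n)
    then show ?case
      using lin_comb_create_homogeneous[of "(lin_comb r create_fst s create_snd ^^ n) \<psi>" "n + m"] by simp
  qed simp
  have "vac2 x \<noteq> 0 \<Longrightarrow> fst x + snd x = 0" for x
    by (simp add: vac2_def split: if_splits)
  from step[OF step[OF this]] assms show ?thesis
    by (simp add: beamsplitter_def)
qed

lemma bs_re_vacuum: "bs_re \<eta> (0, 0) (0, 0) = 1"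
  by (simp add: bs_re_def beamsplitter_vacuum vac2_def)

lemma bs_re_annih_fst:
  "sqrt (real (Suc b)) * bs_re \<eta> (Suc b, e) (n, k) =
     sqrt \<eta> * (sqrt (real n) * bs_re \<eta> (b, e) (n - 1, k)) + sqrt (1 - \<eta>) * (sqrt (real k) * bs_re \<eta> (b, e) (n, k - 1))"
  using fun_cong[OF beamsplitter_heisenberg(1)[of \<eta> n k], of "(b, e)"]
  by (simp add: annih_fst_def beamsplitter_real del: of_nat_Suc of_real_mult of_real_add
      flip: of_real_mult of_real_add)

lemma bs_re_annih_snd:
  "sqrt (real (Suc e)) * bs_re \<eta> (b, Suc e) (n, k) =
     - sqrt (1 - \<eta>) * (sqrt (real n) * bs_re \<eta> (b, e) (n - 1, k)) + sqrt \<eta> * (sqrt (real k) * bs_re \<eta> (b, e) (n, k - 1))"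
  using fun_cong[OF beamsplitter_heisenberg(2)[of \<eta> n k], of "(b, e)"]
  by (simp add: annih_snd_def beamsplitter_real del: of_nat_Suc of_real_mult of_real_add of_real_minus of_real_diff
      flip: of_real_mult of_real_add of_real_minus of_real_diff)

text \<open>The relation for the creation operator of the environment. It is read off the
  definition: the additional factor for mode c commutes past the n factors for mode a, and the
  normalization supplies the square root.\<close>

lemma bs_re_create:
  "sqrt (real (Suc k)) * bs_re \<eta> (b, e) (n, Suc k) =
     sqrt (1 - \<eta>) * (sqrt (real b) * bs_re \<eta> (b - 1, e) (n, k)) + sqrt \<eta> * (sqrt (real e) * bs_re \<eta> (b, e - 1) (n, k))"
proof -
  let ?P = "lin_comb (sqrt \<eta>) create_fst (- sqrt (1 - \<eta>)) create_snd"
  let ?Q = "lin_comb (sqrt (1 - \<eta>)) create_fst (sqrt \<eta>) create_snd"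
  have comm: "(?P ^^ m) (?Q \<psi>) = ?Q ((?P ^^ m) \<psi>)" for m \<psi>
    by (induction m) (simp_all add: lin_comb_create_commute)
  let ?d = "complex_of_real (sqrt (fact n * fact k))"
  have d: "complex_of_real (sqrt (fact n * fact (Suc k))) = complex_of_real (sqrt (real (Suc k))) * ?d"
    unfolding of_real_mult[symmetric] real_sqrt_mult[symmetric] by (simp add: mult_ac)
  have "complex_of_real (sqrt (real (Suc k))) * beamsplitter \<eta> (b, e) (n, Suc k) = ?Q ((?P ^^ n) ((?Q ^^ k) vac2)) (b, e) / ?d"
    unfolding beamsplitter_def fst_conv snd_conv d by (simp add: comm del: of_nat_Suc)
  also have "\<dots> = complex_of_real (sqrt (1 - \<eta>) * sqrt (real b)) * beamsplitter \<eta> (b - 1, e) (n, k)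
      + complex_of_real (sqrt \<eta> * sqrt (real e)) * beamsplitter \<eta> (b, e - 1) (n, k)"
    unfolding lin_comb_create_apply beamsplitter_def by (simp add: add_divide_distrib)
  finally have "complex_of_real (sqrt (real (Suc k)) * bs_re \<eta> (b, e) (n, Suc k)) = complex_of_real
     (sqrt (1 - \<eta>) * (sqrt (real b) * bs_re \<eta> (b - 1, e) (n, k)) + sqrt \<eta> * (sqrt (real e) * bs_re \<eta> (b, e - 1) (n, k)))"
    by (simp add: beamsplitter_real mult.assoc del: of_nat_Suc)
  then show ?thesis by (simp only: of_real_eq_iff)
qed

section \<open>Output amplitudes for a coherent input of real amplitude\<close>

definition coh_re :: "real \<Rightarrow> nat \<Rightarrow> real" where
  "coh_re \<beta> n = exp (- \<beta>\<^sup>2 / 2) * \<beta> ^ n / sqrt (fact n)"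

text \<open>The eigenvalue equation of the annihilation operator at a coherent state.\<close>

lemma coh_re_Suc: "sqrt (real (Suc n)) * coh_re \<beta> (Suc n) = \<beta> * coh_re \<beta> n"
proof -
  have "sqrt (fact (Suc n)) = sqrt (real (Suc n)) * sqrt (fact n)"
    by (simp add: real_sqrt_mult del: of_nat_Suc)
  then show ?thesis by (simp add: coh_re_def field_simps del: of_nat_Suc)
qed

text \<open>The amplitude of the output (b, e) when the inputs are the coherent state and the number state k;
  number conservation selects a single term of the coherent superposition.\<close>
definition out_amp :: "real \<Rightarrow> real \<Rightarrow> nat \<Rightarrow> nat \<Rightarrow> nat \<Rightarrow> real" where
  "out_amp \<eta> \<beta> k b e = (if k \<le> b + e then coh_re \<beta> (b + e - k) * bs_re \<eta> (b, e) (b + e - k, k) else 0)"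

text \<open>Here n is counted for a total of b + e + 1 photons, one of which is removed. The
  predecessors \<open>n - 1\<close> and \<open>k - 1\<close> truncate only where the factor
  \<open>sqrt (real n)\<close> or \<open>sqrt (real k)\<close> vanishes.\<close>

lemma out_amp_lower:
  assumes "k \<le> Suc (b + e)"
  defines "n \<equiv> Suc (b + e) - k"
  shows "sqrt (real n) * coh_re \<beta> n * bs_re \<eta> (b, e) (n - 1, k) = \<beta> * out_amp \<eta> \<beta> k b e"
    and "sqrt (real k) * (coh_re \<beta> n * bs_re \<eta> (b, e) (n, k - 1)) = sqrt (real k) * out_amp \<eta> \<beta> (k - 1) b e"
proof -
  show "sqrt (real n) * coh_re \<beta> n * bs_re \<eta> (b, e) (n - 1, k) = \<beta> * out_amp \<eta> \<beta> k b e"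
  proof (cases n)
    case 0
    then show ?thesis using assms by (simp add: out_amp_def)
  next
    case (Suc i)
    then have "i = b + e - k" "k \<le> b + e" using assms by auto
    then show ?thesis unfolding Suc coh_re_Suc by (simp add: out_amp_def)
  qed
  show "sqrt (real k) * (coh_re \<beta> n * bs_re \<eta> (b, e) (n, k - 1)) = sqrt (real k) * out_amp \<eta> \<beta> (k - 1) b e"
    using assms by (cases k) (auto simp: out_amp_def)
qed

text \<open>Annihilation on the coherent input merely multiplies by \<beta>, so only the environment
  index k is lowered. The three relations for \<open>out_amp\<close> therefore close up without
  mention of the signal photon number.\<close>

lemma out_amp_annih_fst:
  "sqrt (real (Suc b)) * out_amp \<eta> \<beta> k (Suc b) e =
     sqrt \<eta> * \<beta> * out_amp \<eta> \<beta> k b e + sqrt (1 - \<eta>) * (sqrt (real k) * out_amp \<eta> \<beta> (k - 1) b e)"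
proof (cases "k \<le> Suc (b + e)")
  case True
  let ?n = "Suc (b + e) - k"
  have "sqrt (real (Suc b)) * out_amp \<eta> \<beta> k (Suc b) e = coh_re \<beta> ?n * (sqrt (real (Suc b)) * bs_re \<eta> (Suc b, e) (?n, k))"
    using True by (simp add: out_amp_def del: of_nat_Suc)
  also have "\<dots> = sqrt \<eta> * (sqrt (real ?n) * coh_re \<beta> ?n * bs_re \<eta> (b, e) (?n - 1, k))
      + sqrt (1 - \<eta>) * (sqrt (real k) * (coh_re \<beta> ?n * bs_re \<eta> (b, e) (?n, k - 1)))"
    unfolding bs_re_annih_fst by (simp add: algebra_simps)
  finally show ?thesis unfolding out_amp_lower[OF True] by (simp add: mult.assoc)
qed (simp add: out_amp_def)

lemma out_amp_annih_snd:
  "sqrt (real (Suc e)) * out_amp \<eta> \<beta> k b (Suc e) =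
     - sqrt (1 - \<eta>) * \<beta> * out_amp \<eta> \<beta> k b e + sqrt \<eta> * (sqrt (real k) * out_amp \<eta> \<beta> (k - 1) b e)"
proof (cases "k \<le> Suc (b + e)")
  case True
  let ?n = "Suc (b + e) - k"
  have "sqrt (real (Suc e)) * out_amp \<eta> \<beta> k b (Suc e) = coh_re \<beta> ?n * (sqrt (real (Suc e)) * bs_re \<eta> (b, Suc e) (?n, k))"
    using True by (simp add: out_amp_def del: of_nat_Suc)
  also have "\<dots> = - sqrt (1 - \<eta>) * (sqrt (real ?n) * coh_re \<beta> ?n * bs_re \<eta> (b, e) (?n - 1, k))
      + sqrt \<eta> * (sqrt (real k) * (coh_re \<beta> ?n * bs_re \<eta> (b, e) (?n, k - 1)))"
    unfolding bs_re_annih_snd by (simp add: algebra_simps)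
  finally show ?thesis unfolding out_amp_lower[OF True] by (simp add: mult.assoc)
qed (simp add: out_amp_def)

lemma out_amp_create:
  "sqrt (real (Suc k)) * out_amp \<eta> \<beta> (Suc k) b e =
     sqrt (1 - \<eta>) * (sqrt (real b) * out_amp \<eta> \<beta> k (b - 1) e) + sqrt \<eta> * (sqrt (real e) * out_amp \<eta> \<beta> k b (e - 1))"
proof (cases "Suc k \<le> b + e")
  case False
  then show ?thesis by (cases b; cases e) (auto simp: out_amp_def)
next
  case True
  define n where "n = b + e - Suc k"
  have "sqrt (real (Suc k)) * out_amp \<eta> \<beta> (Suc k) b e = coh_re \<beta> n * (sqrt (real (Suc k)) * bs_re \<eta> (b, e) (n, Suc k))"
    using True by (simp add: out_amp_def n_def del: of_nat_Suc)
  also have "\<dots> = sqrt (1 - \<eta>) * (sqrt (real b) * (coh_re \<beta> n * bs_re \<eta> (b - 1, e) (n, k)))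
      + sqrt \<eta> * (sqrt (real e) * (coh_re \<beta> n * bs_re \<eta> (b, e - 1) (n, k)))"
    unfolding bs_re_create by (simp add: algebra_simps)
  also have "sqrt (real b) * (coh_re \<beta> n * bs_re \<eta> (b - 1, e) (n, k)) = sqrt (real b) * out_amp \<eta> \<beta> k (b - 1) e"
    using True by (cases b) (auto simp: out_amp_def n_def)
  also have "sqrt (real e) * (coh_re \<beta> n * bs_re \<eta> (b, e - 1) (n, k)) = sqrt (real e) * out_amp \<eta> \<beta> k b (e - 1)"
    using True by (cases e) (auto simp: out_amp_def n_def)
  finally show ?thesis .
qed

text \<open>The coefficient of x^e in (t x)^k exp(u x); \<open>zero_amp_Suc\<close> expresses the
  derivative of this function.\<close>

definition zero_amp :: "real \<Rightarrow> real \<Rightarrow> nat \<Rightarrow> nat \<Rightarrow> real" where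
  "zero_amp t u k e = (if k \<le> e then t ^ k * u ^ (e - k) / fact (e - k) else 0)"

lemma zero_amp_Suc:
  "real (Suc e) * zero_amp t u k (Suc e) = u * zero_amp t u k e + t * (real k * zero_amp t u (k - 1) e)"
proof (cases k)
  case 0
  then show ?thesis by (simp add: zero_amp_def field_simps del: of_nat_Suc)
next
  case (Suc i)
  consider "e < i" | "e = i" | d where "e = Suc (i + d)"
    by (metis less_imp_Suc_add linorder_neqE_nat)
  then show ?thesis
  proof cases
    case 3
    have "1 / fact d = real (Suc d) / (fact (Suc d) :: real)" by (simp del: of_nat_Suc)
    moreover have "real (Suc e) = real (Suc d) + real k" using 3 Suc by simp
    ultimately have "real (Suc e) / fact (Suc d) = 1 / fact d + real k / fact (Suc d)"
      by (simp only: add_divide_distrib)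
    then have "real (Suc e) / fact (Suc d) * (t ^ k * u ^ Suc d) = (1 / fact d + real k / fact (Suc d)) * (t ^ k * u ^ Suc d)"
      by simp
    moreover have "Suc e - k = Suc d" "e - k = d" "e - (k - 1) = Suc d" "k \<le> e" using 3 Suc by auto
    ultimately show ?thesis
      using Suc by (simp add: zero_amp_def algebra_simps del: of_nat_Suc fact_Suc)
  qed (simp_all add: Suc zero_amp_def)
qed

lemma sqrt_div_sqrt_fact: "sqrt (real k) / sqrt (fact (k - 1)) = real k / sqrt (fact k)"
proof (cases k)
  case (Suc i)
  have "sqrt (fact k) = sqrt (real k) * sqrt (fact i)"
    unfolding Suc by (simp add: real_sqrt_mult del: of_nat_Suc)
  moreover have "real k = sqrt (real k) * sqrt (real k)" by simp
  ultimately show ?thesis using Suc by (simp add: field_simps del: of_nat_Suc)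
qed simp

lemma out_amp_zero:
  "out_amp \<eta> \<beta> k 0 e = exp (- \<beta>\<^sup>2 / 2) * (sqrt (fact e) / sqrt (fact k)) * zero_amp (sqrt \<eta>) (- sqrt (1 - \<eta>) * \<beta>) k e"
proof (induction e arbitrary: k)
  case 0
  then show ?case by (simp add: out_amp_def bs_re_vacuum coh_re_def zero_amp_def)
next
  case (Suc e)
  let ?E = "exp (- \<beta>\<^sup>2 / 2)" and ?u = "- sqrt (1 - \<eta>) * \<beta>" and ?s = "sqrt (real (Suc e))"
  let ?w = "zero_amp (sqrt \<eta>) ?u"
  have fe: "sqrt (fact (Suc e)) = ?s * sqrt (fact e)"
    by (simp add: real_sqrt_mult del: of_nat_Suc)
  have "?s * out_amp \<eta> \<beta> k 0 (Suc e) =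
     ?u * out_amp \<eta> \<beta> k 0 e + sqrt \<eta> * (sqrt (real k) * out_amp \<eta> \<beta> (k - 1) 0 e)"
    by (rule out_amp_annih_snd)
  also have "\<dots> = ?E * sqrt (fact e) * (?u * ?w k e / sqrt (fact k)
      + sqrt \<eta> * (sqrt (real k) / sqrt (fact (k - 1))) * ?w (k - 1) e)"
    unfolding Suc.IH by (simp add: algebra_simps)
  also have "\<dots> = ?E * sqrt (fact e) / sqrt (fact k) * (?u * ?w k e + sqrt \<eta> * (real k * ?w (k - 1) e))"
    unfolding sqrt_div_sqrt_fact by (simp add: field_simps)
  also have "\<dots> = ?E * sqrt (fact e) / sqrt (fact k) * (?s * ?s * ?w k (Suc e))"
    unfolding zero_amp_Suc[symmetric] by (simp del: of_nat_Suc)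
  also have "\<dots> = ?s * (?E * (sqrt (fact (Suc e)) / sqrt (fact k)) * ?w k (Suc e))"
    unfolding fe by (simp add: mult_ac del: of_nat_Suc)
  finally have eq: "?s * out_amp \<eta> \<beta> k 0 (Suc e) = ?s * (?E * (sqrt (fact (Suc e)) / sqrt (fact k)) * ?w k (Suc e))" .
  have "?s \<noteq> 0" by simp
  from eq show ?case by (simp only: mult_left_cancel[OF \<open>?s \<noteq> 0\<close>])
qed

text \<open>Only e >= k contributes. With e = k + j the squared amplitudes become terms of the
  double series above with w = y \<eta> and v = (1 - \<eta>) \<beta>^2.\<close>

lemma out_amp_zero_square_has_sum:
  assumes "0 < \<eta>" "\<eta> < 1" "0 \<le> y" "y < 1"
  shows "((\<lambda>(k, e). y ^ k * (out_amp \<eta> \<beta> k 0 e)\<^sup>2) has_sum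
    exp (- \<beta>\<^sup>2) * (exp ((1 - \<eta>) * \<beta>\<^sup>2 / (1 - y * \<eta>)) / (1 - y * \<eta>))) UNIV"
proof -
  have w: "0 \<le> y * \<eta>" "y * \<eta> < 1"
    using assms mult_strict_mono[of y 1 \<eta> 1] by auto
  let ?h = "\<lambda>(j, k). (k, k + j) :: nat \<times> nat"
  let ?F = "\<lambda>(k, e). y ^ k * (out_amp \<eta> \<beta> k 0 e)\<^sup>2"
  have "?F x = 0" if "x \<notin> range ?h" for x
  proof -
    obtain k e where x: "x = (k, e)" by (cases x)
    have "\<not> k \<le> e" using that unfolding x by (auto simp: image_iff le_iff_add)
    then show ?thesis by (simp add: x out_amp_zero zero_amp_def)
  qed
  then have *: "(?F has_sum S) UNIV \<longleftrightarrow> ((\<lambda>x. ?F (?h x)) has_sum S) UNIV" for S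
    by (intro has_sum_inj_reindex) (auto simp: inj_def)
  have "y ^ k * (out_amp \<eta> \<beta> k 0 (k + j))\<^sup>2 = exp (- \<beta>\<^sup>2) *
      (real ((k + j) choose j) * (y * \<eta>) ^ k * (((1 - \<eta>) * \<beta>\<^sup>2) ^ j / fact j))" for j k
  proof -
    have "real ((k + j) choose j) = fact (k + j) / (fact j * fact k)"
      using binomial_fact[of j "k + j", where 'a = real] by simp
    moreover have pw: "(x ^ i)\<^sup>2 = (x\<^sup>2) ^ i" for x :: real and i
      by (simp add: power_mult[symmetric] mult.commute)
    moreover have "(exp (- \<beta>\<^sup>2 / 2))\<^sup>2 = exp (- \<beta>\<^sup>2)"
      by (simp add: exp_double[symmetric])
    moreover have "(sqrt \<eta> ^ k)\<^sup>2 = \<eta> ^ k" "((- sqrt (1 - \<eta>) * \<beta>) ^ j)\<^sup>2 = ((1 - \<eta>) * \<beta>\<^sup>2) ^ j"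
      unfolding pw using assms by (simp_all add: power_mult_distrib)
    ultimately show ?thesis
      unfolding out_amp_zero zero_amp_def
      by (simp add: power_mult_distrib power_divide mult_ac power2_eq_square[of "fact _"])
  qed
  then have "?F (?h x) = exp (- \<beta>\<^sup>2) * (case x of (j, k) \<Rightarrow>
      real ((k + j) choose j) * (y * \<eta>) ^ k * (((1 - \<eta>) * \<beta>\<^sup>2) ^ j / fact j))" for x
    by (cases x) simp
  then show ?thesis
    unfolding * using has_sum_cmult_right[OF exp_negative_binomial_series[OF w, of "(1 - \<eta>) * \<beta>\<^sup>2"], of "exp (- \<beta>\<^sup>2)"] assms
    by simp
qed

section \<open>Summability of weighted squared amplitudes\<close>

lemma linear_times_geometric_bound:
  fixes y z :: real
  assumes "0 \<le> y" "y < z"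
  obtains C where "\<And>k. real (Suc k) * y ^ k \<le> C * z ^ k"
proof -
  have \<rho>: "0 \<le> y / z" "y / z < 1" using assms by auto
  let ?S = "1 / (1 - y / z) ^ (1 + 1)"
  have "real (Suc k) * y ^ k \<le> ?S * z ^ k" for k
  proof -
    have "(\<Sum>k\<in>{k}. real ((k + 1) choose 1) * (y / z) ^ k) \<le> ?S"
      by (rule finite_sum_le_has_sum[OF negative_binomial_series[OF \<rho>]]) (use \<rho> in auto)
    then have "real (Suc k) * (y / z) ^ k * z ^ k \<le> ?S * z ^ k"
      using assms by (intro mult_right_mono) auto
    then show ?thesis using assms by (simp add: power_divide)
  qed
  then show thesis by (rule that)
qed

text \<open>The additional factor k is absorbed by passing from y to a larger z < 1; this is why
  summability is assumed for every weight below 1.\<close>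

lemma shifted_square_summable:
  fixes f :: "nat \<Rightarrow> nat \<Rightarrow> real"
  assumes f: "\<And>z. 0 \<le> z \<Longrightarrow> z < 1 \<Longrightarrow> (\<lambda>(k, e). z ^ k * (f k e)\<^sup>2) summable_on UNIV"
    and y: "0 \<le> y" "y < 1"
  shows "(\<lambda>(k, e). y ^ k * (sqrt (real k) * f (k - 1) e)\<^sup>2) summable_on UNIV"
proof -
  obtain z where z: "y < z" "z < 1" using y dense by blast
  obtain C where C: "\<And>k. real (Suc k) * y ^ k \<le> C * z ^ k"
    by (rule linear_times_geometric_bound[OF y(1) z(1)]) (rule that)
  have "(\<lambda>p. C * (case p of (k, e) \<Rightarrow> z ^ k * (f k e)\<^sup>2)) summable_on UNIV"
    by (intro summable_on_cmult_right f) (use y z in auto)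
  then have "(\<lambda>(k, e). y ^ Suc k * (sqrt (real (Suc k)) * f (Suc k - 1) e)\<^sup>2) summable_on UNIV"
  proof (rule summable_on_comparison_test)
    fix p :: "nat \<times> nat"
    obtain k e where p: "p = (k, e)" by (cases p)
    have "y ^ Suc k * real (Suc k) \<le> real (Suc k) * y ^ k"
      using y by (simp add: mult_left_le_one_le mult_ac del: of_nat_Suc)
    also have "\<dots> \<le> C * z ^ k" by (rule C)
    finally have "y ^ Suc k * real (Suc k) * (f k e)\<^sup>2 \<le> C * z ^ k * (f k e)\<^sup>2"
      by (rule mult_right_mono) simp
    then show "(case p of (k, e) \<Rightarrow> y ^ Suc k * (sqrt (real (Suc k)) * f (Suc k - 1) e)\<^sup>2)
        \<le> C * (case p of (k, e) \<Rightarrow> z ^ k * (f k e)\<^sup>2)"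
      unfolding p by (simp add: power_mult_distrib mult.assoc[symmetric] del: of_nat_Suc power_Suc)
    show "0 \<le> (case p of (k, e) \<Rightarrow> y ^ Suc k * (sqrt (real (Suc k)) * f (Suc k - 1) e)\<^sup>2)"
      unfolding p using y by simp
  qed
  then show ?thesis
    using has_sum_shift_fst[of "\<lambda>(k, e). y ^ k * (sqrt (real k) * f (k - 1) e)\<^sup>2"]
    by (simp add: summable_on_def case_prod_unfold)
qed

text \<open>Each further photon in b brings one shift in k through the annihilation relation, and
  each shift enlarges the weight; hence y stays arbitrary in the induction.\<close>

lemma out_amp_square_summable:
  assumes \<eta>: "0 < \<eta>" "\<eta> < 1" and "0 \<le> y" "y < 1"
  shows "(\<lambda>(k, e). y ^ k * (out_amp \<eta> \<beta> k b e)\<^sup>2) summable_on UNIV"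
  using assms(3,4)
proof (induction b arbitrary: y)
  case 0
  then show ?case using out_amp_zero_square_has_sum[OF \<eta>] has_sum_imp_summable by blast
next
  case (Suc b)
  let ?P = "\<lambda>k e. out_amp \<eta> \<beta> k b e"
  have "(\<lambda>p. 2 * (\<eta> * \<beta>\<^sup>2) * (case p of (k, e) \<Rightarrow> y ^ k * (?P k e)\<^sup>2)
      + 2 * (1 - \<eta>) * (case p of (k, e) \<Rightarrow> y ^ k * (sqrt (real k) * ?P (k - 1) e)\<^sup>2)) summable_on UNIV"
    by (intro summable_on_add summable_on_cmult_right shifted_square_summable Suc)
  then show ?case
  proof (rule summable_on_comparison_test)
    fix p :: "nat \<times> nat"
    obtain k e where p: "p = (k, e)" by (cases p)
    let ?A = "sqrt \<eta> * \<beta> * ?P k e" and ?B = "sqrt (1 - \<eta>) * (sqrt (real k) * ?P (k - 1) e)"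
    have "(out_amp \<eta> \<beta> k (Suc b) e)\<^sup>2 \<le> real (Suc b) * (out_amp \<eta> \<beta> k (Suc b) e)\<^sup>2"
      by (simp add: algebra_simps)
    also have "\<dots> = (sqrt (real (Suc b)) * out_amp \<eta> \<beta> k (Suc b) e)\<^sup>2"
      by (simp add: power_mult_distrib)
    also have "\<dots> = (?A + ?B)\<^sup>2" unfolding out_amp_annih_fst ..
    also have "\<dots> \<le> 2 * ?A\<^sup>2 + 2 * ?B\<^sup>2"
      using sum_squares_bound[of ?A ?B] by (simp add: power2_sum)
    also have "\<dots> = 2 * (\<eta> * \<beta>\<^sup>2) * (?P k e)\<^sup>2 + 2 * (1 - \<eta>) * (sqrt (real k) * ?P (k - 1) e)\<^sup>2"
      using \<eta> by (simp add: power_mult_distrib)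
    finally have "y ^ k * (out_amp \<eta> \<beta> k (Suc b) e)\<^sup>2 \<le>
        y ^ k * (2 * (\<eta> * \<beta>\<^sup>2) * (?P k e)\<^sup>2 + 2 * (1 - \<eta>) * (sqrt (real k) * ?P (k - 1) e)\<^sup>2)"
      using Suc.prems by (intro mult_left_mono) auto
    then show "(case p of (k, e) \<Rightarrow> y ^ k * (out_amp \<eta> \<beta> k (Suc b) e)\<^sup>2)
        \<le> 2 * (\<eta> * \<beta>\<^sup>2) * (case p of (k, e) \<Rightarrow> y ^ k * (?P k e)\<^sup>2)
          + 2 * (1 - \<eta>) * (case p of (k, e) \<Rightarrow> y ^ k * (sqrt (real k) * ?P (k - 1) e)\<^sup>2)"
      unfolding p by (simp add: distrib_left mult.left_commute)
    show "0 \<le> (case p of (k, e) \<Rightarrow> y ^ k * (out_amp \<eta> \<beta> k (Suc b) e)\<^sup>2)"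
      using Suc.prems unfolding p by simp
  qed
qed

text \<open>This is b! b'! times the coefficient of s^b t^b' in exp(q s t + c s + c t). The
  recursion \<open>binomial_kernel_Suc\<close> is differentiation in s, and the expansion in powers
  of q s t is the source of the Gram representation \<open>D_gram\<close>.\<close>

definition binomial_kernel :: "real \<Rightarrow> real \<Rightarrow> nat \<Rightarrow> nat \<Rightarrow> real" where
  "binomial_kernel q c b b' = (\<Sum>j\<le>b'. real (b choose j) * real (b' choose j) * fact j * q ^ j * c ^ (b - j) * c ^ (b' - j))"

text \<open>The matrix elements of a thermal state with mean photon number N displaced by the real amplitude g.\<close>
definition displaced_thermal :: "real \<Rightarrow> real \<Rightarrow> nat \<Rightarrow> nat \<Rightarrow> real" where
  "displaced_thermal N g b b' = exp (- g\<^sup>2 / (N + 1)) / (N + 1) / (sqrt (fact b) * sqrt (fact b'))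
     * binomial_kernel (N / (N + 1)) (g / (N + 1)) b b'"

lemma binomial_kernel_0: "binomial_kernel q c 0 b' = c ^ b'"
proof -
  have "binomial_kernel q c 0 b' = (\<Sum>j\<in>{0}. real (0 choose j) * real (b' choose j) * fact j * q ^ j * c ^ (0 - j) * c ^ (b' - j))"
    unfolding binomial_kernel_def by (rule sum.mono_neutral_right) auto
  then show ?thesis by simp
qed

lemma binomial_kernel_Suc: "binomial_kernel q c (Suc b) b' = c * binomial_kernel q c b b' + q * real b' * binomial_kernel q c b (b' - 1)"
proof (cases b')
  case 0
  then show ?thesis by (simp add: binomial_kernel_def)
next
  case (Suc i)
  let ?u = "\<lambda>a j. real a * real (b' choose Suc j) * fact (Suc j) * q ^ Suc j * c ^ (Suc b - Suc j) * c ^ (b' - Suc j)"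
  have cs: "c * c ^ (b - j) * real (b choose j) = c ^ (Suc b - j) * real (b choose j)" for j
    by (cases "j \<le> b") (simp_all add: Suc_diff_le)
  have "q * real b' * binomial_kernel q c b i = (\<Sum>j\<le>i. ?u (b choose j) j)"
    unfolding binomial_kernel_def sum_distrib_left
  proof (rule sum.cong[OF refl])
    fix j
    have "real b' * real (i choose j) = real (Suc j) * real (b' choose Suc j)"
      unfolding Suc of_nat_mult[symmetric] by (simp only: Suc_times_binomial_eq mult.commute)
    then have *: "real b' * real (i choose j) * fact j = real (b' choose Suc j) * fact (Suc j)"
      by (simp add: mult_ac del: of_nat_Suc)
    show "q * real b' * (real (b choose j) * real (i choose j) * fact j * q ^ j * c ^ (b - j) * c ^ (i - j)) =
        ?u (b choose j) j"
      using arg_cong[OF *, of "\<lambda>x. x * (q * real (b choose j) * q ^ j * c ^ (b - j) * c ^ (i - j))"] Suc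
      by (simp add: mult_ac del: of_nat_Suc fact_Suc)
  qed
  moreover have "c * binomial_kernel q c b b' = c ^ Suc b * c ^ b'
      + (\<Sum>j\<le>i. ?u (b choose Suc j) j)"
  proof -
    have "c * binomial_kernel q c b b' = (\<Sum>j\<le>Suc i. real (b choose j) * real (b' choose j) * fact j * q ^ j * c ^ (Suc b - j) * c ^ (b' - j))"
      unfolding binomial_kernel_def sum_distrib_left Suc[symmetric]
      by (rule sum.cong[OF refl]) (use cs in \<open>auto simp: mult_ac\<close>)
    then show ?thesis by (simp add: sum.atMost_Suc_shift del: sum.atMost_Suc fact_Suc power_Suc binomial_Suc_Suc)
  qed
  moreover have "binomial_kernel q c (Suc b) b' = c ^ Suc b * c ^ b'
      + (\<Sum>j\<le>i. ?u (Suc b choose Suc j) j)"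
    unfolding binomial_kernel_def by (subst Suc, subst sum.atMost_Suc_shift) (simp del: sum.atMost_Suc fact_Suc power_Suc binomial_Suc_Suc)
  ultimately show ?thesis
    using Suc by (simp add: sum.distrib[symmetric] algebra_simps del: fact_Suc power_Suc of_nat_Suc)
qed

text \<open>\<open>S\<close> is the Gram sum of the amplitudes with thermal weights,
  \<open>T\<close> the same sum with the environment index of one factor lowered. Lowering b
  expresses \<open>S\<close> through \<open>S\<close> and \<open>T\<close>; a second relation
  expresses \<open>T\<close> through \<open>S\<close> and itself with coefficient x \<eta> < 1, so
  \<open>T\<close> can be eliminated. What remains is the recursion of
  \<open>binomial_kernel\<close>.\<close>

lemma out_amp_gram:
  assumes \<eta>: "0 < \<eta>" "\<eta> < 1" and NB: "0 < N_B"
  defines "x \<equiv> N_B / (N_B + 1)"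
  shows "((\<lambda>(k, e). (1 - x) * (x ^ k * out_amp \<eta> \<beta> k b e * out_amp \<eta> \<beta> k b' e)) has_sum
    displaced_thermal ((1 - \<eta>) * N_B) (sqrt \<eta> * \<beta>) b b') UNIV"
proof -
  let ?P = "\<lambda>k b e. out_amp \<eta> \<beta> k b e" and ?t = "sqrt \<eta>" and ?r = "sqrt (1 - \<eta>)"
  let ?F = "\<lambda>b b' p. case p of (k, e) \<Rightarrow> x ^ k * ?P k b e * ?P k b' e"
  let ?G = "\<lambda>b b' p. case p of (k, e) \<Rightarrow> x ^ k * (sqrt (real k) * ?P (k - 1) b e) * ?P k b' e"
  have x: "0 \<le> x" "x < 1" using NB by (auto simp: x_def)
  note sq = out_amp_square_summable[OF \<eta> x]
  define S where "S b b' = (\<Sum>\<^sub>\<infinity>(k, e). x ^ k * ?P k b e * ?P k b' e)" for b b'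
  define T where "T b b' = (\<Sum>\<^sub>\<infinity>(k, e). x ^ k * (sqrt (real k) * ?P (k - 1) b e) * ?P k b' e)" for b b'
  have cross: "(\<lambda>(k, e). x ^ k * f k e * g k e) summable_on UNIV"
    if "(\<lambda>(k, e). x ^ k * (f k e)\<^sup>2) summable_on UNIV" "(\<lambda>(k, e). x ^ k * (g k e)\<^sup>2) summable_on UNIV"
    for f g :: "nat \<Rightarrow> nat \<Rightarrow> real"
  proof (rule Infinite_Sum.abs_summable_summable, rule Infinite_Sum.abs_summable_on_comparison_test')
    show "(\<lambda>p. (case p of (k, e) \<Rightarrow> x ^ k * (f k e)\<^sup>2) + (case p of (k, e) \<Rightarrow> x ^ k * (g k e)\<^sup>2)) summable_on UNIV"
      by (rule summable_on_add[OF that])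
    fix p :: "nat \<times> nat"
    obtain k e where p: "p = (k, e)" by (cases p)
    have "x ^ k * \<bar>f k e * g k e\<bar> \<le> x ^ k * ((f k e)\<^sup>2 + (g k e)\<^sup>2)"
      using x by (intro mult_left_mono abs_mult_le_sum_squares) auto
    then show "norm (case p of (k, e) \<Rightarrow> x ^ k * f k e * g k e)
        \<le> (case p of (k, e) \<Rightarrow> x ^ k * (f k e)\<^sup>2) + (case p of (k, e) \<Rightarrow> x ^ k * (g k e)\<^sup>2)"
      using x by (simp add: p abs_mult distrib_left)
  qed
  have S: "((\<lambda>(k, e). x ^ k * ?P k b e * ?P k b' e) has_sum S b b') UNIV" for b b'
    unfolding S_def by (intro has_sum_infsum cross sq)
  note sq_shift = shifted_square_summable[OF out_amp_square_summable[OF \<eta>] x]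
  have T: "((\<lambda>(k, e). x ^ k * (sqrt (real k) * ?P (k - 1) b e) * ?P k b' e) has_sum T b b') UNIV" for b b'
    unfolding T_def by (intro has_sum_infsum cross sq sq_shift)
  have S_sym: "S b b' = S b' b" for b b'
    unfolding S_def by (simp add: mult_ac)
  have rec1: "sqrt (real (Suc b)) * S (Suc b) b' = ?t * \<beta> * S b b' + ?r * T b b'" for b b'
  proof (rule has_sum_unique)
    show "((\<lambda>p. sqrt (real (Suc b)) * ?F (Suc b) b' p) has_sum sqrt (real (Suc b)) * S (Suc b) b') UNIV"
      by (rule has_sum_cmult_right[OF S])
    have "((\<lambda>p. ?t * \<beta> * ?F b b' p + ?r * ?G b b' p) has_sum ?t * \<beta> * S b b' + ?r * T b b') UNIV"
      by (intro has_sum_add has_sum_cmult_right S T)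
    moreover have "?t * \<beta> * ?F b b' p + ?r * ?G b b' p
      = sqrt (real (Suc b)) * ?F (Suc b) b' p" for p
    proof -
      obtain k e where p: "p = (k, e)" by (cases p)
      show ?thesis
        using arg_cong[OF out_amp_annih_fst[of b \<eta> \<beta> k e], of "\<lambda>y. y * (x ^ k * ?P k b' e)"]
        unfolding p by (simp add: algebra_simps del: of_nat_Suc)
    qed
    ultimately show "((\<lambda>p. sqrt (real (Suc b)) * ?F (Suc b) b' p) has_sum ?t * \<beta> * S b b' + ?r * T b b') UNIV"
      by simp
  qed
  \<comment> \<open>After the shift from k to k + 1 the creation relation is applied to the factor
    with b'; after a shift in e the annihilation relation of the lost mode is applied to the factor
    with b.\<close>
  have rec2: "T b b' = x * (?r * sqrt (real b') * S b (b' - 1) + ?t * (- ?r * \<beta> * S b b' + ?t * T b b'))" for b b'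
  proof (rule has_sum_unique[OF T])
    let ?T = "x * (?r * sqrt (real b') * S b (b' - 1) + ?t * (- ?r * \<beta> * S b b' + ?t * T b b'))"
    let ?H = "\<lambda>p. case p of (k, e) \<Rightarrow> x ^ k * ?P k b e * (sqrt (real e) * ?P k b' (e - 1))"
    have "((\<lambda>p. - ?r * \<beta> * ?F b b' p + ?t * ?G b b' p) has_sum - ?r * \<beta> * S b b' + ?t * T b b') UNIV"
      by (intro has_sum_add has_sum_cmult_right S T)
    moreover have "- ?r * \<beta> * ?F b b' p + ?t * ?G b b' p
      = (case p of (k, e) \<Rightarrow> x ^ k * ?P k b (Suc e) * (sqrt (real (Suc e)) * ?P k b' (Suc e - 1)))" for p
    proof -
      obtain k e where p: "p = (k, e)" by (cases p)
      show ?thesis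
        using arg_cong[OF out_amp_annih_snd[of e \<eta> \<beta> k b], of "\<lambda>y. y * (x ^ k * ?P k b' e)"]
        unfolding p by (simp add: algebra_simps del: of_nat_Suc)
    qed
    ultimately have W: "((\<lambda>(k, e). x ^ k * ?P k b e * (sqrt (real e) * ?P k b' (e - 1))) has_sum - ?r * \<beta> * S b b' + ?t * T b b') UNIV"
      by (subst has_sum_shift_snd) (simp_all add: case_prod_unfold)
    have "((\<lambda>p. x * (?r * sqrt (real b') * ?F b (b' - 1) p + ?t * ?H p))
      has_sum ?T) UNIV"
      by (intro has_sum_add has_sum_cmult_right S W)
    moreover have "x * (?r * sqrt (real b') * ?F b (b' - 1) p + ?t * ?H p)
      = (case p of (k, e) \<Rightarrow> x ^ Suc k * (sqrt (real (Suc k)) * ?P (Suc k - 1) b e) * ?P (Suc k) b' e)" for p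
    proof -
      obtain k e where p: "p = (k, e)" by (cases p)
      show ?thesis
        using arg_cong[OF out_amp_create[of k \<eta> \<beta> b' e], of "\<lambda>y. y * (x ^ Suc k * ?P k b e)"]
        unfolding p by (simp add: algebra_simps del: of_nat_Suc)
    qed
    ultimately have Z: "((\<lambda>(k, e). x ^ Suc k * (sqrt (real (Suc k)) * ?P (Suc k - 1) b e) * ?P (Suc k) b' e) has_sum
        ?T) UNIV"
      by (simp only:)
    show "((\<lambda>(k, e). x ^ k * (sqrt (real k) * ?P (k - 1) b e) * ?P k b' e) has_sum
        ?T) UNIV"
      by (rule has_sum_shift_fst[THEN iffD2]) (use Z in \<open>simp_all only: prod.case\<close>, simp)
  qed
  define N where "N = (1 - \<eta>) * N_B"
  define q c where "q = N / (N + 1)" and "c = ?t * \<beta> / (N + 1)"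
  have N: "0 < N" using \<eta> NB by (simp add: N_def)
  \<comment> \<open>The first equation gives the denominator left by the elimination of
    \<open>T\<close>; it replaces the environment's N_B + 1 by N + 1.\<close>
  have x\<eta>: "1 - x * \<eta> = (N + 1) / (N_B + 1)" "1 - x = 1 / (N_B + 1)"
    using NB by (auto simp: x_def N_def field_simps)
  have rec: "sqrt (real (Suc b)) * S (Suc b) b' = c * S b b' + q * sqrt (real b') * S b (b' - 1)" for b b'
  proof -
    have "T b b' * (1 - x * \<eta>) = x * ?r * (sqrt (real b') * S b (b' - 1) - ?t * \<beta> * S b b')"
    proof -
      have "?t * (?t * T b b') = \<eta> * T b b'" using \<eta> by (simp add: mult.assoc[symmetric])
      with rec2[of b b'] show ?thesis by (simp add: algebra_simps)
    qed
    moreover have "1 - x * \<eta> \<noteq> 0" using N NB by (simp add: x\<eta>)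
    ultimately have T_eq: "T b b' = x * ?r * (sqrt (real b') * S b (b' - 1) - ?t * \<beta> * S b b') / (1 - x * \<eta>)"
      by (simp only: eq_divide_eq if_True not_False_eq_True)
    have "?r * T b b' = (?r * (x * ?r) / (1 - x * \<eta>)) * (sqrt (real b') * S b (b' - 1) - ?t * \<beta> * S b b')"
      unfolding T_eq by simp
    also have "?r * (x * ?r) / (1 - x * \<eta>) = q"
    proof -
      have "?r * (x * ?r) = x * (1 - \<eta>)" using \<eta> by (simp add: mult.left_commute)
      also have "\<dots> / (1 - x * \<eta>) = q" unfolding x\<eta> using NB N by (simp add: x_def q_def N_def)
      finally show ?thesis .
    qed
    finally have rT: "?r * T b b' = q * (sqrt (real b') * S b (b' - 1) - ?t * \<beta> * S b b')" .
    have "?t * \<beta> - q * (?t * \<beta>) = c"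
      using N by (simp add: q_def c_def field_simps)
    then have "c * S b b' = (?t * \<beta> - q * (?t * \<beta>)) * S b b'" by simp
    then show ?thesis
      unfolding rec1 rT by (simp add: algebra_simps)
  qed
  have S0: "(1 - x) * S 0 0 = exp (- (?t * \<beta>)\<^sup>2 / (N + 1)) / (N + 1)"
  proof -
    have "S 0 0 = exp (- \<beta>\<^sup>2) * (exp ((1 - \<eta>) * \<beta>\<^sup>2 / (1 - x * \<eta>)) / (1 - x * \<eta>))"
      unfolding S_def using infsumI[OF out_amp_zero_square_has_sum[OF \<eta> x]]
      by (simp add: power2_eq_square mult.assoc)
    also have "\<dots> = exp (- (?t * \<beta>)\<^sup>2 / (N + 1)) / (1 - x * \<eta>)"
    proof -
      have "- \<beta>\<^sup>2 + (1 - \<eta>) * \<beta>\<^sup>2 / (1 - x * \<eta>) = - (?t * \<beta>)\<^sup>2 / (N + 1)"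
      proof -
        have "(1 - \<eta>) * \<beta>\<^sup>2 * (N_B + 1) = \<beta>\<^sup>2 * (N + 1) - \<eta> * \<beta>\<^sup>2"
          by (simp add: N_def algebra_simps)
        then have "(1 - \<eta>) * \<beta>\<^sup>2 / (1 - x * \<eta>) = (\<beta>\<^sup>2 * (N + 1) - \<eta> * \<beta>\<^sup>2) / (N + 1)"
          by (simp only: x\<eta> divide_divide_eq_right)
        also have "\<dots> = \<beta>\<^sup>2 - (?t * \<beta>)\<^sup>2 / (N + 1)"
          using N \<eta> by (simp add: diff_divide_distrib power_mult_distrib)
        finally show ?thesis by simp
      qed
      then show ?thesis by (simp add: exp_add[symmetric])
    qed
    finally show ?thesis using N NB by (simp add: x\<eta>)
  qed
  \<comment> \<open>By symmetry of \<open>S\<close>, the recursion in the first index at b' = 0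
    settles the row with first index 0.\<close>
  have closed0: "S 0 b = S 0 0 * c ^ b / sqrt (fact b)" for b
  proof (induction b)
    case (Suc b)
    have "sqrt (real (Suc b)) * S (Suc b) 0 = c * S b 0" using rec[of b 0] by simp
    then have "S 0 (Suc b) = c * S 0 b / sqrt (real (Suc b))"
      unfolding S_sym[of _ 0] by (simp add: field_simps del: of_nat_Suc)
    then show ?case using Suc.IH by (simp add: real_sqrt_mult mult_ac del: of_nat_Suc)
  qed simp
  have closed: "S b b' = S 0 0 / (sqrt (fact b) * sqrt (fact b')) * binomial_kernel q c b b'" for b b'
  proof (induction b arbitrary: b')
    case 0
    then show ?case by (simp add: closed0[of b'] binomial_kernel_0)
  next
    case (Suc b)
    have "sqrt (real (Suc b)) * S (Suc b) b' = S 0 0 / sqrt (fact b) *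
        (c * binomial_kernel q c b b' / sqrt (fact b') + q * (sqrt (real b') / sqrt (fact (b' - 1))) * binomial_kernel q c b (b' - 1))"
      unfolding rec Suc.IH by (simp add: algebra_simps)
    also have "\<dots> = S 0 0 / sqrt (fact b) / sqrt (fact b') * binomial_kernel q c (Suc b) b'"
      unfolding sqrt_div_sqrt_fact binomial_kernel_Suc by (simp add: algebra_simps)
    finally have "S (Suc b) b' = S 0 0 / sqrt (fact b) / sqrt (fact b') * binomial_kernel q c (Suc b) b' / sqrt (real (Suc b))"
      by (simp add: field_simps del: of_nat_Suc)
    then show ?case by (simp add: real_sqrt_mult mult_ac del: of_nat_Suc)
  qed
  have "(1 - x) * S b b' = displaced_thermal N (?t * \<beta>) b b'"
    unfolding closed[of b b'] displaced_thermal_def S0[symmetric] q_def c_def by simp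
  then show ?thesis
    using has_sum_cmult_right[OF S[of b b'], of "1 - x"] by (simp add: N_def case_prod_unfold)
qed

section \<open>The output of the channel\<close>

lemma coherent_coh_re: "coherent (complex_of_real \<beta> * cis \<phi>) n = cis (\<phi> * real n) * complex_of_real (coh_re \<beta> n)"
  by (simp add: coherent_def coh_re_def norm_mult power_mult_distrib Complex.DeMoivre mult_ac)

text \<open>With the total photon number fixed the matrix products are finite sums, so no
  convergence question arises inside the conjugation by the beamsplitter.\<close>

lemma infsum_number_conserving:
  fixes F :: "nat \<times> nat \<Rightarrow> complex"
  assumes "\<And>n k. F (n, k) \<noteq> 0 \<Longrightarrow> n + k = s"
  shows "infsum F UNIV = (\<Sum>k\<le>s. F (s - k, k))"
proof -
  have "infsum F UNIV = infsum F ((\<lambda>k. (s - k, k)) ` {..s})"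
  proof (rule infsum_cong_neutral)
    fix x assume x: "x \<in> UNIV - (\<lambda>k. (s - k, k)) ` {..s}"
    obtain n k where nk: "x = (n, k)" by (cases x)
    have "n + k \<noteq> s" using x unfolding nk by (auto simp: image_iff)
    then show "F x = 0" using assms nk by blast
  qed auto
  also have "\<dots> = (\<Sum>k\<le>s. F (s - k, k))"
    by (simp add: sum.reindex inj_on_def)
  finally show ?thesis .
qed

text \<open>Number conservation fixes the input photon number as b + e - k. Its phase splits into a
  part for b and a part for e - k, and the latter cancels against its conjugate because both sides
  share e and k. The factor \<gamma> carries an idler matrix entry through the channel.\<close>

lemma conj_beamsplitter_coherent:
  fixes \<phi> \<beta> N :: real and \<gamma> :: complex and b b' e :: nat
  defines "M \<equiv> \<lambda>i i'. cis (\<phi> * real i) * complex_of_real (coh_re \<beta> i) * cnj (cis (\<phi> * real i') * complex_of_real (coh_re \<beta> i')) * \<gamma>"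
  shows "conj_by (beamsplitter \<eta>) (tensor_op M (thermal N)) (b, e) (b', e) =
    cis (\<phi> * real b) * cnj (cis (\<phi> * real b')) * \<gamma> *
    complex_of_real (\<Sum>\<^sub>\<infinity>k. N ^ k / (N + 1) ^ (k + 1) * out_amp \<eta> \<beta> k b e * out_amp \<eta> \<beta> k b' e)"
proof -
  let ?U = "beamsplitter \<eta>" and ?t = "\<lambda>k. N ^ k / (N + 1) ^ (k + 1)"
  let ?c = "cis (\<phi> * real b) * cnj (cis (\<phi> * real b')) * \<gamma>"
    and ?w = "\<lambda>k. N ^ k / (N + 1) ^ (k + 1) * out_amp \<eta> \<beta> k b e * out_amp \<eta> \<beta> k b' e"
  let ?g = "\<lambda>b k. if k \<le> b + e then ?U (b, e) (b + e - k, k) * (cis (\<phi> * real (b + e - k)) * complex_of_real (coh_re \<beta> (b + e - k))) else 0"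
  have g: "?g b k = cis (\<phi> * (real b + real e - real k)) * complex_of_real (out_amp \<eta> \<beta> k b e)" for b k
    by (simp add: out_amp_def beamsplitter_real of_nat_diff)
  have inner: "op_times ?U (tensor_op M (thermal N)) (b, e) (n, k) =
      ?g b k * complex_of_real (?t k) * (cnj (cis (\<phi> * real n) * complex_of_real (coh_re \<beta> n)) * \<gamma>)" for n k
  proof -
    let ?r = "?g b k * complex_of_real (?t k) * (cnj (cis (\<phi> * real n) * complex_of_real (coh_re \<beta> n)) * \<gamma>)"
    have "op_times ?U (tensor_op M (thermal N)) (b, e) (n, k) =
        (\<Sum>l\<le>b + e. ?U (b, e) (b + e - l, l) * tensor_op M (thermal N) (b + e - l, l) (n, k))"
      unfolding op_times_def by (rule infsum_number_conserving) (use beamsplitter_number in force)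
    also have "\<dots> = (\<Sum>l\<le>b + e. if l = k then ?r else 0)"
      by (rule sum.cong) (auto simp: tensor_op_def thermal_def diag_op_def M_def)
    also have "\<dots> = ?r"
      by simp
    finally show ?thesis .
  qed
  have "conj_by ?U (tensor_op M (thermal N)) (b, e) (b', e) =
      (\<Sum>k\<le>b' + e. op_times ?U (tensor_op M (thermal N)) (b, e) (b' + e - k, k) * dagger ?U (b' + e - k, k) (b', e))"
    unfolding conj_by_def op_times_def[of "op_times _ _"]
    by (rule infsum_number_conserving) (use beamsplitter_number in \<open>force simp: dagger_def\<close>)
  also have "\<dots> = (\<Sum>k\<le>b' + e. ?g b k * complex_of_real (?t k) * \<gamma> * cnj (?g b' k))"
    by (rule sum.cong) (auto simp: inner dagger_def)
  also have "\<dots> = (\<Sum>k\<le>b' + e. ?c * complex_of_real (?w k))"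
  proof (rule sum.cong[OF refl])
    fix k
    have "cis (\<phi> * (real b + real e - real k)) * cnj (cis (\<phi> * (real b' + real e - real k))) = cis (\<phi> * real b) * cnj (cis (\<phi> * real b'))"
      by (simp add: cis_cnj cis_mult algebra_simps)
    then show "?g b k * complex_of_real (?t k) * \<gamma> * cnj (?g b' k) =
        ?c * complex_of_real (?w k)"
      unfolding g by (simp add: mult_ac)
  qed
  also have "\<dots> = ?c * complex_of_real (\<Sum>k\<le>b' + e. ?w k)"
    by (simp only: sum_distrib_left of_real_sum)
  also have "(\<Sum>k\<le>b' + e. ?w k) = (\<Sum>\<^sub>\<infinity>k. ?w k)"
    by (rule infsumI[symmetric], rule has_sum_finite_neutralI[of "{..b' + e}"]) (auto simp: out_amp_def)
  finally show ?thesis .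
qed

text \<open>The partial trace sums over e outside and k inside, the Gram identity over pairs (k, e);
  summability over the pairs reconciles the two.\<close>

lemma bosonic_channel_coherent:
  fixes \<phi> \<beta> :: real and \<gamma> :: complex
  assumes \<eta>: "0 < \<eta>" "\<eta> < 1" and NB: "0 < N_B"
  shows "bosonic_channel \<eta> N_B (\<lambda>i i'. cis (\<phi> * real i) * complex_of_real (coh_re \<beta> i) *
      cnj (cis (\<phi> * real i') * complex_of_real (coh_re \<beta> i')) * \<gamma>) b b' =
    cis (\<phi> * real b) * cnj (cis (\<phi> * real b')) * \<gamma> *
      complex_of_real (displaced_thermal ((1 - \<eta>) * N_B) (sqrt \<eta> * \<beta>) b b')"
proof -
  define x where "x = N_B / (N_B + 1)"
  let ?f = "\<lambda>k e. (1 - x) * (x ^ k * out_amp \<eta> \<beta> k b e * out_amp \<eta> \<beta> k b' e)"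
  have weight: "N_B ^ k / (N_B + 1) ^ (k + 1) = (1 - x) * x ^ k" for k
    using NB by (simp add: x_def power_divide field_simps)
  have hs: "((\<lambda>(k, e). ?f k e) has_sum displaced_thermal ((1 - \<eta>) * N_B) (sqrt \<eta> * \<beta>) b b') UNIV"
    unfolding x_def by (rule out_amp_gram[OF \<eta> NB])
  then have "((\<lambda>(k, e). ?f k e) has_sum displaced_thermal ((1 - \<eta>) * N_B) (sqrt \<eta> * \<beta>) b b') (UNIV \<times> UNIV)"
    by simp
  then have sm: "(\<lambda>(k, e). ?f k e) summable_on (UNIV \<times> UNIV)"
    by (rule has_sum_imp_summable)
  have "(\<Sum>\<^sub>\<infinity>e. \<Sum>\<^sub>\<infinity>k. ?f k e) = (\<Sum>\<^sub>\<infinity>k. \<Sum>\<^sub>\<infinity>e. ?f k e)"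
    by (rule infsum_swap_banach[OF sm, symmetric])
  also have "\<dots> = infsum (\<lambda>(k, e). ?f k e) (UNIV \<times> UNIV)"
    by (rule infsum_Sigma'_banach[OF sm])
  also have "\<dots> = displaced_thermal ((1 - \<eta>) * N_B) (sqrt \<eta> * \<beta>) b b'"
    using infsumI[OF hs] by simp
  finally have tot: "(\<Sum>\<^sub>\<infinity>e. \<Sum>\<^sub>\<infinity>k. ?f k e) = displaced_thermal ((1 - \<eta>) * N_B) (sqrt \<eta> * \<beta>) b b'" .
  show ?thesis
    unfolding bosonic_channel_def partial_trace_snd_def conj_beamsplitter_coherent weight
      infsum_cmult_right' infsum_complex_of_real tot[symmetric] by (simp only: mult.assoc infsum_cmult_right')
qed

section \<open>Phase averages and diagonalizability\<close>

lemma summable_on_mult_Times: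
  fixes f :: "'a \<Rightarrow> real" and g :: "'b \<Rightarrow> real"
  assumes f: "f summable_on UNIV" "\<And>x. 0 \<le> f x" and g: "g summable_on UNIV" "\<And>x. 0 \<le> g x"
  shows "(\<lambda>(x, y). f x * g y) summable_on UNIV"
proof -
  have "(\<lambda>p. f (fst p) * g (snd p)) summable_on (SIGMA x:UNIV. UNIV)"
    by (rule summable_on_SigmaI[where g = "\<lambda>x. f x * infsum g UNIV"])
      (use assms in \<open>auto intro!: has_sum_cmult_right summable_on_cmult_left\<close>)
  then show ?thesis by (simp add: case_prod_unfold)
qed

lemma diagonalizes_hilbert_schmidt:
  assumes "hilbert_schmidt A"
  obtains V p where "diagonalizes V p (\<lambda>i j. complex_of_real (A i j))" "\<And>k. 0 \<le> p k"
proof -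
  interpret hilbert_schmidt A by fact
  show thesis
  proof (rule spectral_decomposition)
    fix V :: "nat \<Rightarrow> nat \<Rightarrow> real" and p :: "nat \<Rightarrow> real"
    assume V: "\<And>k l. ((\<lambda>i. V i k * V i l) has_sum (if k = l then 1 else 0)) UNIV"
    "\<And>i j. ((\<lambda>k. V i k * V j k) has_sum (if i = j then 1 else 0)) UNIV"
    "\<And>i j. ((\<lambda>k. V i k * p k * V j k) has_sum A i j) UNIV"
    "\<And>k. 0 \<le> p k" "bounded (range p)"
    let ?V = "\<lambda>i k. complex_of_real (V i k)"
    have "unitary_op ?V"
    proof (rule unitary_opI)
      fix i j
      show "((\<lambda>k. ?V i k * cnj (?V j k)) has_sum (if i = j then 1 else 0)) UNIV"
        using has_sum_of_real[OF V(2)[of i j], where 'a = complex] by (cases "i = j") simp_all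
      show "((\<lambda>k. cnj (?V k i) * ?V k j) has_sum (if i = j then 1 else 0)) UNIV"
        using has_sum_of_real[OF V(1)[of i j], where 'a = complex] by (cases "i = j") simp_all
    qed
    moreover have "(\<lambda>i j. complex_of_real (A i j)) = conj_by ?V (real_diag p)"
    proof (intro ext)
      fix i j
      show "complex_of_real (A i j) = conj_by ?V (real_diag p) i j"
        using infsumI[OF has_sum_of_real[OF V(3)[of i j], where 'a = complex]] by (simp add: conj_by_diag)
    qed
    ultimately have "diagonalizes ?V p (\<lambda>i j. complex_of_real (A i j))"
      using V(5) by (simp add: diagonalizes_def)
    then show thesis using V(4) by (rule that)
  qed
qed

lemma coherent_norm: "((\<lambda>i. (cmod (coherent \<beta> i))\<^sup>2) has_sum 1) UNIV"
proof -
  have "(cmod (coherent \<beta> i))\<^sup>2 = exp (- (cmod \<beta>)\<^sup>2) * (((cmod \<beta>)\<^sup>2) ^ i / fact i)" for i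
  proof -
    have "(exp (- (cmod \<beta>)\<^sup>2 / 2))\<^sup>2 = exp (- (cmod \<beta>)\<^sup>2)" by (simp add: exp_double[symmetric])
    moreover have "(cmod \<beta> ^ i)\<^sup>2 = ((cmod \<beta>)\<^sup>2) ^ i" by (simp add: power_mult[symmetric] mult.commute)
    ultimately show ?thesis
      by (simp add: coherent_def norm_mult norm_divide norm_power power_mult_distrib power_divide)
  qed
  then show ?thesis
    using has_sum_cmult_right[OF exp_has_sum[of "(cmod \<beta>)\<^sup>2"], of "exp (- (cmod \<beta>)\<^sup>2)"]
    by (simp add: exp_add[symmetric])
qed

text \<open>Dividing out the phases of \<gamma> leaves the real rank-one matrix with entries
  |\<gamma>_i| |\<gamma>_j|, to which the real spectral theorem applies.\<close>

lemma diagonalizes_proj: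
  assumes "((\<lambda>i. (cmod (\<gamma> i))\<^sup>2) has_sum c) UNIV"
  obtains W q where "diagonalizes W q (proj (\<gamma> :: nat ket))"
proof -
  let ?A = "\<lambda>i j. cmod (\<gamma> i) * cmod (\<gamma> j)" and ?u = "\<lambda>i. cis (Arg (\<gamma> i))"
  have "hilbert_schmidt ?A"
  proof
    show "?A i j = ?A j i" for i j by simp
    show "(\<lambda>(i, j). (?A i j)\<^sup>2) summable_on UNIV"
      using summable_on_mult_Times[OF has_sum_imp_summable[OF assms] _ has_sum_imp_summable[OF assms]]
      by (simp add: power_mult_distrib)
    show "0 \<le> (\<Sum>i\<in>F. \<Sum>j\<in>F. u i * ?A i j * u j)" if "finite F" for F u
    proof -
      have "(\<Sum>i\<in>F. \<Sum>j\<in>F. u i * ?A i j * u j) = (\<Sum>i\<in>F. u i * cmod (\<gamma> i))\<^sup>2"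
        by (simp add: power2_eq_square sum_product mult_ac)
      then show ?thesis by simp
    qed
  qed
  then obtain V p where "diagonalizes V p (\<lambda>i j. complex_of_real (?A i j))"
    by (rule diagonalizes_hilbert_schmidt) (rule that)
  then have "diagonalizes (\<lambda>i k. ?u i * V i k) p (phase_conj ?u (\<lambda>i j. complex_of_real (?A i j)))"
    by (rule diagonalizes_phase_conj) simp
  moreover have "phase_conj ?u (\<lambda>i j. complex_of_real (?A i j)) = proj \<gamma>"
  proof (intro ext)
    fix i j
    have polar: "\<gamma> i = complex_of_real (cmod (\<gamma> i)) * ?u i" for i
      using rcis_cmod_Arg[of "\<gamma> i"] by (simp add: rcis_def)
    show "phase_conj ?u (\<lambda>i j. complex_of_real (?A i j)) i j = proj \<gamma> i j"
      unfolding proj_def by (subst polar[of i], subst polar[of j]) (simp add: phase_conj_def mult_ac)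
  qed
  ultimately show thesis using that by simp
qed

lemma conj_by_diag_op: "conj_by (diag_op u) A = phase_conj u A"
proof (intro ext)
  fix i j
  have "op_times (diag_op u) A i k = u i * A i k" for k
    unfolding op_times_def diag_op_def
    using infsumI[OF has_sum_single[of i "\<lambda>l. (if i = l then u i else 0) * A l k"]] by simp
  then have "conj_by (diag_op u) A i j = (\<Sum>\<^sub>\<infinity>k. u i * A i k * cnj (if j = k then u j else 0))"
    by (simp add: conj_by_def op_times_def[of "op_times _ _"] dagger_def diag_op_def)
  also have "\<dots> = u i * A i j * cnj (u j)"
    using infsumI[OF has_sum_single[of j "\<lambda>k. u i * A i k * cnj (if j = k then u j else 0)"]] by simp
  finally show "conj_by (diag_op u) A i j = phase_conj u A i j" by (simp add: phase_conj_def)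
qed

text \<open>The argument of \<alpha> acts on the signal like a further phase shift, so the amplitude
  there becomes real and nonnegative; the idler keeps its complex amplitude inside a pure
  state.\<close>

lemma rho_BI_eq:
  assumes \<eta>: "0 < \<eta>" "\<eta> < 1" and NB: "0 < N_B"
  shows "rho_BI \<eta> N_B \<tau> \<alpha> \<theta> = phase_conj (\<lambda>x. cis ((\<theta> + Arg \<alpha>) * real (fst x)))
    (tensor_op (\<lambda>b b'. complex_of_real (displaced_thermal ((1 - \<eta>) * N_B) (sqrt \<eta> * (sqrt \<tau> * cmod \<alpha>)) b b'))
       (proj (coherent (complex_of_real (sqrt (1 - \<tau>)) * \<alpha>))))"
proof (intro ext)
  fix x y :: "nat \<times> nat"
  let ?\<beta> = "sqrt \<tau> * cmod \<alpha>" and ?\<gamma> = "coherent (complex_of_real (sqrt (1 - \<tau>)) * \<alpha>)"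
  let ?\<phi> = "\<theta> + Arg \<alpha>"
  have "complex_of_real (sqrt \<tau>) * \<alpha> = complex_of_real ?\<beta> * cis (Arg \<alpha>)"
    using rcis_cmod_Arg[of \<alpha>] by (simp add: rcis_def mult.assoc)
  then have coh: "coherent (complex_of_real (sqrt \<tau>) * \<alpha>) n = cis (Arg \<alpha> * real n) * complex_of_real (coh_re ?\<beta> n)" for n
    by (simp only: coherent_coh_re)
  have pr: "proj (coherent (complex_of_real (sqrt \<tau>) * \<alpha>)) i i' = cis (Arg \<alpha> * real i) * complex_of_real (coh_re ?\<beta> i)
      * cnj (cis (Arg \<alpha> * real i') * complex_of_real (coh_re ?\<beta> i'))" for i i'
    by (simp only: proj_def coh)
  have split: "cis (?\<phi> * real i) = cis (\<theta> * real i) * cis (Arg \<alpha> * real i)" for i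
    by (simp add: distrib_right cis_mult)
  have "on_fst (conj_by (phase_unitary \<theta>)) (rho_SI \<tau> \<alpha>) (i, snd x) (i', snd y) =
      cis (?\<phi> * real i) * complex_of_real (coh_re ?\<beta> i) * cnj (cis (?\<phi> * real i') * complex_of_real (coh_re ?\<beta> i'))
        * proj ?\<gamma> (snd x) (snd y)" for i i'
    unfolding on_fst_def phase_unitary_def conj_by_diag_op
    by (simp only: phase_conj_def rho_SI_def tensor_op_def fst_conv snd_conv pr split complex_cnj_mult)
      (simp only: mult_ac)
  then show "rho_BI \<eta> N_B \<tau> \<alpha> \<theta> x y = phase_conj (\<lambda>x. cis (?\<phi> * real (fst x)))
      (tensor_op (\<lambda>b b'. complex_of_real (displaced_thermal ((1 - \<eta>) * N_B) (sqrt \<eta> * ?\<beta>) b b')) (proj ?\<gamma>)) x y"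
    unfolding rho_BI_def on_fst_def[of "bosonic_channel _ _"]
    by (simp only: bosonic_channel_coherent[OF \<eta> NB])
      (simp add: phase_conj_def tensor_op_def mult_ac)
qed

section \<open>Averages of number phases\<close>

lemma sum_phases:
  assumes "0 < m"
  shows "(\<Sum>k<m. cis (2 * pi * real k / real m * real b) * cnj (cis (2 * pi * real k / real m * real b'))) / of_nat m
    = (if b mod m = b' mod m then 1 else 0)"
proof -
  let ?z = "\<lambda>b. cis (2 * pi * real b / real m)"
  have mod: "?z b = ?z (b mod m)" for b
  proof -
    have "real b = real m * real (b div m) + real (b mod m)"
      by (metis div_mult_mod_eq mult.commute of_nat_add of_nat_mult)
    then have "2 * pi * real b / real m = 2 * pi * real (b mod m) / real m + 2 * pi * real_of_int (int (b div m))"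
      using assms by (simp add: field_simps)
    then show ?thesis by (simp only: cis_mult[symmetric] cis_multiple_2pi[OF Ints_of_int] mult_1_right)
  qed
  define w where "w = ?z b * cnj (?z b')"
  have pw: "cis (2 * pi * real k / real m * real b) * cnj (cis (2 * pi * real k / real m * real b')) = w ^ k" for k
    unfolding w_def by (simp add: cis_cnj cis_mult Complex.DeMoivre algebra_simps diff_divide_distrib)
  \<comment> \<open>The m-th roots of unity with exponents below m are distinct, which turns w = 1
    into a congruence modulo m. For the other roots the geometric sum vanishes by w^m = 1.\<close>
  have w1: "w = 1 \<longleftrightarrow> b mod m = b' mod m"
  proof -
    have inj: "inj_on (\<lambda>k. ?z k) {..<m}"
      using Complex.bij_betw_roots_unity[OF assms] by (simp add: bij_betw_def)
    have "w = 1 \<longleftrightarrow> ?z b = ?z b'"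
    proof
      assume "w = 1"
      then have "w * ?z b' = ?z b'" by simp
      then show "?z b = ?z b'" by (simp add: w_def cis_cnj cis_mult)
    qed (simp add: w_def cis_cnj cis_mult)
    also have "\<dots> \<longleftrightarrow> ?z (b mod m) = ?z (b' mod m)" unfolding mod[of b] mod[of b'] by simp
    also have "\<dots> \<longleftrightarrow> b mod m = b' mod m"
      using inj_on_eq_iff[OF inj, of "b mod m" "b' mod m"] assms by simp
    finally show ?thesis .
  qed
  have root: "?z b ^ m = 1" for b
  proof -
    have "?z b ^ m = cis (2 * pi * real b)" using assms by (simp add: Complex.DeMoivre)
    then show ?thesis using cis_multiple_2pi[of "real b"] by simp
  qed
  have "w ^ m = ?z b ^ m * cnj (?z b' ^ m)" by (simp add: w_def power_mult_distrib)
  then have "w ^ m = 1" unfolding root by simp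
  show ?thesis
  proof (cases "w = 1")
    case True
    then show ?thesis unfolding pw using w1 assms by simp
  next
    case False
    then show ?thesis unfolding pw using w1 \<open>w ^ m = 1\<close> by (simp add: geometric_sum)
  qed
qed

lemma integral_phases:
  "integral {0..2 * pi} (\<lambda>\<theta>. cis (\<theta> * real b) * cnj (cis (\<theta> * real b'))) / complex_of_real (2 * pi)
    = (if b = b' then 1 else 0)"
proof (cases "b = b'")
  case True
  then show ?thesis by (simp add: cis_cnj cis_mult scaleR_conv_of_real)
next
  case False
  define d where "d = real b - real b'"
  have d: "d \<noteq> 0" using False by (simp add: d_def)
  have cis_eq: "cis (\<theta> * real b) * cnj (cis (\<theta> * real b')) = cis (d * \<theta>)" for \<theta>
    by (simp add: cis_cnj cis_mult d_def algebra_simps)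
  have "((\<lambda>\<theta>. cis (d * \<theta>)) has_integral (cis (d * (2 * pi)) / (\<i> * complex_of_real d) - cis (d * 0) / (\<i> * complex_of_real d))) {0..2 * pi}"
  proof (rule fundamental_theorem_of_calculus)
    fix \<theta> :: real
    have "((\<lambda>z. exp (\<i> * complex_of_real d * z) / (\<i> * complex_of_real d)) has_field_derivative exp (\<i> * complex_of_real d * complex_of_real \<theta>)) (at (complex_of_real \<theta>))"
      using d by (auto intro!: derivative_eq_intros)
    from has_vector_derivative_real_field[OF this, of "{0..2 * pi}"]
    show "((\<lambda>\<theta>. cis (d * \<theta>) / (\<i> * complex_of_real d)) has_vector_derivative cis (d * \<theta>)) (at \<theta> within {0..2 * pi})"
      by (simp add: cis_conv_exp mult.assoc)
  qed simp
  moreover have "cis (d * (2 * pi)) = 1"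
  proof -
    have "d = real_of_int (int b - int b')" by (simp add: d_def)
    then show ?thesis using cis_multiple_2pi[of d] by (simp add: mult_ac)
  qed
  ultimately have "((\<lambda>\<theta>. cis (d * \<theta>)) has_integral 0) {0..2 * pi}" by simp
  then show ?thesis using False by (simp add: cis_eq integral_unique)
qed

section \<open>Entropy of the pinched displaced thermal state\<close>

definition pinch :: "nat \<Rightarrow> (nat \<Rightarrow> nat \<Rightarrow> 'a::zero) \<Rightarrow> nat \<Rightarrow> nat \<Rightarrow> 'a" where
  "pinch m A i j = (if i mod m = j mod m then A i j else 0)"

text \<open>For y = s / (N (N + 1)) this is n!/(n+d)! times the Laguerre polynomial L_n^(d) at -y.\<close>
definition laguerre_sum :: "real \<Rightarrow> nat \<Rightarrow> nat \<Rightarrow> real" where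
  "laguerre_sum y n d = (\<Sum>k\<le>n. real (n choose k) * y ^ k / fact (d + k))"

lemma laguerre_sum_ge_1: "0 \<le> y \<Longrightarrow> 1 \<le> laguerre_sum y n 0"
  unfolding laguerre_sum_def
  using member_le_sum[of 0 "{..n}" "\<lambda>k. real (n choose k) * y ^ k / fact (0 + k)"] by simp

lemma laguerre_sum_nonneg: "0 \<le> y \<Longrightarrow> 0 \<le> laguerre_sum y n d"
  unfolding laguerre_sum_def by (intro sum_nonneg) simp

lemma laguerre_sum_mono:
  assumes "0 \<le> y"
  shows "laguerre_sum y n 0 \<le> laguerre_sum y (n + d) 0"
proof -
  have "laguerre_sum y n 0 \<le> (\<Sum>k\<le>n. real ((n + d) choose k) * y ^ k / fact (0 + k))"
    unfolding laguerre_sum_def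
    by (intro sum_mono divide_right_mono mult_right_mono of_nat_mono binomial_right_mono) (use assms in auto)
  also have "\<dots> \<le> laguerre_sum y (n + d) 0"
    unfolding laguerre_sum_def by (rule sum_mono2) (use assms in auto)
  finally show ?thesis .
qed

text \<open>Termwise, from d! k! <= (d + k)!.\<close>

lemma laguerre_sum_le:
  assumes "0 \<le> y"
  shows "laguerre_sum y n d \<le> laguerre_sum y n 0 / fact d"
  unfolding laguerre_sum_def sum_divide_distrib
proof (rule sum_mono)
  fix k
  have "fact d * fact k \<le> (fact (d + k) :: nat)"
    by (rule dvd_imp_le[OF fact_fact_dvd_fact]) simp
  then have "fact d * fact k \<le> (fact (d + k) :: real)"
    by (simp only: of_nat_le_iff[where 'a = real, symmetric] of_nat_mult of_nat_fact)
  then have "real (n choose k) * y ^ k / fact (d + k) \<le> real (n choose k) * y ^ k / (fact d * fact k)"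
    using assms by (intro divide_left_mono) auto
  then show "real (n choose k) * y ^ k / fact (d + k) \<le> real (n choose k) * y ^ k / fact (0 + k) / fact d"
    by (simp add: mult.commute)
qed

text \<open>Termwise (d + k)! >= d! (d + 1)^k, after which the binomial theorem sums the powers.
  This is the origin of m\<Delta> + 1 in q_\<Delta>.\<close>

lemma laguerre_sum_le_power:
  assumes "0 \<le> y"
  shows "laguerre_sum y n d \<le> (1 + y / (real d + 1)) ^ n / fact d"
proof -
  have f: "fact d * (real d + 1) ^ k \<le> fact (d + k)" for k
  proof (induction k)
    case (Suc k)
    have "fact d * (real d + 1) ^ Suc k = (real d + 1) * (fact d * (real d + 1) ^ k)" by simp
    also have "\<dots> \<le> (real d + 1 + real k) * fact (d + k)"
      using Suc by (intro mult_mono) auto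
    finally show ?case by (simp add: algebra_simps)
  qed simp
  have "laguerre_sum y n d \<le> (\<Sum>k\<le>n. real (n choose k) * (y / (real d + 1)) ^ k / fact d)"
    unfolding laguerre_sum_def
  proof (rule sum_mono)
    fix k
    have "real (n choose k) * y ^ k / fact (d + k) \<le> real (n choose k) * y ^ k / (fact d * (real d + 1) ^ k)"
      using assms f[of k] by (intro divide_left_mono) auto
    then show "real (n choose k) * y ^ k / fact (d + k) \<le> real (n choose k) * (y / (real d + 1)) ^ k / fact d"
      by (simp add: power_divide mult.commute)
  qed
  also have "\<dots> = (y / (real d + 1) + 1) ^ n / fact d"
    unfolding binomial_ring by (simp add: sum_divide_distrib)
  finally show ?thesis by (simp add: add.commute)
qed

locale displaced_thermal_state =
  fixes N g :: real
  assumes N: "0 < N" and g: "0 \<le> g"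
begin

text \<open>The vacuum entry of the matrix, to be distinguished from the constant K of the theorem,
  which appears below as the parameter \<open>\<kappa>\<close>.\<close>

definition K where "K = exp (- g\<^sup>2 / (N + 1)) / (N + 1)"
definition q where "q = N / (N + 1)"
definition c where "c = g / (N + 1)"
definition y where "y = g\<^sup>2 / (N * (N + 1))"
text \<open>At d = m\<Delta> this is q_\<Delta>.\<close>

definition Q where "Q d = q * (1 + y / (real d + 1))" for d :: nat

abbreviation D where "D \<equiv> displaced_thermal N g"

lemma param_facts: "0 < K" "0 < q" "q < 1" "0 \<le> c" "0 \<le> y" "y * q = c\<^sup>2"
  using N g by (auto simp: K_def q_def c_def y_def power_divide power2_eq_square)

lemma Q_pos: "0 < Q d"
  unfolding Q_def using param_facts by (intro mult_pos_pos add_pos_nonneg) auto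

lemma D_binomial_kernel: "D b b' = K / (sqrt (fact b) * sqrt (fact b')) * binomial_kernel q c b b'"
  by (simp add: displaced_thermal_def K_def q_def c_def)

definition L where "L b j = sqrt K / sqrt (fact b) * (real (b choose j) * sqrt (fact j * q ^ j) * c ^ (b - j))" for b j :: nat

lemma D_gram:
  assumes "b' \<le> J"
  shows "D b b' = (\<Sum>j\<le>J. L b j * L b' j)"
proof -
  have sq: "sqrt (fact j * q ^ j) * sqrt (fact j * q ^ j) = fact j * q ^ j" for j
    using param_facts by simp
  have K2: "sqrt K * sqrt K = K" using param_facts by simp
  have "binomial_kernel q c b b' = (\<Sum>j\<le>J. real (b choose j) * real (b' choose j) * fact j * q ^ j * c ^ (b - j) * c ^ (b' - j))"
    unfolding binomial_kernel_def by (rule sum.mono_neutral_left) (use assms in auto)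
  moreover have "L b j * L b' j = K / (sqrt (fact b) * sqrt (fact b'))
      * (real (b choose j) * real (b' choose j) * fact j * q ^ j * c ^ (b - j) * c ^ (b' - j))" for j
  proof -
    have "L b j * L b' j = (sqrt K * sqrt K) / (sqrt (fact b) * sqrt (fact b'))
      * (real (b choose j) * real (b' choose j) * (sqrt (fact j * q ^ j) * sqrt (fact j * q ^ j)) * c ^ (b - j) * c ^ (b' - j))"
      by (simp add: L_def mult_ac)
    then show ?thesis unfolding sq K2 by (simp only: mult.assoc)
  qed
  ultimately show ?thesis by (simp add: D_binomial_kernel sum_distrib_left)
qed

lemma D_sym: "D b b' = D b' b"
  using D_gram[of b' "max b b'" b] D_gram[of b "max b b'" b'] by (simp add: mult.commute)

text \<open>Reversing the kernel sum by j = n - k turns the powers of c into c^(d + 2k) = c^d (y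
  q)^k, and q^n factors out.\<close>

lemma D_lower: "D (n + d) n = K * (sqrt (fact (n + d)) / sqrt (fact n)) * q ^ n * c ^ d * laguerre_sum y n d"
proof -
  let ?t = "\<lambda>k. real ((n + d) choose (n - k)) * real (n choose (n - k)) * fact (n - k) * q ^ (n - k) * c ^ (n + d - (n - k)) * c ^ (n - (n - k))"
  let ?s = "\<lambda>k. fact (n + d) * q ^ n * c ^ d * (real (n choose k) * y ^ k / fact (d + k))"
  have "binomial_kernel q c (n + d) n = (\<Sum>k\<le>n. ?t k)"
    unfolding binomial_kernel_def by (rule sum.reindex_bij_witness[of _ "\<lambda>k. n - k" "\<lambda>k. n - k"]) auto
  also have "\<dots> = (\<Sum>k\<le>n. ?s k)"
  proof (rule sum.cong[OF refl])
    fix k assume "k \<in> {..n}"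
    then obtain l where n: "n = k + l" by (auto simp: le_iff_add)
    have b1: "real ((n + d) choose (n - k)) * fact (n - k) = fact (n + d) / fact (d + k)"
      using binomial_fact[of l "n + d", where 'a = real] by (simp add: n add_ac)
    have b2: "n choose (n - k) = n choose k"
      using binomial_symmetric[of k n] by (simp add: n)
    have cy: "c ^ (n + d - (n - k)) * c ^ (n - (n - k)) = c ^ d * (y ^ k * q ^ k)"
      by (simp add: n power_add power_mult_distrib[symmetric] param_facts power2_eq_square)
    have "?t k
      = (real ((n + d) choose (n - k)) * fact (n - k)) * real (n choose (n - k)) * q ^ (n - k) * (c ^ (n + d - (n - k)) * c ^ (n - (n - k)))"
      by (simp only: mult_ac)
    also have "\<dots> = ?s k"
      unfolding b1 b2 cy by (simp add: n power_add mult_ac)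
    finally show "?t k
      = ?s k" .
  qed
  also have "\<dots> = fact (n + d) * q ^ n * c ^ d * laguerre_sum y n d"
    by (simp add: laguerre_sum_def sum_distrib_left)
  finally have h: "binomial_kernel q c (n + d) n = fact (n + d) * q ^ n * c ^ d * laguerre_sum y n d" .
  have "fact (n + d) = sqrt (fact (n + d)) * sqrt (fact (n + d) :: real)" by simp
  then have "fact (n + d) / (sqrt (fact (n + d)) * sqrt (fact n)) = sqrt (fact (n + d)) / sqrt (fact n :: real)"
    by (metis (no_types, lifting) fact_nonzero mult_divide_mult_cancel_left real_sqrt_eq_zero_cancel_iff)
  then show ?thesis unfolding D_binomial_kernel h by (simp add: field_simps)
qed

lemma D_diag: "D n n = K * q ^ n * laguerre_sum y n 0"
  using D_lower[of n 0] by simp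

lemma D_diag_pos: "0 < D n n"
  unfolding D_diag using param_facts laguerre_sum_ge_1[of y n] by (intro mult_pos_pos) auto

lemma D_square_le: "(D i j)\<^sup>2 \<le> D i i * D j j"
proof -
  let ?J = "max i j"
  have "(\<Sum>l\<le>?J. L i l * L j l)\<^sup>2 \<le> (\<Sum>l\<le>?J. (L i l)\<^sup>2) * (\<Sum>l\<le>?J. (L j l)\<^sup>2)"
    by (rule Cauchy_Schwarz_ineq_sum)
  then show ?thesis
    using D_gram[of j ?J i] D_gram[of i ?J i] D_gram[of j ?J j] by (simp add: power2_eq_square)
qed

lemma D_diag_summable: "(\<lambda>n. D n n) summable_on UNIV"
proof -
  let ?t = "\<lambda>n j. K * (q ^ n * (real (n choose j) * y ^ j / fact j))"
  let ?F = "\<lambda>(n, j). ?t n j" and ?h = "\<lambda>(j, k). (k + j, j) :: nat \<times> nat"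
  have "?F x = 0" if "x \<notin> range ?h" for x
  proof -
    obtain n j where x: "x = (n, j)" by (cases x)
    have "n < j"
    proof (rule ccontr)
      assume "\<not> n < j"
      then have "x = ?h (j, n - j)" by (simp add: x)
      then have "x \<in> range ?h" by (rule range_eqI)
      with that show False by contradiction
    qed
    then show ?thesis by (simp add: x)
  qed
  then have *: "(?F has_sum S) UNIV \<longleftrightarrow> ((\<lambda>x. ?F (?h x)) has_sum S) UNIV" for S
    by (intro has_sum_inj_reindex) (auto simp: inj_def)
  have "((\<lambda>x. K * (case x of (j, k) \<Rightarrow> real ((k + j) choose j) * q ^ k * ((q * y) ^ j / fact j)))
      has_sum K * (exp (q * y / (1 - q)) / (1 - q))) UNIV"
    by (intro has_sum_cmult_right exp_negative_binomial_series) (use param_facts in auto)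
  moreover have "?F (?h x) = K * (case x of (j, k) \<Rightarrow> real ((k + j) choose j) * q ^ k * ((q * y) ^ j / fact j))" for x
    by (cases x) (simp add: power_add power_mult_distrib mult_ac)
  ultimately have "?F summable_on UNIV"
    using * by (simp add: summable_on_def) blast
  then have "(\<lambda>n. \<Sum>\<^sub>\<infinity>j. ?t n j) summable_on UNIV"
    using summable_on_Sigma_banach[of "\<lambda>n j. ?t n j" UNIV "\<lambda>_. UNIV"] by simp
  moreover have "(\<Sum>\<^sub>\<infinity>j. ?t n j) = D n n" for n
    by (rule infsumI, rule has_sum_finite_neutralI[of "{..n}"])
      (auto simp: D_diag laguerre_sum_def sum_distrib_left mult_ac)
  ultimately show ?thesis by simp
qed

lemma hilbert_schmidt_pinch:
  assumes m: "0 < m"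
  shows "hilbert_schmidt (pinch m D)"
proof
  show "pinch m D i j = pinch m D j i" for i j
    using D_sym by (simp add: pinch_def)
  have "(\<lambda>(i, j). D i i * D j j) summable_on UNIV"
    by (intro summable_on_mult_Times D_diag_summable less_imp_le D_diag_pos)
  then show "(\<lambda>(i, j). (pinch m D i j)\<^sup>2) summable_on UNIV"
    by (rule summable_on_comparison_test)
      (auto simp: pinch_def D_square_le less_imp_le D_diag_pos)
  show "0 \<le> (\<Sum>i\<in>F. \<Sum>j\<in>F. u i * pinch m D i j * u j)" if "finite F" for F u
  proof -
    obtain J where J: "\<And>i. i \<in> F \<Longrightarrow> i \<le> J"
      using \<open>finite F\<close> by (meson finite_nat_set_iff_bounded_le)
    \<comment> \<open>Pinching splits each Gram vector into its residue classes modulo m; indexed by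
      pairs of a residue and l, the pinched form is again a sum of squares.\<close>
    let ?I = "{..<m} \<times> {..J}" and ?v = "\<lambda>a i. if i mod m = fst a then u i * L i (snd a) else 0"
    have "u i * pinch m D i j * u j = (\<Sum>a\<in>?I. ?v a i * ?v a j)" if "j \<in> F" for i j
    proof -
      have "(\<Sum>a\<in>?I. ?v a i * ?v a j) = (\<Sum>r<m. \<Sum>l\<le>J. ?v (r, l) i * ?v (r, l) j)"
        by (simp add: sum.cartesian_product case_prod_unfold cong: if_cong)
      also have "\<dots> = (\<Sum>r<m. if r = i mod m then
          (if i mod m = j mod m then \<Sum>l\<le>J. u i * L i l * (u j * L j l) else 0) else 0)"
        by (rule sum.cong) auto
      also have "\<dots> = (if i mod m = j mod m then \<Sum>l\<le>J. u i * L i l * (u j * L j l) else 0)"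
        using m by simp
      also have "\<dots> = u i * pinch m D i j * u j"
        unfolding pinch_def D_gram[OF J[OF that]] by (simp add: sum_distrib_left sum_distrib_right mult_ac)
      finally show ?thesis ..
    qed
    then have "(\<Sum>i\<in>F. \<Sum>j\<in>F. u i * pinch m D i j * u j) = (\<Sum>i\<in>F. \<Sum>j\<in>F. \<Sum>a\<in>?I. ?v a i * ?v a j)"
      by (intro sum.cong) auto
    also have "\<dots> = (\<Sum>i\<in>F. \<Sum>a\<in>?I. \<Sum>j\<in>F. ?v a i * ?v a j)"
      by (rule sum.cong[OF refl], rule sum.swap)
    also have "\<dots> = (\<Sum>a\<in>?I. \<Sum>i\<in>F. \<Sum>j\<in>F. ?v a i * ?v a j)"
      by (rule sum.swap)
    also have "\<dots> = (\<Sum>a\<in>?I. (\<Sum>i\<in>F. ?v a i)\<^sup>2)"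
      by (simp only: power2_eq_square sum_product)
    also have "0 \<le> \<dots>" by (intro sum_nonneg) simp
    finally show ?thesis .
  qed
qed

text \<open>Of the two factors T in T^2 one is bounded by A / d!, which cancels the A of the
  diagonal entry, the other by the power that turns q^n into (Q d)^n. The term over D_nn has a spare
  factor q^d <= 1, and the term over the larger diagonal index uses A <= A'.\<close>

lemma offdiagonal_bound:
  "(D (n + d) n)\<^sup>2 / D n n + (D (n + d) n)\<^sup>2 / D (n + d) (n + d)
    \<le> 2 * K * (y ^ d / fact d) * (real ((n + d) choose d) * Q d ^ n)"
proof -
  let ?T = "laguerre_sum y n d" and ?A = "laguerre_sum y n 0" and ?A' = "laguerre_sum y (n + d) 0"
  let ?R = "fact (n + d) / fact n :: real" and ?E = "(1 + y / (real d + 1)) ^ n"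
  have A: "0 < ?A" "0 < ?A'" "?A \<le> ?A'"
    using laguerre_sum_ge_1[of y n] laguerre_sum_ge_1[of y "n + d"] laguerre_sum_mono[of y n d] param_facts by auto
  have T: "0 \<le> ?T" "?T \<le> ?A / fact d" "?T \<le> ?E / fact d"
    using laguerre_sum_nonneg laguerre_sum_le laguerre_sum_le_power param_facts by auto
  have "?T\<^sup>2 \<le> (?A / fact d) * (?E / fact d)"
    unfolding power2_eq_square using T A by (intro mult_mono) auto
  then have TA: "?T\<^sup>2 / ?A \<le> ?E / (fact d * fact d)"
    using A by (simp add: field_simps)
  let ?B = "K * ?R * q ^ n * y ^ d * (?T\<^sup>2 / ?A)"
  have sq: "(D (n + d) n)\<^sup>2 = K * K * ?R * (q ^ n * q ^ n) * (y * q) ^ d * ?T\<^sup>2"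
    unfolding D_lower param_facts(6)
    by (simp add: power_mult_distrib power_divide power2_eq_square[of K] power_mult[symmetric]
        power_add[symmetric] mult_2 mult_2_right)
  have "(D (n + d) n)\<^sup>2 / D n n = ?B * q ^ d"
    unfolding sq D_diag[of n] using param_facts(1,2) A by (simp add: power_mult_distrib field_simps)
  also have "\<dots> \<le> ?B * 1"
    using param_facts A by (intro mult_left_mono power_le_one mult_nonneg_nonneg divide_nonneg_nonneg) auto
  finally have b1: "(D (n + d) n)\<^sup>2 / D n n \<le> ?B" by simp
  have "(D (n + d) n)\<^sup>2 / D (n + d) (n + d) = K * ?R * q ^ n * y ^ d * (?T\<^sup>2 / ?A')"
    unfolding sq D_diag[of "n + d"] using param_facts(1,2) A by (simp add: power_mult_distrib power_add field_simps)
  also have "\<dots> \<le> ?B"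
    using param_facts A by (intro mult_left_mono divide_left_mono mult_nonneg_nonneg mult_pos_pos) auto
  finally have b2: "(D (n + d) n)\<^sup>2 / D (n + d) (n + d) \<le> ?B" .
  have "?B \<le> K * ?R * q ^ n * y ^ d * (?E / (fact d * fact d))"
    using param_facts TA by (intro mult_left_mono mult_nonneg_nonneg) auto
  also have "\<dots> = K * (y ^ d / fact d) * ((?R / fact d) * (q ^ n * ?E))"
    by (simp add: mult_ac)
  also have "?R / fact d = real ((n + d) choose d)"
    using binomial_fact[of d "n + d", where 'a = real] by (simp add: mult.commute)
  also have "q ^ n * ?E = Q d ^ n" by (simp add: Q_def power_mult_distrib)
  finally have b3: "?B \<le> K * (y ^ d / fact d) * (real ((n + d) choose d) * Q d ^ n)" .
  have two: "2 * K * x * z = 2 * (K * x * z)" for x z :: real by simp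
  show ?thesis unfolding two using b1 b2 b3 by linarith
qed

text \<open>The share of column j in the term b / a - a of \<open>entropy_entry_bound\<close> for
  row i.\<close>

definition excess where
  "excess m i j = (if i \<noteq> j \<and> i mod m = j mod m then (D i j)\<^sup>2 / D i i else 0)" for m i j :: nat

text \<open>The bound for both diagonals at distance m (k + 1), already summed over n; k stands for
  \<Delta> - 1.\<close>

definition class_bound where
  "class_bound m k = 2 * K * (y ^ (m * Suc k) / fact (m * Suc k)) / (1 - Q (m * Suc k)) ^ (m * Suc k + 1)" for m k :: nat

lemma excess_nonneg: "0 \<le> excess m i j"
  by (simp add: excess_def less_imp_le[OF D_diag_pos])

text \<open>Pairs of distinct congruent indices are parametrized as (n + d, n) and (n, n + d) with d
  = m (k + 1). The two families share one majorant, since \<open>offdiagonal_bound\<close> controls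
  them together.\<close>

lemma infsum_excess_le:
  assumes m: "0 < m" and Q1: "\<And>k. Q (m * Suc k) < 1" and S: "(class_bound m has_sum S) UNIV"
  obtains E where "((\<lambda>(i, j). excess m i j) has_sum E) UNIV" "E \<le> S"
proof -
  let ?d = "\<lambda>k. m * Suc k"
  let ?h1 = "\<lambda>(k, n). (n + ?d k, n)" and ?h2 = "\<lambda>(k, n). (n, n + ?d k)"
  let ?w = "\<lambda>(i, j). excess m i j"
  let ?B = "\<lambda>p. 2 * K * (y ^ ?d (fst p) / fact (?d (fst p))) * (real ((snd p + ?d (fst p)) choose ?d (fst p)) * Q (?d (fst p)) ^ snd p)"
  have inner: "((\<lambda>n. ?B (k, n)) has_sum class_bound m k) UNIV" for k
    using has_sum_cmult_right[OF negative_binomial_series[OF less_imp_le[OF Q_pos] Q1[of k], of "?d k"],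
        of "2 * K * (y ^ ?d k / fact (?d k))"] by (simp add: class_bound_def)
  have Bnn: "0 \<le> ?B p" for p
    using param_facts less_imp_le[OF Q_pos[of "?d (fst p)"]] by simp
  have Bsm: "?B summable_on (SIGMA k:UNIV. UNIV)"
    by (rule summable_on_SigmaI[OF inner has_sum_imp_summable[OF S]]) (rule Bnn)
  have B: "(?B has_sum S) UNIV"
    using has_sum_SigmaI[OF inner S Bsm] by simp
  have le: "?w (?h1 p) + ?w (?h2 p) \<le> ?B p" for p
  proof -
    obtain k n where p: "p = (k, n)" by (cases p)
    have "?w (?h1 p) + ?w (?h2 p) = (D (n + ?d k) n)\<^sup>2 / D n n + (D (n + ?d k) n)\<^sup>2 / D (n + ?d k) (n + ?d k)"
    proof -
      have "(n + ?d k) mod m = n mod m" "?d k \<noteq> 0" using m by (simp_all del: mult_Suc_right)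
      then show ?thesis using D_sym[of n "n + ?d k"] by (simp add: p excess_def del: mult_Suc_right)
    qed
    then show ?thesis using offdiagonal_bound[of n "?d k"] by (simp add: p)
  qed
  have sm: "(\<lambda>p. ?w (h p)) summable_on UNIV" if "\<And>p. ?w (h p) \<le> ?B p" for h
    by (rule summable_on_comparison_test[OF has_sum_imp_summable[OF B] that])
      (simp add: excess_nonneg case_prod_unfold)
  have nn: "0 \<le> ?w x" for x by (cases x) (simp add: excess_nonneg)
  have sm1: "(\<lambda>p. ?w (?h1 p)) summable_on UNIV"
  proof (rule sm)
    show "?w (?h1 p) \<le> ?B p" for p using le[of p] nn[of "?h2 p"] by linarith
  qed
  have sm2: "(\<lambda>p. ?w (?h2 p)) summable_on UNIV"
  proof (rule sm)
    show "?w (?h2 p) \<le> ?B p" for p using le[of p] nn[of "?h1 p"] by linarith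
  qed
  let ?E1 = "\<Sum>\<^sub>\<infinity>p. ?w (?h1 p)" and ?E2 = "\<Sum>\<^sub>\<infinity>p. ?w (?h2 p)"
  have inj: "inj ?h1" "inj ?h2" using m by (auto simp: inj_def)
  have "(?w has_sum ?E1) (range ?h1)"
    using has_sum_reindex[OF inj(1), of ?w ?E1] has_sum_infsum[OF sm1] by (simp add: o_def)
  moreover have "(?w has_sum ?E2) (range ?h2)"
    using has_sum_reindex[OF inj(2), of ?w ?E2] has_sum_infsum[OF sm2] by (simp add: o_def)
  moreover have "range ?h1 \<inter> range ?h2 = {}" using m by auto
  ultimately have "(?w has_sum (?E1 + ?E2)) (range ?h1 \<union> range ?h2)"
    by (rule has_sum_Un_disjoint)
  moreover have "?w x = 0" if "x \<notin> range ?h1 \<union> range ?h2" for x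
  proof -
    obtain i j where x: "x = (i, j)" by (cases x)
    have "\<not> (i \<noteq> j \<and> i mod m = j mod m)"
    proof
      assume ij: "i \<noteq> j \<and> i mod m = j mod m"
      have diff: "\<exists>k. b = a + ?d k" if ab: "a < b" "a mod m = b mod m" for a b
      proof -
        have "m dvd b - a" using mod_eq_dvd_iff_nat[of a b m] ab by simp
        then obtain l where l: "b - a = m * l" by (auto simp: dvd_def)
        then obtain k where "l = Suc k" using ab by (cases l) auto
        then show ?thesis using l ab by (intro exI[of _ k]) simp
      qed
      show False
      proof (cases "i < j")
        case True
        then obtain k where "j = i + ?d k" using diff ij by blast
        then have "x = ?h2 (k, i)" by (simp add: x)
        then have "x \<in> range ?h2" by (rule range_eqI)
        then show False using that by blast
      next
        case False
        then have "j < i" "j mod m = i mod m" using ij by auto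
        then obtain k where "i = j + ?d k" using diff by blast
        then have "x = ?h1 (k, j)" by (simp add: x)
        then have "x \<in> range ?h1" by (rule range_eqI)
        then show False using that by blast
      qed
    qed
    then show ?thesis by (auto simp: x excess_def)
  qed
  ultimately have W: "(?w has_sum (?E1 + ?E2)) UNIV"
    using has_sum_cong_neutral[of UNIV "range ?h1 \<union> range ?h2" ?w ?w "?E1 + ?E2"] by auto
  have "((\<lambda>p. ?w (?h1 p) + ?w (?h2 p)) has_sum (?E1 + ?E2)) UNIV"
    by (intro has_sum_add has_sum_infsum sm1 sm2)
  then have "?E1 + ?E2 \<le> S" by (rule has_sum_mono[OF _ B]) (rule le)
  with W show thesis by (rule that)
qed

lemma pinched_entropy_bound:
  assumes m: "0 < m" and Q1: "\<And>k. Q (m * Suc k) < 1" and S: "(class_bound m has_sum S) UNIV"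
    and V: "diagonalizes V p (\<lambda>i j. complex_of_real (pinch m D i j))" and p: "\<And>k. 0 \<le> p k"
  shows "(\<integral>\<^sup>+ i. ennreal (- (D i i * ln (D i i))) \<partial>count_space UNIV)
    \<le> von_neumann_entropy (\<lambda>i j. complex_of_real (pinch m D i j)) + ennreal S"
proof (rule infsum_excess_le[OF m Q1 S])
  fix E assume E: "((\<lambda>(i, j). excess m i j) has_sum E) UNIV" and ES: "E \<le> S"
  let ?e = "\<lambda>i. \<Sum>\<^sub>\<infinity>j. excess m i j" and ?v = "\<lambda>i. \<Sum>\<^sub>\<infinity>k. (cmod (V i k))\<^sup>2 * (p k * ln (p k))"
  have E': "((\<lambda>(i, j). excess m i j) has_sum E) (SIGMA i:UNIV. UNIV)" using E by simp
  have row: "((\<lambda>j. excess m i j) has_sum ?e i) UNIV" for i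
    using summable_on_SigmaD1[of "excess m" UNIV "\<lambda>_. UNIV" i] has_sum_imp_summable[OF E'] by (intro has_sum_infsum) simp
  have tot: "(?e has_sum E) UNIV"
    by (rule has_sum_SigmaD[OF E']) (use row in simp)
  have e_nn: "0 \<le> ?e i" for i by (rule infsum_nonneg) (rule excess_nonneg)
  have entry: "- (D i i * ln (D i i)) \<le> - ?v i + ?e i" for i
  proof -
    have "((\<lambda>j. D i i * excess m i j + (if j = i then (D i i)\<^sup>2 else 0)) has_sum D i i * ?e i + (if i = i then (D i i)\<^sup>2 else 0)) UNIV"
      by (intro has_sum_add has_sum_cmult_right row has_sum_single) simp
    moreover have "D i i * excess m i j + (if j = i then (D i i)\<^sup>2 else 0) = (cmod (complex_of_real (pinch m D i j)))\<^sup>2" for j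
      using D_diag_pos[of i] by (auto simp: excess_def pinch_def)
    ultimately have b: "((\<lambda>j. (cmod (complex_of_real (pinch m D i j)))\<^sup>2) has_sum D i i * ?e i + (D i i)\<^sup>2) UNIV"
      by simp
    have "- (D i i * ln (D i i)) \<le> - ?v i + ((D i i * ?e i + (D i i)\<^sup>2) / D i i - D i i)"
      by (rule entropy_entry_bound[OF V p _ D_diag_pos b]) (simp add: pinch_def)
    also have "(D i i * ?e i + (D i i)\<^sup>2) / D i i - D i i = ?e i"
      using D_diag_pos[of i] by (simp add: add_divide_distrib power2_eq_square)
    finally show ?thesis .
  qed
  have "(\<integral>\<^sup>+ i. ennreal (- (D i i * ln (D i i))) \<partial>count_space UNIV)
      \<le> (\<integral>\<^sup>+ i. ennreal (- ?v i) + ennreal (?e i) \<partial>count_space UNIV)"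
  proof (rule nn_integral_mono)
    fix i
    have "ennreal (- (D i i * ln (D i i))) \<le> ennreal (- ?v i + ?e i)"
      by (rule ennreal_leI[OF entry])
    \<comment> \<open>\<open>ennreal\<close> sends negative numbers to 0 and is additive on
      nonnegative ones; the maximum with 0 prepares the splitting.\<close>
    also have "\<dots> \<le> ennreal (max 0 (- ?v i) + ?e i)" by (rule ennreal_leI) simp
    also have "\<dots> = ennreal (- ?v i) + ennreal (?e i)"
      using e_nn[of i] by (simp add: ennreal_plus max_def ennreal_neg)
    finally show "ennreal (- (D i i * ln (D i i))) \<le> ennreal (- ?v i) + ennreal (?e i)" .
  qed
  also have "\<dots> = (\<integral>\<^sup>+ i. ennreal (- ?v i) \<partial>count_space UNIV) + (\<integral>\<^sup>+ i. ennreal (?e i) \<partial>count_space UNIV)"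
    by (rule nn_integral_add) auto
  also have "(\<integral>\<^sup>+ i. ennreal (?e i) \<partial>count_space UNIV) = ennreal E"
    unfolding nn_integral_count_space_nat
    by (rule suminf_ennreal_eq[OF e_nn has_sum_imp_sums[OF tot]])
  also have "(\<integral>\<^sup>+ i. ennreal (- ?v i) \<partial>count_space UNIV) = von_neumann_entropy (\<lambda>i j. complex_of_real (pinch m D i j))"
    by (rule von_neumann_entropy_eq[OF V, symmetric])
  finally show ?thesis using ES by (meson add_left_mono ennreal_leI order_trans)
qed

section \<open>Entropy of the diagonal part\<close>

lemma diagonalizes_diag:
  "diagonalizes op_one (\<lambda>i. D i i) (\<lambda>i j. if i = j then complex_of_real (D i i) else 0)"
proof -
  have one: "unitary_op (op_one :: nat opr)"
  proof (rule unitary_opI)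
    fix i j :: nat
    show "((\<lambda>k. op_one i k * cnj (op_one j k)) has_sum (if i = j then 1 else 0)) UNIV"
      using has_sum_single[of i "\<lambda>k. op_one i k * cnj (op_one j k) :: complex"] 
      by (cases "i = j") (simp_all add: op_one_def)
    show "((\<lambda>k. cnj (op_one k i) * op_one k j) has_sum (if i = j then 1 else 0)) UNIV"
      using has_sum_single[of i "\<lambda>k. cnj (op_one k i) * op_one k j :: complex"] by (simp add: op_one_def)
  qed
  have "D i i \<le> (\<Sum>\<^sub>\<infinity>n. D n n)" for i
    using finite_sum_le_infsum[OF D_diag_summable, of "{i}"] less_imp_le[OF D_diag_pos] by simp
  then have "bounded (range (\<lambda>i. D i i))"
    unfolding bounded_iff using less_imp_le[OF D_diag_pos] by (intro exI[of _ "\<Sum>\<^sub>\<infinity>n. D n n"]) auto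
  moreover have "conj_by op_one (diag_op (\<lambda>k. complex_of_real (D k k))) i j = (if i = j then complex_of_real (D i i) else 0)" for i j
    using infsumI[OF has_sum_single[of i "\<lambda>k. op_one i k * complex_of_real (D k k) * cnj (op_one j k)"]]
    by (cases "i = j") (simp_all add: conj_by_diag op_one_def)
  ultimately show ?thesis using one by (simp add: diagonalizes_def fun_eq_iff)
qed

lemma von_neumann_entropy_diag:
  "von_neumann_entropy (\<lambda>i j. if i = j then complex_of_real (D i i) else 0)
    = (\<integral>\<^sup>+ i. ennreal (- (D i i * ln (D i i))) \<partial>count_space UNIV)"
proof -
  have "(\<Sum>\<^sub>\<infinity>k. (cmod (op_one i k))\<^sup>2 * (D k k * ln (D k k))) = D i i * ln (D i i)" for i :: nat
    using infsumI[OF has_sum_single[of i "\<lambda>k. (cmod (op_one i k))\<^sup>2 * (D k k * ln (D k k))"]]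
    by (simp add: op_one_def)
  then show ?thesis unfolding von_neumann_entropy_eq[OF diagonalizes_diag] by simp
qed

end

section \<open>Comparison of the bound with \<open>xi\<close>\<close>

context displaced_thermal_state
begin

definition xi_term :: "real \<Rightarrow> nat \<Rightarrow> nat \<Rightarrow> real" where
  "xi_term \<kappa> m k = (g\<^sup>2 / N\<^sup>2) ^ (m * Suc k) / fact (m * Suc k) * ((real m)\<^sup>2 * (real (Suc k))\<^sup>2 * \<kappa> + 2)
     * (Q (m * Suc k) ^ (m * Suc k) / (1 - Q (m * Suc k)) ^ (m * Suc k + 1))"

lemma Q_le_Q1: "1 \<le> d \<Longrightarrow> Q d \<le> Q 1"
  unfolding Q_def using param_facts by (intro mult_left_mono add_left_mono divide_left_mono) auto

text \<open>Q 1 = q + c^2 / 2 with 1 - q = 1 / (N + 1), so the assumption is equivalent to the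
  claim. It is the hypothesis on N_T of the theorem.\<close>

lemma Q1_less_1:
  assumes "g\<^sup>2 < 2 * (N + 1)"
  shows "Q 1 < 1"
proof -
  have "Q 1 = q + c\<^sup>2 / 2"
    unfolding param_facts(6)[symmetric] by (simp add: Q_def distrib_left)
  moreover have "q = 1 - 1 / (N + 1)" using N by (simp add: q_def field_simps)
  moreover have "c\<^sup>2 < 2 / (N + 1)"
  proof -
    have "g\<^sup>2 / (N + 1) < 2" using assms N by (simp add: pos_divide_less_eq)
    then have "g\<^sup>2 / (N + 1) / (N + 1) < 2 / (N + 1)" using N by (intro divide_strict_right_mono) auto
    then show ?thesis by (simp add: c_def power2_eq_square)
  qed
  ultimately show ?thesis by simp
qed

text \<open>From y = (g^2 / N^2) q and q <= Q d follows y^d <= (g^2 / N^2)^d (Q d)^d, while the 2 of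
  \<open>class_bound\<close> is at most the bracket m^2 \<Delta>^2 \<kappa> + 2.\<close>

lemma class_bound_le_xi_term:
  assumes "Q (m * Suc k) < 1" "0 \<le> \<kappa>"
  shows "0 \<le> class_bound m k" "class_bound m k \<le> K * xi_term \<kappa> m k"
proof -
  let ?d = "m * Suc k"
  let ?W = "K / fact ?d * (1 / (1 - Q ?d) ^ (?d + 1))"
    and ?L = "((real m)\<^sup>2 * (real (Suc k))\<^sup>2 * \<kappa> + 2) * (g\<^sup>2 / N\<^sup>2 * Q ?d) ^ ?d"
  have pos: "0 < 1 - Q ?d" using assms by simp
  then have W: "0 \<le> 1 / (1 - Q ?d) ^ (?d + 1)" by simp
  show "0 \<le> class_bound m k"
    unfolding class_bound_def using param_facts pos by simp
  have "y = g\<^sup>2 / N\<^sup>2 * q"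
    using N by (simp add: y_def q_def power2_eq_square)
  also have "\<dots> \<le> g\<^sup>2 / N\<^sup>2 * Q ?d"
    unfolding Q_def using param_facts by (intro mult_left_mono) auto
  finally have "y ^ ?d \<le> (g\<^sup>2 / N\<^sup>2 * Q ?d) ^ ?d"
    using param_facts by (intro power_mono) auto
  moreover have "2 \<le> (real m)\<^sup>2 * (real (Suc k))\<^sup>2 * \<kappa> + 2" using assms by simp
  moreover have "0 \<le> (g\<^sup>2 / N\<^sup>2 * Q ?d) ^ ?d"
    using less_imp_le[OF Q_pos] by (intro zero_le_power mult_nonneg_nonneg) auto
  ultimately have "2 * y ^ ?d \<le> ?L"
    using param_facts by (intro mult_mono) auto
  then have "2 * y ^ ?d * ?W
      \<le> ?L * ?W"
    using W param_facts by (intro mult_right_mono mult_nonneg_nonneg) auto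
  moreover have "2 * y ^ ?d * ?W = class_bound m k"
    unfolding class_bound_def by (simp del: mult_Suc_right power_Suc)
  moreover have "?L * ?W
      = K * xi_term \<kappa> m k"
    unfolding xi_term_def power_mult_distrib by (simp del: mult_Suc_right power_Suc of_nat_Suc)
  ultimately show "class_bound m k \<le> K * xi_term \<kappa> m k" by simp
qed

text \<open>\<open>suminf\<close> of a divergent series carries no information, so convergence has
  to precede any comparison with \<open>xi\<close>. Q n <= Q 1 keeps 1 - Q n away from 0, and the
  factorial beats the remaining geometric growth.\<close>

lemma xi_term_summable:
  assumes m: "0 < m" and Q1: "Q 1 < 1" and \<kappa>: "0 \<le> \<kappa>"
  shows "summable (xi_term \<kappa> m)"
proof -
  define \<delta> where "\<delta> = 1 - Q 1"
  have \<delta>: "0 < \<delta>" using Q1 by (simp add: \<delta>_def)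
  \<comment> \<open>The factor 4 pays for the quadratic prefactor through n^2 <= 4^n; the rest is
    the growth left after bounding 1 - Q n below by \<delta>.\<close>
  define a where "a = 4 * (g\<^sup>2 / N\<^sup>2 / \<delta>)"
  let ?d = "\<lambda>k. m * Suc k"
  have "(\<lambda>n. a ^ n / fact n) summable_on range ?d"
    by (rule summable_on_subset_banach[OF has_sum_imp_summable[OF exp_has_sum[of a]]]) simp
  moreover have "inj ?d" using m by (auto simp: inj_def)
  ultimately have "(\<lambda>k. a ^ ?d k / fact (?d k)) summable_on UNIV"
    using summable_on_reindex[of ?d UNIV "\<lambda>n. a ^ n / fact n"] by (simp add: o_def)
  then have "summable (\<lambda>k. (\<kappa> + 2) / \<delta> * (a ^ ?d k / fact (?d k)))"
    by (intro summable_mult summable_on_imp_summable)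
  then show ?thesis
  proof (rule summable_comparison_test')
    fix k
    let ?n = "?d k"
    let ?G = "(g\<^sup>2 / N\<^sup>2) ^ ?n / fact ?n" and ?H = "Q ?n ^ ?n / (1 - Q ?n) ^ (?n + 1)"
    have n1: "1 \<le> ?n" using m by simp
    have Qn: "0 < Q ?n" "Q ?n \<le> 1" "\<delta> \<le> 1 - Q ?n"
      using Q_pos Q_le_Q1[OF n1] Q1 by (auto simp: \<delta>_def)
    have sq: "(real ?n)\<^sup>2 * \<kappa> + 2 \<le> 4 ^ ?n * (\<kappa> + 2)"
    proof -
      have "real ?n \<le> 2 ^ ?n" by (rule less_imp_le[OF of_nat_less_two_power])
      then have "(real ?n)\<^sup>2 \<le> (2 ^ ?n)\<^sup>2" by (intro power_mono) auto
      also have "\<dots> = 4 ^ ?n" by (simp only: power2_eq_square power_mult_distrib[symmetric]) simp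
      finally have "(real ?n)\<^sup>2 * \<kappa> \<le> 4 ^ ?n * \<kappa>" using \<kappa> by (rule mult_right_mono)
      moreover have "2 \<le> (4::real) ^ ?n * 2" by (simp del: mult_Suc_right)
      ultimately show ?thesis by (simp only: distrib_left)
    qed
    have frac: "?H \<le> 1 / \<delta> ^ (?n + 1)"
      using Qn \<delta> by (intro frac_le power_le_one power_mono) auto
    have fnn: "0 \<le> ?H"
      using Qn \<delta> by (intro divide_nonneg_nonneg zero_le_power) auto
    have \<kappa>nn: "0 \<le> (real ?n)\<^sup>2 * \<kappa> + 2" using \<kappa> by simp
    have nn: "0 \<le> ?G" by simp
    have "xi_term \<kappa> m k = ?G * (((real ?n)\<^sup>2 * \<kappa> + 2) * (?H))"
      unfolding xi_term_def of_nat_mult power_mult_distrib by (simp only: mult.assoc)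
    moreover have "0 \<le> \<dots>" by (intro mult_nonneg_nonneg nn fnn \<kappa>nn)
    moreover have "?G * (((real ?n)\<^sup>2 * \<kappa> + 2) * (?H))
        \<le> ?G * ((4 ^ ?n * (\<kappa> + 2)) * (1 / \<delta> ^ (?n + 1)))"
      using \<kappa> by (intro mult_left_mono[OF _ nn] mult_mono sq frac fnn) auto
    moreover have "?G * ((4 ^ ?n * (\<kappa> + 2)) * (1 / \<delta> ^ (?n + 1))) = (\<kappa> + 2) / \<delta> * (a ^ ?n / fact ?n)"
      unfolding a_def power_mult_distrib power_divide[of _ \<delta>] power_add power_one_right by (simp add: mult_ac del: mult_Suc_right)
    ultimately show "norm (xi_term \<kappa> m k) \<le> (\<kappa> + 2) / \<delta> * (a ^ ?n / fact ?n)"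
      by (simp only: real_norm_def abs_of_nonneg)
  qed
qed

lemma class_bound_sum_le_xi:
  assumes m: "0 < m" and g2: "g\<^sup>2 < 2 * (N + 1)" and \<kappa>: "0 \<le> \<kappa>"
  obtains S where "(class_bound m has_sum S) UNIV" "S \<le> K * (\<Sum>k. xi_term \<kappa> m k)"
proof -
  note Q1 = Q1_less_1[OF g2]
  have Qk: "Q (m * Suc k) < 1" for k
    using Q_le_Q1[of "m * Suc k"] Q1 m by simp
  note cb = class_bound_le_xi_term[OF Qk \<kappa>]
  have sm: "summable (\<lambda>k. K * xi_term \<kappa> m k)"
    by (rule summable_mult[OF xi_term_summable[OF m Q1 \<kappa>]])
  have scb: "summable (class_bound m)"
    by (rule summable_comparison_test'[OF sm]) (use cb in auto)
  have "(class_bound m has_sum (\<Sum>k. class_bound m k)) UNIV"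
    by (rule sums_nonneg_imp_has_sum[OF summable_sums[OF scb] cb(1)])
  moreover have "(\<Sum>k. class_bound m k) \<le> K * (\<Sum>k. xi_term \<kappa> m k)"
    using suminf_le[OF cb(2) scb sm] suminf_mult[OF xi_term_summable[OF m Q1 \<kappa>], of K] by simp
  ultimately show thesis by (rule that)
qed

text \<open>The exponents combine as s/(N(N+1)) - s/N = - s/(N+1), so the prefactor of
  \<open>xi\<close> is the vacuum entry of \<open>D\<close>.\<close>

lemma xi_eq:
  assumes "g\<^sup>2 = \<eta> * \<tau> * (cmod \<alpha>)\<^sup>2"
  shows "xi \<eta> \<tau> \<alpha> N m = K * (\<Sum>k. xi_term ((\<bar>ln (N / (N + 1))\<bar> + ln (1 + g\<^sup>2 / (N * (N + 1))))\<^sup>2) m k)"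
proof -
  have "exp (g\<^sup>2 / (N * (N + 1))) / (N + 1) * exp (- (g\<^sup>2 / N)) = K"
  proof -
    have "g\<^sup>2 / N - g\<^sup>2 / (N + 1) = (g\<^sup>2 * (N + 1) - g\<^sup>2 * N) / (N * (N + 1))"
      using N by (intro diff_frac_eq) auto
    moreover have "g\<^sup>2 * (N + 1) - g\<^sup>2 * N = g\<^sup>2" by (simp add: algebra_simps)
    ultimately have "g\<^sup>2 / (N * (N + 1)) + - (g\<^sup>2 / N) = - g\<^sup>2 / (N + 1)" by simp
    then have "exp (g\<^sup>2 / (N * (N + 1))) * exp (- (g\<^sup>2 / N)) = exp (- g\<^sup>2 / (N + 1))"
      by (simp only: exp_add[symmetric])
    then show ?thesis by (simp add: K_def)
  qed
  moreover have "N / (N + 1) * (1 + g\<^sup>2 / (N * (N + 1) * (real m * real (Suc k) + 1))) = Q (m * Suc k)" for k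
    unfolding Q_def q_def y_def of_nat_mult by simp
  ultimately show ?thesis
    unfolding xi_def Let_def assms[symmetric] xi_term_def by (simp only:)
qed

end

section \<open>Averaged two-mode states and the conclusion\<close>

lemma rho_BI_phase:
  fixes \<eta> \<tau> N_B :: real and \<alpha> :: complex
  assumes "0 < \<eta>" "\<eta> < 1" "0 < N_B"
  defines "D \<equiv> displaced_thermal ((1 - \<eta>) * N_B) (sqrt \<eta> * (sqrt \<tau> * cmod \<alpha>))"
  shows "rho_BI \<eta> N_B \<tau> \<alpha> \<theta> x y = cis (\<theta> * real (fst x)) * cnj (cis (\<theta> * real (fst y))) *
    phase_conj (\<lambda>x. cis (Arg \<alpha> * real (fst x)))
      (tensor_op (\<lambda>b b'. complex_of_real (D b b')) (proj (coherent (complex_of_real (sqrt (1 - \<tau>)) * \<alpha>)))) x y"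
  unfolding rho_BI_eq[OF assms(1-3)] D_def phase_conj_def distrib_right cis_mult[symmetric] complex_cnj_mult
  by (simp only: mult_ac)

lemma psk_average_eq:
  fixes \<eta> \<tau> N_B :: real and \<alpha> :: complex
  assumes "0 < \<eta>" "\<eta> < 1" "0 < N_B" and m: "0 < m"
  defines "D \<equiv> displaced_thermal ((1 - \<eta>) * N_B) (sqrt \<eta> * (sqrt \<tau> * cmod \<alpha>))"
  shows "(\<lambda>x y. (\<Sum>k<m. rho_BI \<eta> N_B \<tau> \<alpha> (2 * pi * real k / real m) x y) / of_nat m)
    = phase_conj (\<lambda>x. cis (Arg \<alpha> * real (fst x)))
       (tensor_op (\<lambda>b b'. complex_of_real (pinch m D b b')) (proj (coherent (complex_of_real (sqrt (1 - \<tau>)) * \<alpha>))))"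
    (is "_ = ?A")
proof (intro ext)
  fix x y :: "nat \<times> nat"
  show "(\<Sum>k<m. rho_BI \<eta> N_B \<tau> \<alpha> (2 * pi * real k / real m) x y) / of_nat m = ?A x y"
    using sum_phases[OF m, of "fst x" "fst y"]
    unfolding rho_BI_phase[OF assms(1-3)] sum_distrib_right[symmetric]
    by (simp only: times_divide_eq_left[symmetric]) (simp add: phase_conj_def tensor_op_def pinch_def D_def)
qed

lemma ring_average_eq:
  fixes \<eta> \<tau> N_B :: real and \<alpha> :: complex
  assumes "0 < \<eta>" "\<eta> < 1" "0 < N_B"
  defines "D \<equiv> displaced_thermal ((1 - \<eta>) * N_B) (sqrt \<eta> * (sqrt \<tau> * cmod \<alpha>))"
  shows "(\<lambda>x y. integral {0..2 * pi} (\<lambda>\<theta>. rho_BI \<eta> N_B \<tau> \<alpha> \<theta> x y) / complex_of_real (2 * pi))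
    = phase_conj (\<lambda>x. cis (Arg \<alpha> * real (fst x)))
       (tensor_op (\<lambda>b b'. if b = b' then complex_of_real (D b b) else 0) (proj (coherent (complex_of_real (sqrt (1 - \<tau>)) * \<alpha>))))"
    (is "_ = ?A")
proof (intro ext)
  fix x y :: "nat \<times> nat"
  show "integral {0..2 * pi} (\<lambda>\<theta>. rho_BI \<eta> N_B \<tau> \<alpha> \<theta> x y) / complex_of_real (2 * pi) = ?A x y"
    using integral_phases[of "fst x" "fst y"]
    unfolding rho_BI_phase[OF assms(1-3)] integral_mult_left
    by (simp only: times_divide_eq_left[symmetric]) (simp add: phase_conj_def tensor_op_def D_def)
qed

theorem proposition7:
  fixes \<eta> \<tau> N_B N_T :: real and \<alpha> :: complex and m :: nat
  assumes "0 < \<eta>" and "\<eta> < 1"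
    and "0 \<le> \<tau>" and "\<tau> \<le> 1"
    and "N_B > 0" and "N_T = (1 - \<eta>) * N_B"
    and "m > 0"
    and "N_T > \<eta> * \<tau> * (cmod \<alpha>)\<^sup>2 / 2 - 1"
  shows "chi_PSK_coherent m \<eta> N_B \<tau> \<alpha>
           \<ge> chi_ring_coherent \<eta> N_B \<tau> \<alpha> - ereal (xi \<eta> \<tau> \<alpha> N_T m)"
proof -
  define g where "g = sqrt \<eta> * (sqrt \<tau> * cmod \<alpha>)"
  let ?\<gamma> = "coherent (complex_of_real (sqrt (1 - \<tau>)) * \<alpha>)"
  let ?\<kappa> = "(\<bar>ln (N_T / (N_T + 1))\<bar> + ln (1 + g\<^sup>2 / (N_T * (N_T + 1))))\<^sup>2"
  have g2: "g\<^sup>2 = \<eta> * \<tau> * (cmod \<alpha>)\<^sup>2"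
    using assms by (simp add: g_def power_mult_distrib)
  interpret displaced_thermal_state N_T g
    using assms by unfold_locales (simp_all add: g_def)
  have small: "g\<^sup>2 < 2 * (N_T + 1)" unfolding g2 using assms(8) by (simp add: field_simps)
  have Qk: "Q (m * Suc k) < 1" for k
    using Q_le_Q1[of "m * Suc k"] Q1_less_1[OF small] assms(7) by simp
  obtain S where S: "(class_bound m has_sum S) UNIV" and S_le: "S \<le> K * (\<Sum>k. xi_term ?\<kappa> m k)"
    by (rule class_bound_sum_le_xi[OF assms(7) small, of ?\<kappa>]) (simp, rule that)
  have S_xi: "S \<le> xi \<eta> \<tau> \<alpha> N_T m" unfolding xi_eq[OF g2] by (rule S_le)
  have "0 \<le> S"
    by (rule has_sum_nonneg[OF S]) (rule class_bound_le_xi_term(1)[OF Qk, of 0], simp)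
  obtain V p where V: "diagonalizes V p (\<lambda>i j. complex_of_real (pinch m D i j))" and p: "\<And>k. 0 \<le> p k"
    by (rule diagonalizes_hilbert_schmidt[OF hilbert_schmidt_pinch[OF assms(7)]]) (rule that)
  obtain W r where W: "diagonalizes W r (proj ?\<gamma>)"
    by (rule diagonalizes_proj[OF coherent_norm]) (rule that)
  define H0 where "H0 = von_neumann_entropy (tensor_op (\<lambda>b b'. complex_of_real (D b b')) (proj ?\<gamma>))"
  define HP where "HP = von_neumann_entropy (\<lambda>i j. complex_of_real (pinch m D i j))"
  define HR where "HR = von_neumann_entropy (\<lambda>b b'. if b = b' then complex_of_real (D b b) else 0)"
  have H\<theta>: "von_neumann_entropy (rho_BI \<eta> N_B \<tau> \<alpha> \<theta>) = H0" for \<theta>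
    unfolding rho_BI_eq[OF assms(1,2,5)] H0_def g_def assms(6)
    by (rule von_neumann_entropy_phase_conj) simp
  have psk: "von_neumann_entropy (\<lambda>x y. (\<Sum>k<m. rho_BI \<eta> N_B \<tau> \<alpha> (2 * pi * real k / real m) x y) / of_nat m) = HP"
    unfolding psk_average_eq[OF assms(1,2,5,7)] g_def[symmetric] assms(6)[symmetric] HP_def
    by (subst von_neumann_entropy_phase_conj) (simp, rule von_neumann_entropy_tensor_proj[OF V W coherent_norm])
  have ring: "von_neumann_entropy (\<lambda>x y. integral {0..2 * pi} (\<lambda>\<theta>. rho_BI \<eta> N_B \<tau> \<alpha> \<theta> x y) / complex_of_real (2 * pi)) = HR"
    unfolding ring_average_eq[OF assms(1,2,5)] g_def[symmetric] assms(6)[symmetric] HR_def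
    by (subst von_neumann_entropy_phase_conj) (simp, rule von_neumann_entropy_tensor_proj[OF diagonalizes_diag W coherent_norm])
  have "HR \<le> HP + ennreal S"
    unfolding HR_def HP_def von_neumann_entropy_diag by (rule pinched_entropy_bound[OF assms(7) Qk S V p])
  also have "\<dots> \<le> HP + ennreal (xi \<eta> \<tau> \<alpha> N_T m)"
    by (intro add_left_mono ennreal_leI S_xi)
  \<comment> \<open>\<open>ennreal\<close> keeps the value of xi because xi >= S >= 0.\<close>
  finally have "enn2ereal HR \<le> enn2ereal HP + ereal (xi \<eta> \<tau> \<alpha> N_T m)"
    using \<open>0 \<le> S\<close> S_xi by (simp add: less_eq_ennreal.rep_eq plus_ennreal.rep_eq enn2ereal_ennreal)
  \<comment> \<open>Multiplying and dividing by a finite nonzero number cancels in [0,\<infinity>]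
    even when the entropy is infinite.\<close>
  moreover have "(\<Sum>k<m. von_neumann_entropy (rho_BI \<eta> N_B \<tau> \<alpha> (2 * pi * real k / real m))) / of_nat m = H0"
    unfolding H\<theta> using assms(7) mult_divide_eq_ennreal[of "of_nat m" H0] by (simp add: mult.commute)
  moreover have "(\<integral>\<^sup>+ \<theta>\<in>{0..2 * pi}. von_neumann_entropy (rho_BI \<eta> N_B \<tau> \<alpha> \<theta>) \<partial>lborel) / ennreal (2 * pi) = H0"
    unfolding H\<theta> using mult_divide_eq_ennreal[of "ennreal (2 * pi)" H0]
    by (simp add: nn_integral_cmult_indicator)
  ultimately show ?thesis
    unfolding chi_PSK_coherent_def chi_ring_coherent_def psk_holevo_def ring_holevo_def psk ring
    \<comment> \<open>Infinite entropies are included: an infinite \<open>HR\<close> forces an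
      infinite \<open>HP\<close>, and in \<open>ereal\<close> the difference \<infinity> -
      \<infinity> is \<infinity>.\<close>
    by (cases "enn2ereal HR"; cases "enn2ereal HP"; cases "enn2ereal H0") auto
qed

end
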